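(* Let $M$ be a contact $3$-manifold, let $\rho:M\to B$ and $\rho^\vee:M\to B^\vee$ be a pair of transverse Legendrian fibrations, and let $\mathcal{V}\subset M$ be a smooth surface. The curve of inflections of the characteristic fronts of $\mathcal{V}$ (by $\rho$) is the image under $\rho$ of the $\rho^\vee$-contour $\widehat{I}$ of $\mathcal{V}$.
   Context: A fibration of a contact 3-manifold $M$ over a surface is Legendrian if its fibres are Legendre curves (integral curves of the contact plane field). Two Legendrian fibrations are transverse if their fibres are nowhere tangent. At a point of $\mathcal{V}$ where the tangent plane of $\mathcal V$ differs from the contact plane, their intersection is the characteristic line; the integral curves of this field of lines are the characteristics of $\mathcal{V}$. The points where the two planes coincide are called characteristic points. A characteristic front of $\mathcal{V}$ is the image $\rho(\gamma)$ in $B$ of a characteristic $\gamma$ of $\mathcal V$. A line of $B$ is the image by $\rho$ of a $\rho^\vee$-fibre. An inflection of a smoothly immersed curve in $B$ is a point at which the curve has at least 3-point contact with a line of $B$; the curve of inflections of the characteristic fronts is the curve formed by their inflections. The $\rho^\vee$-contour $\widehat{I}$ of $\mathcal{V}$ is the set of critical points of $\rho^\vee|_{\mathcal{V}}:\mathcal{V}\to B^\vee$.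
   Formalization: Characteristic points are removed from the contour (no characteristic passes through them); inflections mean 3-point contact with the line through the same point of M, or with any line if distinct points of M give distinct contact elements of B. The literal claim fails otherwise. *)

theory Defs
  imports "HOL-Analysis.Analysis"
begin

section \<open>Smooth maps and smooth manifolds\<close>

text \<open>On an open subset of a Euclidean space, a map is of class \<open>C\<^sup>k\<^sup>+\<^sup>1\<close> iff it is differentiable and all its
  directional derivatives are of class \<open>C\<^sup>k\<close>.  The definitions are only used for open \<open>S\<close>.\<close>

primrec Ck_on :: "nat \<Rightarrow> 'a::euclidean_space set \<Rightarrow> ('a \<Rightarrow> 'b::real_normed_vector) \<Rightarrow> bool" where
  "Ck_on 0 S f \<longleftrightarrow> continuous_on S f"
| "Ck_on (Suc k) S f \<longleftrightarrow> (\<forall>x\<in>S. f differentiable (at x)) \<and>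
     (\<forall>v. Ck_on k S (\<lambda>x. frechet_derivative f (at x) v))"

definition smooth_on :: "'a::euclidean_space set \<Rightarrow> ('a \<Rightarrow> 'b::real_normed_vector) \<Rightarrow> bool" where
  "smooth_on S f \<longleftrightarrow> (\<forall>k. Ck_on k S f)"

text \<open>A manifold is a whole (Hausdorff, second countable) type with an atlas; its dimension is that
  of the model space \<open>'e\<close>.\<close>

type_synonym ('m, 'e) chart = "'m set \<times> ('m \<Rightarrow> 'e)"
type_synonym ('m, 'e) atlas = "('m, 'e) chart set"

definition chart_inv :: "('m, 'e) chart \<Rightarrow> 'e \<Rightarrow> 'm" where
  "chart_inv c = inv_into (fst c) (snd c)"

definition smooth_manifold :: "('m::topological_space, 'e::euclidean_space) atlas \<Rightarrow> bool" where
  "smooth_manifold A \<longleftrightarrow>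
     (\<Union>c\<in>A. fst c) = UNIV \<and>
     (\<forall>c\<in>A. open (fst c) \<and> open (snd c ` fst c) \<and>
        homeomorphism (fst c) (snd c ` fst c) (snd c) (chart_inv c)) \<and>
     (\<forall>c\<in>A. \<forall>d\<in>A. smooth_on (snd c ` (fst c \<inter> fst d)) (snd d \<circ> chart_inv c))"

definition std_atlas :: "('e::euclidean_space, 'e) atlas" where
  "std_atlas = {(UNIV, id)}"

definition smooth_map ::
  "('m::topological_space, 'e::euclidean_space) atlas \<Rightarrow> ('n::topological_space, 'f::euclidean_space) atlas
    \<Rightarrow> ('m \<Rightarrow> 'n) \<Rightarrow> 'm set \<Rightarrow> bool" where
  "smooth_map A B f S \<longleftrightarrow>
     (\<forall>p\<in>S. \<exists>c\<in>A. \<exists>d\<in>B. \<exists>N. open N \<and> p \<in> N \<and> N \<subseteq> S \<inter> fst c \<and> f ` N \<subseteq> fst d \<and>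
        smooth_on (snd c ` N) (snd d \<circ> f \<circ> chart_inv c))"

section \<open>Tangent vectors\<close>

text \<open>A tangent vector at \<open>p\<close> is the family of its coordinate expressions in the charts at \<open>p\<close>,
  extended by 0 to all other pairs; the zero vector is therefore \<open>\<lambda>_. 0\<close>.\<close>

type_synonym ('m, 'e) tvec = "('m, 'e) chart \<Rightarrow> 'e"

definition tangent_space ::
  "('m, 'e::euclidean_space) atlas \<Rightarrow> 'm \<Rightarrow> ('m, 'e) tvec set" where
  "tangent_space A p = {v.
     (\<forall>c. \<not> (c \<in> A \<and> p \<in> fst c) \<longrightarrow> v c = 0) \<and>
     (\<forall>c\<in>A. \<forall>d\<in>A. p \<in> fst c \<longrightarrow> p \<in> fst d \<longrightarrow>
        v d = frechet_derivative (snd d \<circ> chart_inv c) (at (snd c p)) (v c))}"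

text \<open>For \<open>v\<close> tangent at \<open>p\<close> the value does not depend on the chart selected in the source.\<close>

definition differential ::
  "('m, 'e::euclidean_space) atlas \<Rightarrow> ('n, 'f::euclidean_space) atlas
    \<Rightarrow> ('m \<Rightarrow> 'n) \<Rightarrow> 'm \<Rightarrow> ('m, 'e) tvec \<Rightarrow> ('n, 'f) tvec" where
  "differential A B f p v =
     (\<lambda>d. if d \<in> B \<and> f p \<in> fst d then
            (let c = (SOME c. c \<in> A \<and> p \<in> fst c)
             in frechet_derivative (snd d \<circ> f \<circ> chart_inv c) (at (snd c p)) (v c))
          else 0)"

definition velocity ::
  "('m, 'e::euclidean_space) atlas \<Rightarrow> (real \<Rightarrow> 'm) \<Rightarrow> real \<Rightarrow> ('m, 'e) tvec" where
  "velocity A \<gamma> t =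
     (\<lambda>c. if c \<in> A \<and> \<gamma> t \<in> fst c then vector_derivative (snd c \<circ> \<gamma>) (at t) else 0)"

text \<open>Tangent space at \<open>p\<close> of a submanifold \<open>S\<close>: the velocities of the smooth curves contained in \<open>S\<close>.\<close>

definition tangent_to ::
  "('m::topological_space, 'e::euclidean_space) atlas \<Rightarrow> 'm set \<Rightarrow> 'm \<Rightarrow> ('m, 'e) tvec set" where
  "tangent_to A S p = {v. \<exists>\<gamma> \<epsilon>. \<epsilon> > 0 \<and> smooth_map std_atlas A \<gamma> {-\<epsilon><..<\<epsilon>} \<and>
     \<gamma> ` {-\<epsilon><..<\<epsilon>} \<subseteq> S \<and> \<gamma> 0 = p \<and> v = velocity A \<gamma> 0}"

definition nonzero_differential ::
  "('m::topological_space, 'e::euclidean_space) atlas \<Rightarrow> ('m \<Rightarrow> real) \<Rightarrow> 'm \<Rightarrow> bool" where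
  "nonzero_differential A g p \<longleftrightarrow>
     (\<exists>v\<in>tangent_space A p. differential A std_atlas g p v \<noteq> (\<lambda>_. 0))"

definition smooth_surface ::
  "('m::topological_space, real^3) atlas \<Rightarrow> 'm set \<Rightarrow> bool" where
  "smooth_surface A V \<longleftrightarrow>
     (\<forall>p\<in>V. \<exists>N f. open N \<and> p \<in> N \<and> smooth_map A std_atlas f N \<and> nonzero_differential A f p \<and>
        V \<inter> N = {q\<in>N. f q = (0::real)})"

section \<open>Contact structures and Legendrian fibrations\<close>

text \<open>A 1-form on an open subset of \<open>\<real>\<^sup>3\<close> is given by its coefficient vector field \<open>\<alpha>\<close>.\<close>

definition ext_deriv :: "(real^3 \<Rightarrow> real^3) \<Rightarrow> real^3 \<Rightarrow> real^3 \<Rightarrow> real^3 \<Rightarrow> real" where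
  "ext_deriv \<alpha> x u v =
     frechet_derivative \<alpha> (at x) u \<bullet> v - frechet_derivative \<alpha> (at x) v \<bullet> u"

definition wedge_ext_deriv :: "(real^3 \<Rightarrow> real^3) \<Rightarrow> real^3 \<Rightarrow> real^3 \<Rightarrow> real^3 \<Rightarrow> real^3 \<Rightarrow> real" where
  "wedge_ext_deriv \<alpha> x u v w =
     (\<alpha> x \<bullet> u) * ext_deriv \<alpha> x v w + (\<alpha> x \<bullet> v) * ext_deriv \<alpha> x w u + (\<alpha> x \<bullet> w) * ext_deriv \<alpha> x u v"

text \<open>\<open>\<xi> q\<close> is the contact plane at \<open>q\<close>: locally the kernel of a 1-form with \<open>\<alpha> \<and> d\<alpha> \<noteq> 0\<close>.
  No global contact form (co-orientation) is required.\<close>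

definition contact_structure ::
  "('m::topological_space, real^3) atlas \<Rightarrow> ('m \<Rightarrow> ('m, real^3) tvec set) \<Rightarrow> bool" where
  "contact_structure M \<xi> \<longleftrightarrow>
     (\<forall>p. \<exists>c\<in>M. \<exists>N \<alpha>. open N \<and> p \<in> N \<and> N \<subseteq> fst c \<and> smooth_on (snd c ` N) \<alpha> \<and>
        (\<forall>q\<in>N. \<xi> q = {v\<in>tangent_space M q. \<alpha> (snd c q) \<bullet> v c = 0} \<and>
               (\<exists>u v w. wedge_ext_deriv \<alpha> (snd c q) u v w \<noteq> 0)))"

definition fibre :: "('m \<Rightarrow> 'b) \<Rightarrow> 'm \<Rightarrow> 'm set" where
  "fibre \<rho> p = {q. \<rho> q = \<rho> p}"

text \<open>Locally trivial fibration: \<open>\<rho>\<close> is a surjective submersion and over a neighbourhood \<open>U\<close> of each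
  point \<open>b\<close> there is a smooth \<open>r\<close> onto the fibre \<open>F\<close> over \<open>b\<close> such that \<open>(\<rho>, r)\<close> is a diffeomorphism from
  the part of \<open>M\<close> over \<open>U\<close> to \<open>U \<times> F\<close>, that is, a bijection with injective differential (the dimensions
  of source and target agree, \<open>\<rho>\<close> being a submersion).\<close>

definition smooth_fibration ::
  "('m::topological_space, 'e::euclidean_space) atlas \<Rightarrow> ('b::topological_space, 'f::euclidean_space) atlas
    \<Rightarrow> ('m \<Rightarrow> 'b) \<Rightarrow> bool" where
  "smooth_fibration M B \<rho> \<longleftrightarrow>
     smooth_map M B \<rho> UNIV \<and> surj \<rho> \<and>
     (\<forall>p. differential M B \<rho> p ` tangent_space M p = tangent_space B (\<rho> p)) \<and>
     (\<forall>b. \<exists>U r. open U \<and> b \<in> U \<and> smooth_map M M r (\<rho> -` U) \<and>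
        bij_betw (\<lambda>p. (\<rho> p, r p)) (\<rho> -` U) (U \<times> \<rho> -` {b}) \<and>
        (\<forall>p\<in>\<rho> -` U. \<forall>v\<in>tangent_space M p.
           differential M B \<rho> p v = (\<lambda>_. 0) \<and> differential M M r p v = (\<lambda>_. 0) \<longrightarrow> v = (\<lambda>_. 0)))"

definition legendrian_fibration ::
  "('m::topological_space, real^3) atlas \<Rightarrow> ('m \<Rightarrow> ('m, real^3) tvec set) \<Rightarrow>
    ('b::topological_space, real^2) atlas \<Rightarrow> ('m \<Rightarrow> 'b) \<Rightarrow> bool" where
  "legendrian_fibration M \<xi> B \<rho> \<longleftrightarrow>
     smooth_fibration M B \<rho> \<and> (\<forall>p. tangent_to M (fibre \<rho> p) p \<subseteq> \<xi> p)"

definition transverse_fibrations ::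
  "('m::topological_space, real^3) atlas \<Rightarrow> ('m \<Rightarrow> 'b) \<Rightarrow> ('m \<Rightarrow> 'c) \<Rightarrow> bool" where
  "transverse_fibrations M \<rho> \<rho>' \<longleftrightarrow>
     (\<forall>p. tangent_to M (fibre \<rho> p) p \<inter> tangent_to M (fibre \<rho>' p) p = {\<lambda>_. 0})"

text \<open>\<open>\<rho>\<close> sends \<open>p\<close> to the contact element (tangent line of \<open>B\<close> at \<open>\<rho> p\<close>) that is the image of the contact
  plane at \<open>p\<close>.  The resulting map to the space of contact elements of \<open>B\<close> is an immersion;
  here it is required to be injective, as it is when \<open>M\<close> is the space \<open>PT\<^sup>*B\<close> of contact elements itself,
  but not, for example, on its double cover \<open>ST\<^sup>*B\<close>.\<close>

definition distinct_contact_elements ::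
  "('m::topological_space, real^3) atlas \<Rightarrow> ('m \<Rightarrow> ('m, real^3) tvec set) \<Rightarrow>
    ('b::topological_space, real^2) atlas \<Rightarrow> ('m \<Rightarrow> 'b) \<Rightarrow> bool" where
  "distinct_contact_elements M \<xi> B \<rho> \<longleftrightarrow>
     (\<forall>p q. \<rho> p = \<rho> q \<and> differential M B \<rho> p ` \<xi> p = differential M B \<rho> q ` \<xi> q \<longrightarrow> p = q)"

section \<open>Characteristics, fronts and inflections\<close>

definition characteristic_points ::
  "('m::topological_space, real^3) atlas \<Rightarrow> ('m \<Rightarrow> ('m, real^3) tvec set) \<Rightarrow> 'm set \<Rightarrow> 'm set" where
  "characteristic_points M \<xi> V = {p\<in>V. tangent_to M V p = \<xi> p}"

definition characteristic_line ::
  "('m::topological_space, real^3) atlas \<Rightarrow> ('m \<Rightarrow> ('m, real^3) tvec set) \<Rightarrow> 'm set \<Rightarrow> 'm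
    \<Rightarrow> ('m, real^3) tvec set" where
  "characteristic_line M \<xi> V p = tangent_to M V p \<inter> \<xi> p"

definition characteristic ::
  "('m::topological_space, real^3) atlas \<Rightarrow> ('m \<Rightarrow> ('m, real^3) tvec set) \<Rightarrow> 'm set
    \<Rightarrow> (real \<Rightarrow> 'm) \<Rightarrow> real set \<Rightarrow> bool" where
  "characteristic M \<xi> V \<gamma> I \<longleftrightarrow>
     open I \<and> connected I \<and> smooth_map std_atlas M \<gamma> I \<and>
     (\<forall>t\<in>I. \<gamma> t \<in> V - characteristic_points M \<xi> V \<and>
        velocity M \<gamma> t \<noteq> (\<lambda>_. 0) \<and> velocity M \<gamma> t \<in> characteristic_line M \<xi> V (\<gamma> t))"

text \<open>The \<open>\<rho>\<close>-image of a \<open>\<rho>'\<close>-fibre \<open>F\<close> may have several branches through a point, one for each point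
  \<open>q\<close> of \<open>F\<close> above it.  The curve \<open>c\<close> has at least \<open>k\<close>-point contact at \<open>t\<close> with the branch at \<open>q\<close> if \<open>g \<circ> c\<close>
  has a zero of multiplicity at least \<open>k\<close> at \<open>t\<close> for a local equation \<open>g = 0\<close> of that branch.\<close>

definition has_contact ::
  "('m::topological_space, real^3) atlas \<Rightarrow> ('b::topological_space, real^2) atlas \<Rightarrow> ('m \<Rightarrow> 'b) \<Rightarrow>
    nat \<Rightarrow> (real \<Rightarrow> 'b) \<Rightarrow> real \<Rightarrow> 'm set \<Rightarrow> 'm \<Rightarrow> bool" where
  "has_contact M B \<rho> k c t F q \<longleftrightarrow>
     q \<in> F \<and> \<rho> q = c t \<and>
     (\<exists>W N g. open W \<and> c t \<in> W \<and> open N \<and> q \<in> N \<and>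
        smooth_map B std_atlas g W \<and> nonzero_differential B g (c t) \<and>
        (\<forall>m\<in>N \<inter> F. g (\<rho> m) = 0) \<and>
        (\<forall>j<k. (deriv ^^ j) (g \<circ> c) t = (0::real)))"

text \<open>\<open>c\<close> is immersed at \<open>t\<close> and has at least 3-point contact there with the line of \<open>B\<close> that is the
  image of the \<open>\<rho>'\<close>-fibre through \<open>q\<close>.\<close>

definition inflection_along ::
  "('m::topological_space, real^3) atlas \<Rightarrow> ('b::topological_space, real^2) atlas \<Rightarrow> ('m \<Rightarrow> 'b) \<Rightarrow>
    ('m \<Rightarrow> 'c) \<Rightarrow> (real \<Rightarrow> 'b) \<Rightarrow> real \<Rightarrow> 'm \<Rightarrow> bool" where
  "inflection_along M B \<rho> \<rho>' c t q \<longleftrightarrow>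
     velocity B c t \<noteq> (\<lambda>_. 0) \<and> has_contact M B \<rho> 3 c t (fibre \<rho>' q) q"

text \<open>Inflections of the characteristic fronts, contact being allowed with any line of \<open>B\<close>.\<close>

definition front_inflections ::
  "('m::topological_space, real^3) atlas \<Rightarrow> ('m \<Rightarrow> ('m, real^3) tvec set) \<Rightarrow>
    ('b::topological_space, real^2) atlas \<Rightarrow> ('m \<Rightarrow> 'b) \<Rightarrow> ('m \<Rightarrow> 'c) \<Rightarrow> 'm set \<Rightarrow> 'b set" where
  "front_inflections M \<xi> B \<rho> \<rho>' V =
     {\<rho> (\<gamma> t) | \<gamma> I t. characteristic M \<xi> V \<gamma> I \<and> t \<in> I \<and>
        (\<exists>q. inflection_along M B \<rho> \<rho>' (\<rho> \<circ> \<gamma>) t q)}"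

text \<open>The same with front and line regarded as fronts of Legendre curves of \<open>M\<close>: the contact is with
  the line having the same contact element, that is, the image of the \<open>\<rho>'\<close>-fibre through \<open>\<gamma> t\<close>.  This
  matters only if different points of \<open>M\<close> define the same contact element of \<open>B\<close>.\<close>

definition lifted_front_inflections ::
  "('m::topological_space, real^3) atlas \<Rightarrow> ('m \<Rightarrow> ('m, real^3) tvec set) \<Rightarrow>
    ('b::topological_space, real^2) atlas \<Rightarrow> ('m \<Rightarrow> 'b) \<Rightarrow> ('m \<Rightarrow> 'c) \<Rightarrow> 'm set \<Rightarrow> 'b set" where
  "lifted_front_inflections M \<xi> B \<rho> \<rho>' V =
     {\<rho> (\<gamma> t) | \<gamma> I t. characteristic M \<xi> V \<gamma> I \<and> t \<in> I \<and>
        inflection_along M B \<rho> \<rho>' (\<rho> \<circ> \<gamma>) t (\<gamma> t)}"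

text \<open>Critical points of the restriction of \<open>\<rho>'\<close> to \<open>V\<close>.\<close>

definition contour ::
  "('m::topological_space, real^3) atlas \<Rightarrow> ('c::topological_space, real^2) atlas \<Rightarrow> ('m \<Rightarrow> 'c)
    \<Rightarrow> 'm set \<Rightarrow> 'm set" where
  "contour M B' \<rho>' V =
     {p\<in>V. differential M B' \<rho>' p ` tangent_to M V p \<noteq> tangent_space B' (\<rho>' p)}"

end

theory Submission
  imports Defs
begin

text \<open>At each point the contact plane is spanned by a vector \<open>E\<close> tangent to the \<open>\<rho>\<close>-fibre and a vector \<open>E'\<close>
  tangent to the \<open>\<rho>'\<close>-fibre.  Let \<open>\<gamma>\<close> be a Legendre curve with velocity \<open>a E + b E'\<close>, and let \<open>g = 0\<close> be a
  local equation of the image under \<open>\<rho>\<close> of the \<open>\<rho>'\<close>-fibre through a point of \<open>\<gamma>\<close>.  There the second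
  derivative of \<open>g \<circ> \<rho> \<circ> \<gamma>\<close> is a nonzero multiple of \<open>a b d\<alpha>(E, E')\<close>, and \<open>d\<alpha>(E, E') \<noteq> 0\<close> by the contact
  condition.  The front is immersed iff \<open>b \<noteq> 0\<close>, so it has an inflection iff \<open>a = 0\<close>, that is, iff \<open>\<gamma>\<close> is
  tangent to the \<open>\<rho>'\<close>-fibre.  For a characteristic of \<open>V\<close> this means that the plane tangent to \<open>V\<close>
  contains the kernel of the differential of \<open>\<rho>'\<close>.\<close>

section \<open>Calculus of smooth maps on open sets\<close>

text \<open>Nothing is assumed about the acceleration of \<gamma>, yet it occurs in the second
  derivative of the front equation. It drops out because the differential of
  \<open>g \<circ> \<rho>\<close> at the point is proportional to \<alpha>, and the differentiated
  Legendre condition trades the acceleration for a quadratic term in the velocity. What is left is a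
  symmetric Hessian minus a multiple of the derivative of \<alpha>, whose antisymmetric part is
  d\<alpha>. Contact is defined by the existence of some local equation of the line. One direction
  therefore needs the computation for an arbitrary equation, and the other needs one equation to
  exist, which comes from the inverse function theorem. When contact with any line is allowed, first
  order contact already makes the tangent directions of front and line agree, and
  \<open>distinct_contact_elements\<close> then identifies the two points of the contact manifold.
  Characteristic points lie in the contour but on no characteristic, so they are subtracted from it.
  Through every other point a characteristic has to be produced, hence the existence theorem for
  integral curves.\<close>

abbreviation fderiv :: "('a::real_normed_vector \<Rightarrow> 'b::real_normed_vector) \<Rightarrow> 'a \<Rightarrow> 'a \<Rightarrow> 'b" where
  "fderiv f x \<equiv> frechet_derivative f (at x)"

lemma has_fderiv: "f differentiable (at x) \<Longrightarrow> (f has_derivative fderiv f x) (at x)"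
  by (simp add: frechet_derivative_works)

lemma fderiv_eq: "(f has_derivative f') (at x) \<Longrightarrow> fderiv f x = f'"
  using frechet_derivative_at by metis

lemma Ck_on_subset: "Ck_on k S f \<Longrightarrow> T \<subseteq> S \<Longrightarrow> Ck_on k T f"
  by (induction k arbitrary: f) (auto intro: continuous_on_subset)

lemma Ck_on_imp_continuous_on: "Ck_on k S f \<Longrightarrow> continuous_on S f"
  by (cases k)
    (auto intro!: continuous_at_imp_continuous_on differentiable_imp_continuous_within)

lemma Ck_on_Suc_imp: "Ck_on (Suc k) S f \<Longrightarrow> Ck_on k S f"
proof (induction k arbitrary: f)
  case 0
  then show ?case using Ck_on_imp_continuous_on by fastforce
next
  case (Suc k)
  then show ?case by (metis Ck_on.simps(2))
qed

text \<open>On an open set, equal functions have equal derivatives at each point, so the agreement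
  passes to all directional derivatives and the induction closes.\<close>

lemma Ck_on_cong:
  assumes "open S" "\<And>x. x \<in> S \<Longrightarrow> f x = g x" "Ck_on k S f"
  shows "Ck_on k S g"
  using assms(2,3)
proof (induction k arbitrary: f g)
  case 0
  then show ?case using continuous_on_cong[of S S f g] by simp
next
  case (Suc k)
  have d: "(g has_derivative fderiv f x) (at x)" if "x \<in> S" for x
    by (rule has_derivative_transform_within_open[OF has_fderiv assms(1) that])
       (use Suc.prems that in auto)
  have "Ck_on k S (\<lambda>x. fderiv g x v)" for v
  proof (rule Suc.IH)
    show "fderiv f x v = fderiv g x v" if "x \<in> S" for x
      using fderiv_eq[OF d[OF that]] by simp
    show "Ck_on k S (\<lambda>x. fderiv f x v)" using Suc.prems by simp
  qed
  then show ?case using d by (auto simp: differentiable_def)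
qed

text \<open>Allows any explicit formula \<open>f'\<close> in place of
  \<open>frechet_derivative\<close>; all closure properties below go through it.\<close>

lemma Ck_on_SucI:
  assumes "open S" "\<And>x. x \<in> S \<Longrightarrow> (f has_derivative f' x) (at x)" "\<And>v. Ck_on k S (\<lambda>x. f' x v)"
  shows "Ck_on (Suc k) S f"
proof -
  have "Ck_on k S (\<lambda>x. fderiv f x v)" for v
    by (rule Ck_on_cong[OF assms(1) _ assms(3)[of v]]) (simp add: fderiv_eq[OF assms(2)])
  then show ?thesis using assms(2) by (auto simp: differentiable_def)
qed

lemma Ck_on_SucD:
  assumes "Ck_on (Suc k) S f"
  shows "x \<in> S \<Longrightarrow> (f has_derivative fderiv f x) (at x)" "Ck_on k S (\<lambda>x. fderiv f x v)"
  using assms by (auto intro: has_fderiv)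

lemma Ck_on_const: "open S \<Longrightarrow> Ck_on k S (\<lambda>x. c)"
proof (induction k arbitrary: c)
  case (Suc k)
  show ?case by (rule Ck_on_SucI[where f'="\<lambda>x v. 0", OF Suc.prems _ Suc.IH[OF Suc.prems]]) simp
qed simp

lemma Ck_on_bounded_linear:
  assumes "bounded_linear L" "open S" "Ck_on k S f"
  shows "Ck_on k S (\<lambda>x. L (f x))"
  using assms(3)
proof (induction k arbitrary: f)
  case 0
  then show ?case using assms(1) bounded_linear.continuous_on by auto
next
  case (Suc k)
  show ?case
  proof (rule Ck_on_SucI[OF assms(2)])
    show "((\<lambda>x. L (f x)) has_derivative (\<lambda>v. L (fderiv f x v))) (at x)" if "x \<in> S" for x
      by (rule bounded_linear.has_derivative[OF assms(1) Ck_on_SucD(1)[OF Suc.prems that]])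
  qed (rule Suc.IH, rule Ck_on_SucD(2)[OF Suc.prems])
qed

lemma Ck_on_add:
  assumes "open S" "Ck_on k S f" "Ck_on k S g"
  shows "Ck_on k S (\<lambda>x. f x + g x)"
  using assms(2,3)
proof (induction k arbitrary: f g)
  case 0
  then show ?case by (auto intro: continuous_intros)
next
  case (Suc k)
  show ?case
  proof (rule Ck_on_SucI[OF assms(1)])
    show "((\<lambda>x. f x + g x) has_derivative (\<lambda>v. fderiv f x v + fderiv g x v)) (at x)" if "x \<in> S" for x
      by (intro has_derivative_add Ck_on_SucD(1)[OF Suc.prems(1) that] Ck_on_SucD(1)[OF Suc.prems(2) that])
  qed (rule Suc.IH[OF Ck_on_SucD(2)[OF Suc.prems(1)] Ck_on_SucD(2)[OF Suc.prems(2)]])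
qed

lemma Ck_on_sum:
  assumes "open S" "\<And>i. i \<in> I \<Longrightarrow> Ck_on k S (f i)"
  shows "Ck_on k S (\<lambda>x. \<Sum>i\<in>I. f i x)"
  using assms(2) by (induction I rule: infinite_finite_induct)
    (auto intro: Ck_on_const Ck_on_add assms(1))

lemma Ck_on_bilinear:
  assumes "bounded_bilinear b" "open S" "Ck_on k S f" "Ck_on k S g"
  shows "Ck_on k S (\<lambda>x. b (f x) (g x))"
  using assms(3,4)
proof (induction k arbitrary: f g)
  case 0
  then show ?case using assms(1) bounded_bilinear.continuous_on by auto
next
  case (Suc k)
  show ?case
  proof (rule Ck_on_SucI[OF assms(2)])
    show "((\<lambda>x. b (f x) (g x)) has_derivative
            (\<lambda>v. b (f x) (fderiv g x v) + b (fderiv f x v) (g x))) (at x)" if "x \<in> S" for x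
      by (rule bounded_bilinear.FDERIV[OF assms(1)])
         (use that Ck_on_SucD(1) Suc.prems in auto)
    show "Ck_on k S (\<lambda>x. b (f x) (fderiv g x v) + b (fderiv f x v) (g x))" for v
      by (intro Ck_on_add Suc.IH assms(2) Ck_on_SucD(2)[OF Suc.prems(1)] Ck_on_SucD(2)[OF Suc.prems(2)]
            Ck_on_Suc_imp[OF Suc.prems(1)] Ck_on_Suc_imp[OF Suc.prems(2)])
  qed
qed

lemmas Ck_on_mult = Ck_on_bilinear[OF bounded_bilinear_mult]
lemmas Ck_on_scaleR = Ck_on_bilinear[OF bounded_bilinear_scaleR]
lemmas Ck_on_inner = Ck_on_bilinear[OF bounded_bilinear_inner]

lemma Ck_on_id: "open S \<Longrightarrow> Ck_on k S (\<lambda>x. x)"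
proof (cases k)
  case (Suc m)
  assume "open S"
  then show ?thesis unfolding Suc
    by (intro Ck_on_SucI[where f'="\<lambda>x v. v"] Ck_on_const) auto
qed simp

text \<open>In the chain rule the outer derivative is applied to the direction
  \<open>fderiv f x v\<close>, which moves with \<open>x\<close>, whereas \<open>Ck_on\<close>
  controls derivatives in fixed directions only. Expanding that direction in \<open>Basis\<close>
  leaves products of functions that the induction hypothesis covers.\<close>

lemma Ck_on_compose:
  fixes f :: "'a::euclidean_space \<Rightarrow> 'b::euclidean_space" and g :: "'b \<Rightarrow> 'c::real_normed_vector"
  assumes "open S" "open T" "f ` S \<subseteq> T" "Ck_on k S f" "Ck_on k T g"
  shows "Ck_on k S (\<lambda>x. g (f x))"
  using assms(4,5)
proof (induction k arbitrary: g)
  case 0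
  then show ?case using assms(3) by (auto intro: continuous_on_compose2)
next
  case (Suc k)
  show ?case
  proof (rule Ck_on_SucI[OF assms(1)])
    show "((\<lambda>x. g (f x)) has_derivative (\<lambda>v. \<Sum>i\<in>Basis. (fderiv f x v \<bullet> i) *\<^sub>R fderiv g (f x) i)) (at x)"
      if x: "x \<in> S" for x
    proof -
      have g: "(g has_derivative fderiv g (f x)) (at (f x))"
        by (rule Ck_on_SucD(1)[OF Suc.prems(2)]) (use x assms in auto)
      then interpret g: bounded_linear "fderiv g (f x)" by (rule has_derivative_bounded_linear)
      have e: "fderiv g (f x) w = (\<Sum>i\<in>Basis. (w \<bullet> i) *\<^sub>R fderiv g (f x) i)" for w
        by (subst euclidean_representation[of w, symmetric]) (simp only: g.sum g.scaleR)
      show ?thesis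
        unfolding e[symmetric] by (rule has_derivative_compose[OF Ck_on_SucD(1)[OF Suc.prems(1) x] g])
    qed
    have f: "Ck_on k S f" by (rule Ck_on_Suc_imp[OF Suc.prems(1)])
    show "Ck_on k S (\<lambda>x. \<Sum>i\<in>Basis. (fderiv f x v \<bullet> i) *\<^sub>R fderiv g (f x) i)" for v
      by (intro Ck_on_sum Ck_on_scaleR Ck_on_inner Ck_on_const assms(1) Ck_on_SucD(2)[OF Suc.prems(1)]
          Suc.IH[OF f] Ck_on_SucD(2)[OF Suc.prems(2)])
  qed
qed

lemma Ck_on_inverse:
  fixes f :: "'a::euclidean_space \<Rightarrow> real"
  assumes "open S" "Ck_on k S f" "\<And>x. x \<in> S \<Longrightarrow> f x \<noteq> 0"
  shows "Ck_on k S (\<lambda>x. inverse (f x))"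
  using assms(2)
proof (induction k)
  case 0
  then show ?case using assms(3) by (auto intro: continuous_intros)
next
  case (Suc k)
  show ?case
  proof (rule Ck_on_SucI[OF assms(1)])
    show "((\<lambda>x. inverse (f x)) has_derivative
        (\<lambda>h. - (inverse (f x) * fderiv f x h * inverse (f x)))) (at x)" if "x \<in> S" for x
      by (rule Deriv.has_derivative_inverse) (use assms(3) that Ck_on_SucD(1)[OF Suc.prems] in auto)
    have "Ck_on k S (\<lambda>x. inverse (f x))" by (rule Suc.IH[OF Ck_on_Suc_imp[OF Suc.prems]])
    then show "Ck_on k S (\<lambda>x. - (inverse (f x) * fderiv f x v * inverse (f x)))" for v
      by (intro Ck_on_bounded_linear[OF bounded_linear_minus[OF bounded_linear_ident]] Ck_on_mult assms(1)
          Ck_on_SucD(2)[OF Suc.prems])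
  qed
qed

lemma Ck_on_prod:
  fixes f :: "'i \<Rightarrow> 'a::euclidean_space \<Rightarrow> real"
  assumes "open S" "\<And>i. i \<in> I \<Longrightarrow> Ck_on k S (f i)"
  shows "Ck_on k S (\<lambda>x. \<Prod>i\<in>I. f i x)"
  using assms(2) by (induction I rule: infinite_finite_induct)
    (auto intro: Ck_on_const Ck_on_mult assms(1))

lemma Ck_on_vec_nth: "open S \<Longrightarrow> Ck_on k S f \<Longrightarrow> Ck_on k S (\<lambda>x. f x $ i)"
  by (rule Ck_on_bounded_linear[OF bounded_linear_vec_nth])

lemma Ck_on_vec_lambda:
  fixes f :: "'i::finite \<Rightarrow> 'a::euclidean_space \<Rightarrow> real"
  assumes "open S" "\<And>i. Ck_on k S (f i)"
  shows "Ck_on k S (\<lambda>x. \<chi> i. f i x)"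
proof -
  have "Ck_on k S (\<lambda>x. \<Sum>i\<in>UNIV. f i x *\<^sub>R (axis i 1 :: real^'i))"
    by (intro Ck_on_sum Ck_on_scaleR Ck_on_const assms)
  moreover have "(\<lambda>x. \<Sum>i\<in>UNIV. f i x *\<^sub>R (axis i 1 :: real^'i)) = (\<lambda>x. \<chi> i. f i x)"
    by (auto simp: vec_eq_iff axis_def if_distrib cong: if_cong)
  ultimately show ?thesis by simp
qed

lemma Ck_on_det:
  fixes A :: "'a::euclidean_space \<Rightarrow> real^'n^'n"
  assumes "open S" "\<And>i j. Ck_on k S (\<lambda>x. A x $ i $ j)"
  shows "Ck_on k S (\<lambda>x. det (A x))"
  unfolding det_def by (intro Ck_on_sum Ck_on_mult Ck_on_prod Ck_on_const assms)

section \<open>Closure properties of smooth maps\<close>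

lemma smooth_onD: "smooth_on S f \<Longrightarrow> Ck_on k S f"
  by (simp add: smooth_on_def)

lemma smooth_on_subset: "smooth_on S f \<Longrightarrow> T \<subseteq> S \<Longrightarrow> smooth_on T f"
  by (auto simp: smooth_on_def intro: Ck_on_subset)

lemma smooth_on_cong: "open S \<Longrightarrow> (\<And>x. x \<in> S \<Longrightarrow> f x = g x) \<Longrightarrow> smooth_on S f \<Longrightarrow> smooth_on S g"
  unfolding smooth_on_def by (intro allI, rule Ck_on_cong[of S f g]) auto

lemma smooth_on_const: "open S \<Longrightarrow> smooth_on S (\<lambda>x. c)"
  by (simp add: smooth_on_def Ck_on_const)

lemma smooth_on_id: "open S \<Longrightarrow> smooth_on S (\<lambda>x. x)"
  by (simp add: smooth_on_def Ck_on_id)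

lemma smooth_on_add: "open S \<Longrightarrow> smooth_on S f \<Longrightarrow> smooth_on S g \<Longrightarrow> smooth_on S (\<lambda>x. f x + g x)"
  by (simp add: smooth_on_def Ck_on_add)

lemma smooth_on_bounded_linear:
  "bounded_linear L \<Longrightarrow> open S \<Longrightarrow> smooth_on S f \<Longrightarrow> smooth_on S (\<lambda>x. L (f x))"
  by (simp add: smooth_on_def Ck_on_bounded_linear)

lemma smooth_on_diff:
  assumes "open S" "smooth_on S f" "smooth_on S g"
  shows "smooth_on S (\<lambda>x. f x - g x)"
  using smooth_on_add[OF assms(1,2) smooth_on_bounded_linear[OF bounded_linear_minus[OF bounded_linear_ident] assms(1,3)]]
  by simp

lemma smooth_on_bilinear:
  "bounded_bilinear b \<Longrightarrow> open S \<Longrightarrow> smooth_on S f \<Longrightarrow> smooth_on S g \<Longrightarrow> smooth_on S (\<lambda>x. b (f x) (g x))"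
  by (simp add: smooth_on_def Ck_on_bilinear)

lemmas smooth_on_scaleR = smooth_on_bilinear[OF bounded_bilinear_scaleR]
lemmas smooth_on_inner = smooth_on_bilinear[OF bounded_bilinear_inner]

lemma smooth_on_compose:
  fixes f :: "'a::euclidean_space \<Rightarrow> 'b::euclidean_space" and g :: "'b \<Rightarrow> 'c::real_normed_vector"
  assumes "open S" "open T" "f ` S \<subseteq> T" "smooth_on S f" "smooth_on T g"
  shows "smooth_on S (\<lambda>x. g (f x))"
  unfolding smooth_on_def by (rule allI, rule Ck_on_compose[OF assms(1-3) smooth_onD[OF assms(4)] smooth_onD[OF assms(5)]])

lemma smooth_on_vec_nth: "open S \<Longrightarrow> smooth_on S f \<Longrightarrow> smooth_on S (\<lambda>x. f x $ i)"
  by (rule smooth_on_bounded_linear[OF bounded_linear_vec_nth])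

lemma smooth_on_vec_lambda:
  fixes f :: "'i::finite \<Rightarrow> 'a::euclidean_space \<Rightarrow> real"
  shows "open S \<Longrightarrow> (\<And>i. smooth_on S (f i)) \<Longrightarrow> smooth_on S (\<lambda>x. \<chi> i. f i x)"
  by (simp add: smooth_on_def Ck_on_vec_lambda)

lemma smooth_on_continuous_on: "smooth_on S f \<Longrightarrow> continuous_on S f"
  by (metis smooth_onD Ck_on_imp_continuous_on)

lemma smooth_on_has_fderiv: "smooth_on S f \<Longrightarrow> x \<in> S \<Longrightarrow> (f has_derivative fderiv f x) (at x)"
  by (metis smooth_onD Ck_on_SucD(1))

lemma smooth_on_fderiv: "smooth_on S f \<Longrightarrow> smooth_on S (\<lambda>x. fderiv f x v)"
  unfolding smooth_on_def using Ck_on_SucD(2) by blast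

lemma smooth_on_linear_fderiv: "smooth_on S f \<Longrightarrow> x \<in> S \<Longrightarrow> linear (fderiv f x)"
  using smooth_on_has_fderiv has_derivative_linear by blast

text \<open>Needed because \<open>smooth_map\<close> supplies charts and a neighbourhood that depend
  on the point.\<close>

lemma smooth_on_if_locally:
  assumes "\<And>x. x \<in> S \<Longrightarrow> \<exists>T. open T \<and> x \<in> T \<and> smooth_on T f"
  shows "smooth_on S f"
proof -
  have "Ck_on k S f" if "\<And>x. x \<in> S \<Longrightarrow> \<exists>T. open T \<and> x \<in> T \<and> Ck_on k T f" for k
    using that
  proof (induction k arbitrary: f)
    case 0
    then show ?case
      by (auto intro!: continuous_at_imp_continuous_on simp: continuous_on_eq_continuous_at) (metis continuous_on_eq_continuous_at)
  next
    case (Suc k)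
    have "\<exists>T. open T \<and> x \<in> T \<and> Ck_on k T (\<lambda>x. fderiv f x v)" if "x \<in> S" for x v
      using Suc.prems[OF that] by auto
    then have "Ck_on k S (\<lambda>x. fderiv f x v)" for v by (intro Suc.IH)
    moreover have "f differentiable (at x)" if "x \<in> S" for x
      using Suc.prems[OF that] by auto
    ultimately show ?case by simp
  qed
  then show ?thesis using assms unfolding smooth_on_def by blast
qed

section \<open>Symmetry of second derivatives\<close>

lemma has_derivative_along_line:
  assumes "(g has_derivative g') (at (a + s *\<^sub>R u))"
  shows "((\<lambda>s. g (a + s *\<^sub>R u)) has_vector_derivative g' u) (at s)"
proof -
  have "((\<lambda>s. a + s *\<^sub>R u) has_derivative (\<lambda>h. h *\<^sub>R u)) (at s)"
    by (auto intro!: derivative_eq_intros)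
  from has_derivative_compose[OF this assms] show ?thesis
    using has_derivative_linear[OF assms] by (simp add: has_vector_derivative_def linear_cmul)
qed

lemma smooth_on_along_line:
  assumes "smooth_on U f" "a + s *\<^sub>R u \<in> U"
  shows "((\<lambda>s. f (a + s *\<^sub>R u)) has_vector_derivative fderiv f (a + s *\<^sub>R u) u) (at s)"
  by (rule has_derivative_along_line[OF smooth_on_has_fderiv[OF assms]])

text \<open>Two applications of the mean value theorem: to the difference in direction
  \<open>w\<close> as a function of \<open>s\<close>, then to its derivative as a function of
  \<open>t\<close>. The double difference is symmetric in \<open>u\<close> and \<open>w\<close>,
  which is what the symmetry of second derivatives exploits.\<close>

lemma double_difference_mean_value:
  fixes f :: "'a::euclidean_space \<Rightarrow> real"
  assumes "smooth_on U f" "0 < h"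
    and U: "\<And>s t. 0 \<le> s \<Longrightarrow> s \<le> h \<Longrightarrow> 0 \<le> t \<Longrightarrow> t \<le> h \<Longrightarrow> x + s *\<^sub>R u + t *\<^sub>R w \<in> U"
  obtains s t where "0 < s" "s < h" "0 < t" "t < h"
    "f (x + h *\<^sub>R u + h *\<^sub>R w) - f (x + h *\<^sub>R u) - f (x + h *\<^sub>R w) + f x
       = h * h * fderiv (\<lambda>y. fderiv f y u) (x + s *\<^sub>R u + t *\<^sub>R w) w"
proof -
  let ?\<phi> = "\<lambda>s. f ((x + h *\<^sub>R w) + s *\<^sub>R u) - f (x + s *\<^sub>R u)"
  have "(x + h *\<^sub>R w) + s *\<^sub>R u \<in> U" "x + s *\<^sub>R u \<in> U" if "0 \<le> s" "s \<le> h" for s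
    using U[of s h] U[of s 0] that assms(2) by (auto simp: algebra_simps)
  note smooth_on_along_line[OF assms(1) this(1)] smooth_on_along_line[OF assms(1) this(2)]
  then have "(?\<phi> has_real_derivative fderiv f ((x + h *\<^sub>R w) + s *\<^sub>R u) u - fderiv f (x + s *\<^sub>R u) u) (at s)"
    if "0 \<le> s" "s \<le> h" for s
    using that by (auto simp: has_real_derivative_iff_has_vector_derivative intro: has_vector_derivative_diff)
  from MVT2[OF assms(2) this]
  obtain s where s: "0 < s" "s < h"
    "?\<phi> h - ?\<phi> 0 = h * (fderiv f ((x + h *\<^sub>R w) + s *\<^sub>R u) u - fderiv f (x + s *\<^sub>R u) u)"
    by auto
  have "((\<lambda>t. fderiv f ((x + s *\<^sub>R u) + t *\<^sub>R w) u) has_real_derivative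
      fderiv (\<lambda>y. fderiv f y u) (x + s *\<^sub>R u + t *\<^sub>R w) w) (at t)" if "0 \<le> t" "t \<le> h" for t
    using U[of s t] that s unfolding has_real_derivative_iff_has_vector_derivative
    by (intro smooth_on_along_line[OF smooth_on_fderiv[OF assms(1)]]) auto
  from MVT2[OF assms(2) this]
  obtain t where t: "0 < t" "t < h"
    "fderiv f ((x + s *\<^sub>R u) + h *\<^sub>R w) u - fderiv f (x + s *\<^sub>R u) u
      = h * fderiv (\<lambda>y. fderiv f y u) (x + s *\<^sub>R u + t *\<^sub>R w) w"
    by auto
  show thesis
    by (rule that[OF s(1,2) t(1,2)]) (use s(3) t(3) in \<open>simp add: algebra_simps\<close>)
qed

text \<open>Both mixed derivatives, evaluated at suitable points near \<open>x\<close>, equal the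
  same double difference divided by \<open>h * h\<close>; continuity then excludes a gap between
  them at \<open>x\<close>.\<close>

lemma fderiv_fderiv_commute:
  fixes f :: "'a::euclidean_space \<Rightarrow> real"
  assumes "open U" "smooth_on U f" "x \<in> U"
  shows "fderiv (\<lambda>y. fderiv f y u) x w = fderiv (\<lambda>y. fderiv f y w) x u"
proof (rule ccontr)
  define A where "A y = fderiv (\<lambda>y. fderiv f y u) y w" for y
  define B where "B y = fderiv (\<lambda>y. fderiv f y w) y u" for y
  assume "\<not> ?thesis"
  then have ne: "A x \<noteq> B x" by (simp add: A_def B_def)
  \<comment> \<open>Half the gap: a number cannot be within \<open>e\<close> of both
    \<open>A x\<close> and \<open>B x\<close>.\<close>
  define e where "e = \<bar>A x - B x\<bar> / 2"
  have e: "e > 0" using ne by (simp add: e_def)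
  have "continuous_on U A" "continuous_on U B"
    unfolding A_def B_def by (intro smooth_on_continuous_on smooth_on_fderiv assms)+
  then have "isCont A x" "isCont B x"
    using assms by (auto simp: continuous_on_eq_continuous_at)
  then obtain d1 d2 where d: "d1 > 0" "d2 > 0"
    "\<And>y. dist y x < d1 \<Longrightarrow> \<bar>A y - A x\<bar> < e" "\<And>y. dist y x < d2 \<Longrightarrow> \<bar>B y - B x\<bar> < e"
    using e unfolding continuous_at_eps_delta dist_real_def by metis
  obtain d3 where d3: "d3 > 0" "ball x d3 \<subseteq> U"
    using assms open_contains_ball by blast
  define d where "d = min d1 (min d2 d3)"
  have dpos: "d > 0" using d d3 by (simp add: d_def)
  \<comment> \<open>Keeps the whole parallelogram with sides \<open>h u\<close> and
    \<open>h w\<close> inside the ball of radius \<open>d\<close>; the summand 1 avoids a zero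
    denominator.\<close>
  define h where "h = d / (norm u + norm w + 1)"
  have npos: "norm u + norm w + 1 > 0"
    by (smt (verit) norm_ge_zero)
  then have h: "h > 0" using dpos by (simp add: h_def)
  have near: "dist (x + s *\<^sub>R u + t *\<^sub>R w) x < d" if "0 \<le> s" "s \<le> h" "0 \<le> t" "t \<le> h" for s t
  proof -
    have "dist (x + s *\<^sub>R u + t *\<^sub>R w) x = norm (s *\<^sub>R u + t *\<^sub>R w)"
      by (simp add: dist_norm algebra_simps)
    also have "\<dots> \<le> s * norm u + t * norm w"
      using norm_triangle_ineq[of "s *\<^sub>R u" "t *\<^sub>R w"] that by simp
    also have "\<dots> \<le> h * norm u + h * norm w"
      using that by (intro add_mono mult_right_mono) auto
    also have "\<dots> < h * (norm u + norm w + 1)" using h by (simp add: algebra_simps)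
    also have "\<dots> = d" using npos by (simp add: h_def)
    finally show ?thesis .
  qed
  then have inU: "x + s *\<^sub>R u + t *\<^sub>R w \<in> U" if "0 \<le> s" "s \<le> h" "0 \<le> t" "t \<le> h" for s t
    using that d3 by (force simp: d_def dist_commute)
  obtain s t where st: "0 < s" "s < h" "0 < t" "t < h"
    "f (x + h *\<^sub>R u + h *\<^sub>R w) - f (x + h *\<^sub>R u) - f (x + h *\<^sub>R w) + f x = h * h * A (x + s *\<^sub>R u + t *\<^sub>R w)"
    unfolding A_def using double_difference_mean_value[OF assms(2) h inU] by blast
  have inU': "x + s *\<^sub>R w + t *\<^sub>R u \<in> U" if "0 \<le> s" "s \<le> h" "0 \<le> t" "t \<le> h" for s t
    using inU[of t s] that by (simp add: algebra_simps)
  obtain s' t' where st': "0 < s'" "s' < h" "0 < t'" "t' < h"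
    "f (x + h *\<^sub>R w + h *\<^sub>R u) - f (x + h *\<^sub>R w) - f (x + h *\<^sub>R u) + f x = h * h * B (x + s' *\<^sub>R w + t' *\<^sub>R u)"
    unfolding B_def using double_difference_mean_value[OF assms(2) h inU'] by blast
  have "h * h * A (x + s *\<^sub>R u + t *\<^sub>R w) = h * h * B (x + t' *\<^sub>R u + s' *\<^sub>R w)"
    using st(5) st'(5) by (simp add: algebra_simps)
  then have "A (x + s *\<^sub>R u + t *\<^sub>R w) = B (x + t' *\<^sub>R u + s' *\<^sub>R w)" using h by simp
  moreover have "\<bar>A (x + s *\<^sub>R u + t *\<^sub>R w) - A x\<bar> < e"
    using near[of s t] st by (intro d) (auto simp: d_def)
  moreover have "\<bar>B (x + t' *\<^sub>R u + s' *\<^sub>R w) - B x\<bar> < e"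
    using near[of t' s'] st' by (intro d) (auto simp: d_def)
  ultimately show False using e_def by (smt (verit) field_sum_of_halves)
qed

section \<open>The smooth inverse function theorem and level sets\<close>

text \<open>Bootstrapping: by Cramer's rule \<open>g' y v\<close> is a rational expression in the
  entries of the matrix of \<open>fderiv f (g y)\<close>, so it is of class \<open>Ck\<close> as
  soon as \<open>g\<close> is, and then \<open>g\<close> gains one order.\<close>

lemma Ck_on_inverse_map:
  fixes f :: "real^'n \<Rightarrow> real^'n"
  assumes "open U" "open V" "smooth_on U f" "g ` V \<subseteq> U" "continuous_on V g"
    and deriv: "\<And>y. y \<in> V \<Longrightarrow> (g has_derivative g' y) (at y)"
    and bij: "\<And>y. y \<in> V \<Longrightarrow> bij (fderiv f (g y))"
    and inv: "\<And>y v. y \<in> V \<Longrightarrow> fderiv f (g y) (g' y v) = v"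
  shows "Ck_on k V g"
proof (induction k)
  case 0
  then show ?case using assms by simp
next
  case (Suc k)
  define A where "A y = matrix (fderiv f (g y))" for y
  have A: "A y *v v = fderiv f (g y) v" if "y \<in> V" for y v
    unfolding A_def
    by (intro fun_cong[OF matrix_vector_mul(2)] smooth_on_linear_fderiv[OF assms(3)]) (use assms that in auto)
  have detA: "det (A y) \<noteq> 0" if "y \<in> V" for y
  proof -
    have "bij ((*v) (A y))" using bij[OF that] A[OF that] by (simp add: fun_eq_iff cong: bij_betw_cong)
    then show ?thesis by (simp add: invertible_eq_bij[symmetric] invertible_det_nz)
  qed
  have CkA: "Ck_on k V (\<lambda>y. A y $ i $ j)" for i j
    unfolding A_def matrix_def
    by (simp, intro Ck_on_vec_nth Ck_on_compose[OF assms(2,1,4) Suc] smooth_onD smooth_on_fderiv assms)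
  define C where "C v = (\<lambda>y. \<chi> k. det (\<chi> i j. if j = k then v $ i else A y $ i $ j) * inverse (det (A y)))"
    for v :: "real^'n"
  have C: "g' y v = C v y" if "y \<in> V" for y v
    using cramer[OF detA[OF that], of "g' y v" v] A[OF that] inv[OF that]
    by (simp add: C_def divide_inverse)
  show ?case
  proof (rule Ck_on_SucI[OF assms(2) deriv])
    show "Ck_on k V (\<lambda>y. g' y v)" for v
    proof (rule Ck_on_cong[OF assms(2)])
      show "Ck_on k V (C v)"
        unfolding C_def
      proof (intro Ck_on_vec_lambda assms Ck_on_mult Ck_on_inverse Ck_on_det CkA detA)
        show "Ck_on k V (\<lambda>x. (\<chi> i j. if j = l then v $ i else A x $ i $ j) $ i $ j)" for l i j
          using CkA[of i j] Ck_on_const[OF assms(2)] by (cases "j = l") simp_all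
      qed
    qed (simp add: C)
  qed
qed

text \<open>The continuously differentiable version \<open>inverse_function_theorem\<close> gives
  the local inverse and its derivative; \<open>Ck_on_inverse_map\<close> raises the regularity. The
  left inverse \<open>l\<close> of the injective derivative is the datum which that theorem asks
  for.\<close>

theorem smooth_inverse_function_theorem:
  fixes f :: "real^'n \<Rightarrow> real^'n"
  assumes "open U" "smooth_on U f" "x0 \<in> U" "inj (fderiv f x0)"
  obtains U' V g where "open U'" "U' \<subseteq> U" "x0 \<in> U'" "open V" "f x0 \<in> V" "homeomorphism U' V f g"
    "smooth_on V g"
proof -
  have bl: "bounded_linear (fderiv f x)" if "x \<in> U" for x
    using smooth_on_has_fderiv[OF assms(2) that] has_derivative_bounded_linear by blast
  define f' where "f' x = Blinfun (fderiv f x)" for x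
  have f': "blinfun_apply (f' x) = fderiv f x" if "x \<in> U" for x
    unfolding f'_def using bl[OF that] by (rule bounded_linear_Blinfun_apply)
  obtain l where l: "linear l" "l \<circ> fderiv f x0 = id"
    using linear_injective_left_inverse[OF bounded_linear.linear[OF bl[OF assms(3)]] assms(4)] by blast
  have "Blinfun l o\<^sub>L f' x0 = id_blinfun"
    using l f'[OF assms(3)] bounded_linear_Blinfun_apply[of l]
    by (auto intro!: blinfun_eqI simp: linear_conv_bounded_linear fun_eq_iff)
  moreover have "continuous_on U f'"
  proof (rule continuous_on_blinfun_componentwise)
    show "continuous_on U (\<lambda>x. blinfun_apply (f' x) i)" for i
      using smooth_on_continuous_on[OF smooth_on_fderiv[OF assms(2)], of i] f'
      by (simp cong: continuous_on_cong)
  qed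
  moreover have "(f has_derivative blinfun_apply (f' x)) (at x)" if "x \<in> U" for x
    using smooth_on_has_fderiv[OF assms(2) that] f'[OF that] by simp
  ultimately obtain U' V g g' where *: "open U'" "U' \<subseteq> U" "x0 \<in> U'" "open V" "f x0 \<in> V"
    "homeomorphism U' V f g" "\<And>y. y \<in> V \<Longrightarrow> (g has_derivative (g' y)) (at y)"
    "\<And>y. y \<in> V \<Longrightarrow> g' y = inv (blinfun_apply (f'(g y)))"
    "\<And>y. y \<in> V \<Longrightarrow> bij (blinfun_apply (f'(g y)))"
    using inverse_function_theorem[OF assms(1) _ _ assms(3), of f f' "Blinfun l"] by metis
  have gV: "g y \<in> U" if "y \<in> V" for y using *(2,6) that by (auto simp: homeomorphism_def)
  have bij: "bij (fderiv f (g y))" if "y \<in> V" for y using *(9)[OF that] f'[OF gV[OF that]] by simp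
  have "smooth_on V g"
    unfolding smooth_on_def
  proof (intro allI Ck_on_inverse_map[OF assms(1) *(4) assms(2) _ _ *(7) bij])
    show "fderiv f (g y) (g' y v) = v" if "y \<in> V" for y v
      using *(8)[OF that] f'[OF gV[OF that]] bij[OF that] by (simp add: bij_is_surj surj_f_inv_f)
    show "continuous_on V g" using *(6) by (simp add: homeomorphism_def)
  qed (use gV in auto)
  with * show thesis using that by blast
qed

text \<open>With a right inverse \<open>r\<close> of \<open>D = f'(x\<^sub>0)\<close>, the map \<open>\<Phi> x = r (f x - f x\<^sub>0) + (x - x\<^sub>0) - r (D (x - x\<^sub>0))\<close>
  has derivative the identity at \<open>x\<^sub>0\<close> and straightens the level sets of \<open>f\<close>; the curve is
  \<open>t \<mapsto> \<Phi>\<inverse> (t v)\<close>.\<close>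

lemma curve_in_level_set:
  fixes f :: "real^'n \<Rightarrow> 'b::euclidean_space"
  assumes "open U" "smooth_on U f" "x0 \<in> U" "surj (fderiv f x0)" "fderiv f x0 v = 0"
  obtains \<gamma> \<epsilon> where "\<epsilon> > 0" "smooth_on {-\<epsilon><..<\<epsilon>} \<gamma>" "\<gamma> 0 = x0" "\<gamma> ` {-\<epsilon><..<\<epsilon>} \<subseteq> U"
    "\<And>t. t \<in> {-\<epsilon><..<\<epsilon>} \<Longrightarrow> f (\<gamma> t) = f x0" "(\<gamma> has_vector_derivative v) (at 0)"
proof -
  let ?D = "fderiv f x0"
  have lin: "linear ?D" by (rule smooth_on_linear_fderiv[OF assms(2,3)])
  obtain r where r: "linear r" "?D \<circ> r = id"
    using linear_surjective_right_inverse[OF lin assms(4)] by blast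
  have Dr: "?D (r y) = y" for y using r(2) by (metis comp_apply id_apply)
  have blr: "bounded_linear r" and blD: "bounded_linear ?D"
    using r lin by (auto simp: linear_conv_bounded_linear)
  define \<Phi> where "\<Phi> x = r (f x - f x0) + ((x - x0) - r (?D (x - x0)))" for x
  have smooth: "smooth_on U \<Phi>"
    unfolding \<Phi>_def
    by (intro smooth_on_add smooth_on_diff smooth_on_bounded_linear[OF blr] smooth_on_bounded_linear[OF blD]
        smooth_on_const smooth_on_id assms)
  have "(\<Phi> has_derivative (\<lambda>h. r (?D h - 0) + ((h - 0) - r (?D (h - 0))))) (at x0)"
    unfolding \<Phi>_def
    by (intro has_derivative_add has_derivative_diff bounded_linear.has_derivative[OF blr]
        bounded_linear.has_derivative[OF blD] has_derivative_ident has_derivative_const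
        smooth_on_has_fderiv[OF assms(2,3)])
  then have d\<Phi>: "(\<Phi> has_derivative (\<lambda>h. h)) (at x0)" by simp
  then have fd\<Phi>: "fderiv \<Phi> x0 = (\<lambda>h. h)" by (rule fderiv_eq)
  then have "inj (fderiv \<Phi> x0)" by (simp add: inj_def)
  from smooth_inverse_function_theorem[OF assms(1) smooth assms(3) this]
  obtain U' V g where *: "open U'" "U' \<subseteq> U" "x0 \<in> U'" "open V" "\<Phi> x0 \<in> V" "homeomorphism U' V \<Phi> g"
    "smooth_on V g" by metis
  have \<Phi>0: "\<Phi> x0 = 0" unfolding \<Phi>_def using linear_0[OF r(1)] linear_0[OF lin] by simp
  have "continuous_on UNIV (\<lambda>t. t *\<^sub>R v)" by (intro continuous_intros)
  then have "open ((\<lambda>t. t *\<^sub>R v) -` V)" using *(4) open_vimage by blast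
  moreover have "0 \<in> (\<lambda>t. t *\<^sub>R v) -` V" using \<Phi>0 *(5) by simp
  ultimately obtain \<epsilon> where e: "\<epsilon> > 0" "ball 0 \<epsilon> \<subseteq> (\<lambda>t. t *\<^sub>R v) -` V"
    using open_contains_ball by blast
  have eV: "t *\<^sub>R v \<in> V" if "t \<in> {-\<epsilon><..<\<epsilon>}" for t
    using e(2) that by (auto simp: subset_iff ball_eq_greaterThanLessThan)
  define \<gamma> where "\<gamma> t = g (t *\<^sub>R v)" for t
  have g\<Phi>: "g (\<Phi> x) = x" if "x \<in> U'" for x using *(6) that by (simp add: homeomorphism_def)
  have \<Phi>g: "\<Phi> (g y) = y" "g y \<in> U'" if "y \<in> V" for y using *(6) that by (auto simp: homeomorphism_def)
  have dg: "(g has_derivative fderiv g 0) (at 0)"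
    using smooth_on_has_fderiv[OF *(7)] *(5) \<Phi>0 by simp
  have "((\<lambda>x. g (\<Phi> x)) has_derivative fderiv g 0) (at x0)"
    using has_derivative_compose[OF d\<Phi>, of g "fderiv g 0"] dg \<Phi>0 by simp
  moreover have "((\<lambda>x. g (\<Phi> x)) has_derivative (\<lambda>h. h)) (at x0)"
    by (rule has_derivative_transform_within_open[OF has_derivative_ident *(1,3)]) (simp add: g\<Phi>)
  ultimately have gid: "fderiv g 0 = (\<lambda>h. h)" by (rule has_derivative_unique)
  show thesis
  proof (rule that[of \<epsilon> \<gamma>])
    show "smooth_on {-\<epsilon><..<\<epsilon>} \<gamma>"
      unfolding \<gamma>_def
      by (rule smooth_on_compose[OF _ *(4) _ _ *(7)])
         (use eV in \<open>auto intro!: smooth_on_scaleR smooth_on_id smooth_on_const\<close>)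
    show "\<gamma> 0 = x0" using g\<Phi>[OF *(3)] \<Phi>0 by (simp add: \<gamma>_def)
    show "\<gamma> ` {-\<epsilon><..<\<epsilon>} \<subseteq> U" using \<Phi>g(2) eV *(2) by (auto simp: \<gamma>_def)
    show "f (\<gamma> t) = f x0" if "t \<in> {-\<epsilon><..<\<epsilon>}" for t
    proof -
      have "\<Phi> (\<gamma> t) = t *\<^sub>R v" unfolding \<gamma>_def by (rule \<Phi>g(1)[OF eV[OF that]])
      \<comment> \<open>At every \<open>x\<close> the value \<open>?D (\<Phi> x)\<close> is
        \<open>f x - f x0\<close>, since \<open>?D \<circ> r = id\<close> makes the last two terms
        of \<open>\<Phi>\<close> cancel. Hence \<open>f\<close> is constant wherever
        \<open>\<Phi>\<close> takes values in the kernel of \<open>?D\<close>.\<close>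
      then have "?D (\<Phi> (\<gamma> t)) = 0" using assms(5) lin by (simp add: linear_cmul)
      then show ?thesis
        unfolding \<Phi>_def by (simp add: linear_add[OF lin] linear_diff[OF lin] Dr)
    qed
    show "(\<gamma> has_vector_derivative v) (at 0)"
      using has_derivative_along_line[of g "fderiv g 0" 0 0 v] dg gid by (simp add: \<gamma>_def[abs_def])
  qed (rule e)
qed

section \<open>Integral curves of vector fields\<close>

text \<open>Mean value inequality on a convex compact ball. The operator norm of the derivative is
  bounded through the sum \<open>N\<close> of the norms of the partial derivatives, whose continuity
  follows directly from smoothness.\<close>

lemma smooth_on_lipschitz_cball:
  fixes X :: "'a::euclidean_space \<Rightarrow> 'b::real_normed_vector"
  assumes "smooth_on U X" "cball x0 r \<subseteq> U"
  obtains L where "L \<ge> 0" "\<And>x y. x \<in> cball x0 r \<Longrightarrow> y \<in> cball x0 r \<Longrightarrow> norm (X x - X y) \<le> L * norm (x - y)"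
proof -
  define N where "N x = (\<Sum>i\<in>Basis. norm (fderiv X x i))" for x
  have "continuous_on (cball x0 r) N"
    unfolding N_def
    by (intro continuous_intros continuous_on_subset[OF _ assms(2)] smooth_on_continuous_on
        smooth_on_fderiv[OF assms(1)])
  then have "bounded (N ` cball x0 r)"
    by (intro compact_imp_bounded compact_continuous_image compact_cball)
  then obtain L where L: "\<And>x. x \<in> cball x0 r \<Longrightarrow> norm (N x) \<le> L"
    unfolding bounded_iff by blast
  show thesis
  proof (rule that[of "\<bar>L\<bar>"])
    fix x y assume xy: "x \<in> cball x0 r" "y \<in> cball x0 r"
    show "norm (X x - X y) \<le> \<bar>L\<bar> * norm (x - y)"
    proof (rule differentiable_bound[OF convex_cball _ _ xy])
      fix z assume z: "z \<in> cball x0 r"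
      then have d: "(X has_derivative fderiv X z) (at z)"
        using smooth_on_has_fderiv[OF assms(1)] assms(2) by blast
      then show "(X has_derivative fderiv X z) (at z within cball x0 r)"
        by (rule has_derivative_at_withinI)
      have "onorm (fderiv X z) \<le> N z"
        unfolding N_def by (rule onorm_componentwise[OF has_derivative_bounded_linear[OF d]])
      then show "onorm (fderiv X z) \<le> \<bar>L\<bar>" using L[OF z] by simp
    qed
  qed simp
qed

text \<open>The integral from 0 to \<open>t\<close>, for \<open>t\<close> of either sign, is written
  as a difference of integrals starting at \<open>-h\<close>; so no oriented integral is
  needed.\<close>

lemma integral_difference_bound:
  fixes u :: "real \<Rightarrow> 'a::euclidean_space"
  assumes "continuous_on {-h..h} u" "h \<ge> 0" "\<And>s. s \<in> {-h..h} \<Longrightarrow> norm (u s) \<le> B" "t \<in> {-h..h}"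
  shows "norm (integral {-h..t} u - integral {-h..0} u) \<le> B * h"
proof -
  have "norm (integral {-h..t} u - integral {-h..0} u) \<le> B * norm (t - 0)"
  proof (rule differentiable_bound[where S="{-h..h}" and f'="\<lambda>s a. a *\<^sub>R u s"])
    fix s assume s: "s \<in> {-h..h}"
    show "((\<lambda>t. integral {-h..t} u) has_derivative (\<lambda>a. a *\<^sub>R u s)) (at s within {-h..h})"
      using integral_has_vector_derivative[OF assms(1) s] by (simp add: has_vector_derivative_def)
    show "onorm (\<lambda>a. a *\<^sub>R u s) \<le> B"
    proof (rule onorm_le)
      show "norm (a *\<^sub>R u s) \<le> B * norm a" for a
        using mult_left_mono[OF assms(3)[OF s] norm_ge_zero[of a]] by (simp add: mult.commute)
    qed
  qed (use assms in auto)
  also have "\<dots> \<le> B * h"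
    using assms(2,4) order_trans[OF norm_ge_zero assms(3)[of 0]] by (intro mult_left_mono) auto
  finally show ?thesis .
qed

text \<open>Picard's theorem: the integral operator \<open>T\<close> is a contraction on the
  continuous curves with values in a closed ball around \<open>x0\<close>, and its fixed point
  solves the equation.\<close>

theorem integral_curve_exists:
  fixes X :: "'a::euclidean_space \<Rightarrow> 'a"
  assumes "open U" "smooth_on U X" "x0 \<in> U"
  obtains \<gamma> \<epsilon> where "\<epsilon> > 0" "smooth_on {-\<epsilon><..<\<epsilon>} \<gamma>" "\<gamma> 0 = x0"
    "\<And>t. t \<in> {-\<epsilon><..<\<epsilon>} \<Longrightarrow> \<gamma> t \<in> U" "\<And>t. t \<in> {-\<epsilon><..<\<epsilon>} \<Longrightarrow> (\<gamma> has_vector_derivative X (\<gamma> t)) (at t)"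
proof -
  obtain r where r: "r > 0" "cball x0 r \<subseteq> U"
    using assms open_contains_cball by blast
  obtain L where L: "L \<ge> 0"
    "\<And>x y. x \<in> cball x0 r \<Longrightarrow> y \<in> cball x0 r \<Longrightarrow> norm (X x - X y) \<le> L * norm (x - y)"
    using smooth_on_lipschitz_cball[OF assms(2) r(2)] by metis
  have contX: "continuous_on (cball x0 r) X"
    by (rule continuous_on_subset[OF smooth_on_continuous_on[OF assms(2)] r(2)])
  then have "bounded (X ` cball x0 r)"
    by (intro compact_imp_bounded compact_continuous_image compact_cball)
  then obtain K where K: "K > 0" "\<And>x. x \<in> cball x0 r \<Longrightarrow> norm (X x) \<le> K"
    unfolding bounded_pos by blast
  \<comment> \<open>The bound \<open>r / K\<close> keeps the image of \<open>T\<close> in the ball,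
    and the other bound makes \<open>T\<close> contract by \<open>L * h \<le> 1 / 2\<close>; the
    summand 1 covers \<open>L = 0\<close>.\<close>
  define h where "h = min (r / K) (1 / (2 * (L + 1)))"
  have h: "h > 0" using r K L by (simp add: h_def)
  have hK: "K * h \<le> r"
  proof -
    have "K * h \<le> K * (r / K)" using K by (intro mult_left_mono) (auto simp: h_def)
    then show ?thesis using K by simp
  qed
  have hL: "L * h \<le> 1 / 2"
  proof -
    have "L * h \<le> (L + 1) * (1 / (2 * (L + 1)))" using L(1) h by (intro mult_mono) (auto simp: h_def)
    moreover have "(L + 1) * (1 / (2 * (L + 1))) = 1 / 2" using L(1) by (simp add: field_simps)
    ultimately show ?thesis by linarith
  qed
  \<comment> \<open>Bounded continuous functions on the whole line form a complete metric space, and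
    \<open>S\<close> is a closed subset of it.\<close>
  define S where "S = (PiC UNIV (\<lambda>_. cball x0 r) :: (real \<Rightarrow>\<^sub>C 'a) set)"
  have S: "\<phi> \<in> S \<longleftrightarrow> (\<forall>t. apply_bcontfun \<phi> t \<in> cball x0 r)" for \<phi>
    by (auto simp: S_def mem_PiC_iff Pi_iff)
  \<comment> \<open>Clamping the time to \<open>{-h..h}\<close> makes each image under
    \<open>T\<close> a function on the whole line, constant outside that interval.\<close>
  define c where "c t = max (-h) (min h t)" for t :: real
  have c: "c t \<in> {-h..h}" for t using h by (simp add: c_def)
  define F where "F \<phi> t = integral {-h..t} (\<lambda>s. X (apply_bcontfun \<phi> s))" for \<phi> :: "real \<Rightarrow>\<^sub>C 'a" and t
  define T where "T \<phi> = Bcontfun (\<lambda>t. x0 + (F \<phi> (c t) - F \<phi> 0))" for \<phi>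
  have cont: "continuous_on A (\<lambda>s. X (apply_bcontfun \<phi> s))" if "\<phi> \<in> S" for \<phi> A
    by (rule continuous_on_compose2[OF contX]) (use that in \<open>auto simp: S\<close>)
  have F: "norm (F \<phi> (c t) - F \<phi> 0) \<le> r" if "\<phi> \<in> S" for \<phi> t
  proof -
    have "norm (F \<phi> (c t) - F \<phi> 0) \<le> K * h"
      unfolding F_def
      by (rule integral_difference_bound[OF cont[OF that] _ _ c]) (use h K that in \<open>auto simp: S\<close>)
    then show ?thesis using hK by simp
  qed
  have dF: "(F \<phi> has_vector_derivative X (apply_bcontfun \<phi> t)) (at t within {-h..h})"
    if "\<phi> \<in> S" "t \<in> {-h..h}" for \<phi> t
    unfolding F_def[abs_def] by (rule integral_has_vector_derivative[OF cont[OF that(1)] that(2)])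
  have T: "apply_bcontfun (T \<phi>) t = x0 + (F \<phi> (c t) - F \<phi> 0)" if "\<phi> \<in> S" for \<phi> t
  proof -
    have "continuous_on {-h..h} (F \<phi>)"
      using dF[OF that] has_vector_derivative_continuous continuous_on_eq_continuous_within by blast
    then have "continuous_on UNIV (\<lambda>t. F \<phi> (c t))"
      by (rule continuous_on_compose2) (use c in \<open>auto simp: c_def intro!: continuous_intros\<close>)
    then have "continuous_on UNIV (\<lambda>t. x0 + (F \<phi> (c t) - F \<phi> 0))" by (intro continuous_intros)
    moreover have "norm (x0 + (F \<phi> (c t) - F \<phi> 0)) \<le> norm x0 + r" for t
      using norm_triangle_ineq[of x0 "F \<phi> (c t) - F \<phi> 0"] F[OF that, of t] by linarith
    ultimately show ?thesis
      unfolding T_def by (subst Bcontfun_inverse) (auto intro: bcontfun_normI)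
  qed
  have "\<exists>!\<phi>\<in>S. T \<phi> = \<phi>"
  proof (rule Banach_fix[where c="1/2"])
    show "complete S"
      unfolding S_def by (intro closed_PiC[THEN complete_eq_closed[THEN iffD2]]) auto
    have "const_bcontfun x0 \<in> S" using r by (simp add: S const_bcontfun.rep_eq)
    then show "S \<noteq> {}" by blast
    show "T ` S \<subseteq> S"
    proof (rule image_subsetI)
      show "T \<phi> \<in> S" if "\<phi> \<in> S" for \<phi>
        using F[OF that] unfolding S by (simp add: T[OF that] dist_norm norm_minus_commute)
    qed
    fix \<phi> \<psi> assume S2: "\<phi> \<in> S" "\<psi> \<in> S"
    show "dist (T \<phi>) (T \<psi>) \<le> 1 / 2 * dist \<phi> \<psi>"
    proof (rule dist_bound)
      fix t
      let ?u = "\<lambda>s. X (apply_bcontfun \<phi> s) - X (apply_bcontfun \<psi> s)"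
      have int: "integral {-h..t} ?u = F \<phi> t - F \<psi> t" for t
        unfolding F_def by (intro integral_diff integrable_continuous_interval cont S2)
      have "norm (integral {-h..c t} ?u - integral {-h..0} ?u) \<le> (L * dist \<phi> \<psi>) * h"
      proof (rule integral_difference_bound[OF _ _ _ c])
        show "norm (?u s) \<le> L * dist \<phi> \<psi>" for s
        proof -
          have "norm (?u s) \<le> L * dist (apply_bcontfun \<phi> s) (apply_bcontfun \<psi> s)"
            using L(2) S2 by (simp add: S dist_norm)
          also have "\<dots> \<le> L * dist \<phi> \<psi>" by (intro mult_left_mono dist_bounded L(1))
          finally show ?thesis .
        qed
      qed (use h S2 in \<open>auto intro!: continuous_intros cont\<close>)
      also have "\<dots> \<le> 1 / 2 * dist \<phi> \<psi>"
        using mult_right_mono[OF hL zero_le_dist[of \<phi> \<psi>]] by (simp add: mult_ac)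
      finally show "dist (apply_bcontfun (T \<phi>) t) (apply_bcontfun (T \<psi>) t) \<le> 1 / 2 * dist \<phi> \<psi>"
        by (simp add: T S2 int dist_norm algebra_simps)
    qed
  qed auto
  then obtain \<phi> where \<phi>: "\<phi> \<in> S" "T \<phi> = \<phi>" by blast
  define \<gamma> where "\<gamma> = apply_bcontfun \<phi>"
  have \<gamma>: "\<gamma> t = x0 + (F \<phi> (c t) - F \<phi> 0)" for t
    using T[OF \<phi>(1), of t] \<phi>(2) by (simp add: \<gamma>_def)
  have inU: "\<gamma> t \<in> U" for t using \<phi>(1) r(2) by (auto simp: S \<gamma>_def)
  have d\<gamma>: "(\<gamma> has_vector_derivative X (\<gamma> t)) (at t)" if t: "t \<in> {-h<..<h}" for t
  proof -
    have "(F \<phi> has_vector_derivative X (\<gamma> t)) (at t within {-h<..<h})"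
      using dF[OF \<phi>(1), of t] t unfolding \<gamma>_def
      by (intro has_vector_derivative_within_subset[where S="{-h..h}" and T="{-h<..<h}"]) auto
    then have "(F \<phi> has_vector_derivative X (\<gamma> t)) (at t)"
      unfolding at_within_open[OF t open_greaterThanLessThan] .
    then have "((\<lambda>t. x0 + (F \<phi> t - F \<phi> 0)) has_vector_derivative X (\<gamma> t)) (at t)"
      by (auto intro!: derivative_eq_intros)
    then show ?thesis
      by (rule has_vector_derivative_transform_within_open[OF _ open_greaterThanLessThan t])
        (auto simp: \<gamma> c_def)
  qed
  \<comment> \<open>Each order of smoothness of \<open>\<gamma>\<close> passes to its derivative
    \<open>X (\<gamma> t)\<close> and so yields the next order.\<close>
  have "Ck_on k {-h<..<h} \<gamma>" for k
  proof (induction k)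
    case 0
    then show ?case by (simp add: \<gamma>_def)
  next
    case (Suc k)
    show ?case
    proof (rule Ck_on_SucI[OF open_greaterThanLessThan])
      show "(\<gamma> has_derivative (\<lambda>v. v *\<^sub>R X (\<gamma> t))) (at t)" if "t \<in> {-h<..<h}" for t
        using d\<gamma>[OF that] by (simp add: has_vector_derivative_def)
      show "Ck_on k {-h<..<h} (\<lambda>t. v *\<^sub>R X (\<gamma> t))" for v
        by (intro Ck_on_scaleR Ck_on_const open_greaterThanLessThan
            Ck_on_compose[OF open_greaterThanLessThan assms(1) _ Suc smooth_onD[OF assms(2)]])
          (use inU in auto)
    qed
  qed
  then have "smooth_on {-h<..<h} \<gamma>" by (simp add: smooth_on_def)
  moreover have "\<gamma> 0 = x0" using h by (simp add: \<gamma> c_def)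
  ultimately show thesis using that h inU d\<gamma> by blast
qed

section \<open>Linear algebra in dimensions two and three\<close>

lemma linear_functional_eq_inner:
  fixes f :: "real^'n \<Rightarrow> real"
  assumes "linear f"
  shows "f v = (\<chi> i. f (axis i 1)) \<bullet> v"
proof -
  have "f v = f (\<Sum>i\<in>UNIV. v $ i *\<^sub>R axis i 1)"
    using basis_expansion[of v] by (simp add: scalar_mult_eq_scaleR)
  also have "\<dots> = (\<Sum>i\<in>UNIV. v $ i * f (axis i 1))"
    by (simp add: linear_sum[OF assms] linear_cmul[OF assms])
  finally show ?thesis by (simp add: inner_vec_def mult.commute)
qed

lemma cross_eq_0_imp_multiple:
  fixes a v :: "real^3"
  assumes "a \<noteq> 0" "cross3 v a = 0"
  obtains k where "v = k *\<^sub>R a"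
proof -
  have *: "(a \<bullet> a) *\<^sub>R v = (a \<bullet> v) *\<^sub>R a"
    using Lagrange[of a v a] assms(2) by simp
  have "v = inverse (a \<bullet> a) *\<^sub>R ((a \<bullet> a) *\<^sub>R v)" using assms(1) by simp
  then show thesis unfolding * scaleR_scaleR by (rule that)
qed

text \<open>By Lagrange's identity \<open>v\<close> has zero cross product with
  \<open>cross3 a b\<close>, so the two are parallel.\<close>

lemma orthogonal_both_imp_multiple_cross:
  fixes a b v :: "real^3"
  assumes "cross3 a b \<noteq> 0" "v \<bullet> a = 0" "v \<bullet> b = 0"
  obtains k where "v = k *\<^sub>R cross3 a b"
  using cross_eq_0_imp_multiple[OF assms(1), of v] Lagrange[of v a b] assms(2,3) by auto

text \<open>With \<open>n\<close> the cross product of \<open>a\<close> and \<open>b\<close>, the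
  vector \<open>(n \<bullet> n) v\<close> equals \<open>cross3 n (cross3 v n)\<close>. The inner
  product \<open>cross3 v n\<close> is a combination of \<open>a\<close> and \<open>b\<close>, and
  taking the cross product with \<open>n\<close> maps \<open>a\<close> and \<open>b\<close> back
  into their span.\<close>

lemma orthogonal_cross_imp_span:
  fixes a b v :: "real^3"
  assumes "cross3 a b \<noteq> 0" "cross3 a b \<bullet> v = 0"
  obtains s t where "v = s *\<^sub>R a + t *\<^sub>R b"
proof -
  let ?n = "cross3 a b"
  have "(?n \<bullet> ?n) *\<^sub>R v = cross3 ?n (cross3 v ?n)"
    using Lagrange[of ?n v ?n] assms(2) by simp
  also have "\<dots> = (v \<bullet> b) *\<^sub>R cross3 ?n a - (v \<bullet> a) *\<^sub>R cross3 ?n b"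
    by (simp add: Lagrange[of v a b] Cross3.right_diff_distrib cross_mult_right)
  also have "cross3 ?n a = (a \<bullet> a) *\<^sub>R b - (a \<bullet> b) *\<^sub>R a"
    using Lagrange[of a a b] cross_skew[of ?n a] by simp
  also have "cross3 ?n b = (a \<bullet> b) *\<^sub>R b - (b \<bullet> b) *\<^sub>R a"
    using Lagrange[of b a b] cross_skew[of ?n b] by (simp add: inner_commute)
  finally have *: "(?n \<bullet> ?n) *\<^sub>R v = ((v \<bullet> a) * (b \<bullet> b) - (v \<bullet> b) * (a \<bullet> b)) *\<^sub>R a
      + ((v \<bullet> b) * (a \<bullet> a) - (v \<bullet> a) * (a \<bullet> b)) *\<^sub>R b"
    by (simp add: algebra_simps)
  have "v = inverse (?n \<bullet> ?n) *\<^sub>R ((?n \<bullet> ?n) *\<^sub>R v)" using assms(1) by simp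
  then show thesis unfolding * scaleR_add_right scaleR_scaleR by (rule that)
qed

lemma orthogonal_same_imp_multiple:
  fixes d w a :: "real^2"
  assumes "a \<noteq> 0" "d \<noteq> 0" "a \<bullet> d = 0" "a \<bullet> w = 0"
  obtains k where "w = k *\<^sub>R d"
proof -
  have e: "a$1 * d$1 + a$2 * d$2 = 0" "a$1 * w$1 + a$2 * w$2 = 0"
    using assms by (simp_all add: inner_vec_def sum_2)
  \<comment> \<open>The determinant of \<open>d\<close> and \<open>w\<close>, multiplied by either
    entry of \<open>a\<close>, is a combination of the two orthogonality relations; since
    \<open>a\<close> is nonzero the determinant vanishes.\<close>
  have "a$1 * (d$1 * w$2 - d$2 * w$1) = w$2 * (a$1 * d$1 + a$2 * d$2) - d$2 * (a$1 * w$1 + a$2 * w$2)"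
    "a$2 * (d$1 * w$2 - d$2 * w$1) = d$1 * (a$1 * w$1 + a$2 * w$2) - w$1 * (a$1 * d$1 + a$2 * d$2)"
    by (simp_all add: algebra_simps)
  moreover have "a$1 \<noteq> 0 \<or> a$2 \<noteq> 0" using assms(1) by (auto simp: vec_eq_iff forall_2)
  ultimately have c: "d$1 * w$2 = d$2 * w$1" using e by auto
  have "d$1 \<noteq> 0 \<or> d$2 \<noteq> 0" using assms(2) by (auto simp: vec_eq_iff forall_2)
  then show thesis
  proof
    assume "d$1 \<noteq> 0"
    then have "w = (w$1 / d$1) *\<^sub>R d" using c by (auto simp: vec_eq_iff forall_2 field_simps)
    then show thesis by (rule that)
  next
    assume "d$2 \<noteq> 0"
    then have "w = (w$2 / d$2) *\<^sub>R d" using c by (auto simp: vec_eq_iff forall_2 field_simps)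
    then show thesis by (rule that)
  qed
qed

section \<open>Gradients and kernel fields\<close>

definition gradient :: "(real^'n \<Rightarrow> real) \<Rightarrow> real^'n \<Rightarrow> real^'n" where
  "gradient f x = (\<chi> i. fderiv f x (axis i 1))"

lemma fderiv_eq_gradient: "smooth_on U f \<Longrightarrow> x \<in> U \<Longrightarrow> fderiv f x v = gradient f x \<bullet> v"
  unfolding gradient_def by (rule linear_functional_eq_inner[OF smooth_on_linear_fderiv])

lemma smooth_on_gradient: "open U \<Longrightarrow> smooth_on U f \<Longrightarrow> smooth_on U (gradient f)"
  unfolding gradient_def[abs_def] by (intro smooth_on_vec_lambda smooth_on_fderiv)

text \<open>Equality of mixed derivatives, restated for the Hessian as a bilinear form.\<close>

lemma fderiv_gradient_commute:
  assumes "open U" "smooth_on U f" "x \<in> U"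
  shows "fderiv (gradient f) x u \<bullet> w = fderiv (gradient f) x w \<bullet> u"
proof -
  have *: "fderiv (\<lambda>y. fderiv f y w) x u = fderiv (gradient f) x u \<bullet> w" for u w
  proof -
    have "(gradient f has_derivative fderiv (gradient f) x) (at x)"
      by (rule smooth_on_has_fderiv[OF smooth_on_gradient[OF assms(1,2)] assms(3)])
    then have "((\<lambda>y. gradient f y \<bullet> w) has_derivative (\<lambda>u. fderiv (gradient f) x u \<bullet> w)) (at x)"
      by (rule has_derivative_inner_left)
    then have "((\<lambda>y. fderiv f y w) has_derivative (\<lambda>u. fderiv (gradient f) x u \<bullet> w)) (at x)"
      by (rule has_derivative_transform_within_open[OF _ assms(1,3)])
        (simp add: fderiv_eq_gradient[OF assms(2)])
    then show ?thesis by (simp add: fderiv_eq)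
  qed
  show ?thesis using fderiv_fderiv_commute[OF assms, of w u] unfolding * .
qed

text \<open>The kernel of a 2 by 3 matrix of rank two is spanned by the cross product of its rows.
  This formula gives a smooth spanning field of the fibre directions without a choice at each
  point.\<close>

definition kernel_field :: "(real^3 \<Rightarrow> real^2) \<Rightarrow> real^3 \<Rightarrow> real^3" where
  "kernel_field R x = cross3 (matrix (fderiv R x) $ 1) (matrix (fderiv R x) $ 2)"

lemma fderiv_nth_eq_row:
  assumes "smooth_on U R" "x \<in> U"
  shows "fderiv R x v $ i = matrix (fderiv R x) $ i \<bullet> v"
  using fun_cong[OF matrix_vector_mul(2)[OF smooth_on_linear_fderiv[OF assms]], of v]
    matrix_vector_mul_component[of "matrix (fderiv R x)" v i] by simp

lemma smooth_on_kernel_field: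
  assumes "open U" "smooth_on U R"
  shows "smooth_on U (kernel_field R)"
proof -
  have rows: "smooth_on U (\<lambda>x. matrix (fderiv R x) $ i)" for i
    unfolding matrix_def
    by (simp, intro smooth_on_vec_lambda smooth_on_vec_nth smooth_on_fderiv assms)
  have "bounded_bilinear cross3"
    using bilinear_cross bilinear_conv_bounded_bilinear by blast
  from smooth_on_bilinear[OF this assms(1) rows rows] show ?thesis
    unfolding kernel_field_def[abs_def] .
qed

lemma fderiv_kernel_field:
  assumes "smooth_on U R" "x \<in> U"
  shows "fderiv R x (kernel_field R x) = 0"
  by (simp add: vec_eq_iff forall_2 fderiv_nth_eq_row[OF assms] kernel_field_def dot_cross_self)

lemma kernel_field_nonzero:
  assumes "smooth_on U R" "x \<in> U" "surj (fderiv R x)"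
  shows "kernel_field R x \<noteq> 0"
proof
  assume 0: "kernel_field R x = 0"
  obtain v where v: "fderiv R x v = axis 1 1" using assms(3) by (metis surjD)
  obtain w where w: "fderiv R x w = axis 2 1" using assms(3) by (metis surjD)
  let ?r = "\<lambda>i. matrix (fderiv R x) $ i"
  have "?r 1 \<bullet> v = 1" "?r 2 \<bullet> v = 0" "?r 2 \<bullet> w = 1"
    using fderiv_nth_eq_row[OF assms(1,2), of v] fderiv_nth_eq_row[OF assms(1,2), of w]
    by (simp_all add: v w axis_def flip: fderiv_nth_eq_row[OF assms(1,2)])
  \<comment> \<open>By Lagrange's identity the cross product of \<open>v\<close> with the kernel
    field is minus the second row, which would have to be zero although its inner product with
    \<open>w\<close> is 1.\<close>
  then show False
    using Lagrange[of v "?r 1" "?r 2"] 0 by (simp add: kernel_field_def inner_commute)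
qed

lemma fderiv_eq_0_imp_multiple:
  assumes "smooth_on U R" "x \<in> U" "surj (fderiv R x)" "fderiv R x v = 0"
  obtains k where "v = k *\<^sub>R kernel_field R x"
proof -
  have "v \<bullet> matrix (fderiv R x) $ i = 0" for i
    using fderiv_nth_eq_row[OF assms(1,2), of v i] assms(4) by (simp add: inner_commute)
  then show thesis
    using orthogonal_both_imp_multiple_cross kernel_field_nonzero[OF assms(1-3)] that
    unfolding kernel_field_def by metis
qed

section \<open>A transverse pair of Legendrian submersions in coordinates\<close>

text \<open>The geometric hypotheses read in one chart of the contact manifold and one chart of each
  base. Vectors tangent to the fibres become kernel vectors of the derivatives, which turns the
  Legendrian and transversality conditions into linear algebra at each point.\<close>

locale legendrian_pair =
  fixes U :: "(real^3) set" and \<alpha> :: "real^3 \<Rightarrow> real^3" and R R' :: "real^3 \<Rightarrow> real^2"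
  assumes open_U: "open U"
    and smooth_\<alpha>: "smooth_on U \<alpha>" and smooth_R: "smooth_on U R" and smooth_R': "smooth_on U R'"
    and contact: "x \<in> U \<Longrightarrow> \<exists>u v w. wedge_ext_deriv \<alpha> x u v w \<noteq> 0"
    and surj_R: "x \<in> U \<Longrightarrow> surj (fderiv R x)" and surj_R': "x \<in> U \<Longrightarrow> surj (fderiv R' x)"
    and legendrian_R: "x \<in> U \<Longrightarrow> fderiv R x v = 0 \<Longrightarrow> \<alpha> x \<bullet> v = 0"
    and legendrian_R': "x \<in> U \<Longrightarrow> fderiv R' x v = 0 \<Longrightarrow> \<alpha> x \<bullet> v = 0"
    and transverse: "x \<in> U \<Longrightarrow> fderiv R x v = 0 \<Longrightarrow> fderiv R' x v = 0 \<Longrightarrow> v = 0"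
begin

abbreviation E where "E \<equiv> kernel_field R"
abbreviation E' where "E' \<equiv> kernel_field R'"

lemma R_E: "x \<in> U \<Longrightarrow> fderiv R x (E x) = 0" and R'_E': "x \<in> U \<Longrightarrow> fderiv R' x (E' x) = 0"
  by (rule fderiv_kernel_field[OF smooth_R] fderiv_kernel_field[OF smooth_R']; assumption)+

lemma \<alpha>_E: "x \<in> U \<Longrightarrow> \<alpha> x \<bullet> E x = 0" and \<alpha>_E': "x \<in> U \<Longrightarrow> \<alpha> x \<bullet> E' x = 0"
  by (simp_all add: legendrian_R legendrian_R' R_E R'_E')

lemma E_nonzero: "x \<in> U \<Longrightarrow> E x \<noteq> 0" and E'_nonzero: "x \<in> U \<Longrightarrow> E' x \<noteq> 0"
  by (simp_all add: kernel_field_nonzero[OF smooth_R _ surj_R] kernel_field_nonzero[OF smooth_R' _ surj_R'])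

lemma R_E'_nonzero: "x \<in> U \<Longrightarrow> fderiv R x (E' x) \<noteq> 0"
  and R'_E_nonzero: "x \<in> U \<Longrightarrow> fderiv R' x (E x) \<noteq> 0"
  using transverse E_nonzero E'_nonzero R_E R'_E' by blast+

lemma linear_R: "x \<in> U \<Longrightarrow> linear (fderiv R x)" and linear_R': "x \<in> U \<Longrightarrow> linear (fderiv R' x)"
  and linear_\<alpha>: "x \<in> U \<Longrightarrow> linear (fderiv \<alpha> x)"
  by (rule smooth_on_linear_fderiv[OF smooth_R] smooth_on_linear_fderiv[OF smooth_R']
      smooth_on_linear_fderiv[OF smooth_\<alpha>]; assumption)+

lemma cross_E_E'_nonzero:
  assumes "x \<in> U"
  shows "cross3 (E x) (E' x) \<noteq> 0"
proof
  assume "cross3 (E x) (E' x) = 0"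
  then obtain k where k: "E x = k *\<^sub>R E' x" using cross_eq_0_imp_multiple E'_nonzero[OF assms] by blast
  have "fderiv R' x (E x) = 0"
    unfolding k using R'_E'[OF assms] by (simp add: linear_cmul[OF linear_R'[OF assms]])
  then show False using R'_E_nonzero[OF assms] by simp
qed

lemma \<alpha>_nonzero: "x \<in> U \<Longrightarrow> \<alpha> x \<noteq> 0"
  using contact[of x] by (auto simp: wedge_ext_deriv_def)

text \<open>The orthogonal complement of the plane spanned by \<open>E\<close> and \<open>E'\<close>
  is a line, and it contains the nonzero vector \<open>\<alpha> x\<close>.\<close>

lemma orthogonal_imp_multiple_\<alpha>:
  assumes "x \<in> U" "a \<bullet> E x = 0" "a \<bullet> E' x = 0"
  obtains k where "a = k *\<^sub>R \<alpha> x"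
proof -
  obtain k where k: "a = k *\<^sub>R cross3 (E x) (E' x)"
    using orthogonal_both_imp_multiple_cross[OF cross_E_E'_nonzero] assms by blast
  obtain l where l: "\<alpha> x = l *\<^sub>R cross3 (E x) (E' x)"
    using orthogonal_both_imp_multiple_cross[OF cross_E_E'_nonzero] assms(1) \<alpha>_E \<alpha>_E' by blast
  have "l \<noteq> 0" using l \<alpha>_nonzero[OF assms(1)] by auto
  then have "a = (k / l) *\<^sub>R \<alpha> x" using k l by simp
  then show thesis by (rule that)
qed

lemma contact_plane_span:
  assumes "x \<in> U" "\<alpha> x \<bullet> v = 0"
  obtains a b where "v = a *\<^sub>R E x + b *\<^sub>R E' x"
proof -
  obtain l where l: "\<alpha> x = l *\<^sub>R cross3 (E x) (E' x)"
    using orthogonal_both_imp_multiple_cross[OF cross_E_E'_nonzero] assms(1) \<alpha>_E \<alpha>_E' by blast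
  have "l \<noteq> 0" using l \<alpha>_nonzero[OF assms(1)] by auto
  then have "cross3 (E x) (E' x) \<bullet> v = 0" using assms(2) l by simp
  then show thesis using orthogonal_cross_imp_span[OF cross_E_E'_nonzero[OF assms(1)]] that by blast
qed

text \<open>Since \<open>\<alpha>\<close> annihilates \<open>E\<close> and \<open>E'\<close>, the
  3-form of the contact condition takes on \<open>(n, E, E')\<close> the value
  \<open>\<alpha>(n) d\<alpha>(E, E')\<close>, and any other triple only contributes a determinant
  factor. If \<open>d\<alpha>(E, E')\<close> vanished, the 3-form would be zero.\<close>

lemma ext_deriv_E_E'_nonzero:
  assumes x: "x \<in> U"
  shows "ext_deriv \<alpha> x (E x) (E' x) \<noteq> 0"
proof
  assume 0: "ext_deriv \<alpha> x (E x) (E' x) = 0"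
  define n where "n = cross3 (E x) (E' x)"
  have n: "n \<noteq> 0" using cross_E_E'_nonzero[OF x] by (simp add: n_def)
  have repr: "\<exists>a b c. u = a *\<^sub>R n + b *\<^sub>R E x + c *\<^sub>R E' x" for u
  proof -
    have "n \<bullet> (u - ((n \<bullet> u) / (n \<bullet> n)) *\<^sub>R n) = 0" using n by (simp add: inner_diff_right)
    then obtain b c where "u - ((n \<bullet> u) / (n \<bullet> n)) *\<^sub>R n = b *\<^sub>R E x + c *\<^sub>R E' x"
      using orthogonal_cross_imp_span n unfolding n_def by metis
    then have "u = ((n \<bullet> u) / (n \<bullet> n)) *\<^sub>R n + b *\<^sub>R E x + c *\<^sub>R E' x" by (simp add: algebra_simps)
    then show ?thesis by blast
  qed
  note lin = linear_add[OF linear_\<alpha>[OF x]] linear_cmul[OF linear_\<alpha>[OF x]]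
  have ext: "ext_deriv \<alpha> x (a *\<^sub>R n + b *\<^sub>R E x + c *\<^sub>R E' x) (a' *\<^sub>R n + b' *\<^sub>R E x + c' *\<^sub>R E' x)
      = (a * b' - b * a') * ext_deriv \<alpha> x n (E x) + (a * c' - c * a') * ext_deriv \<alpha> x n (E' x)
        + (b * c' - c * b') * ext_deriv \<alpha> x (E x) (E' x)" for a b c a' b' c'
    unfolding ext_deriv_def lin by (simp add: inner_add_left inner_add_right algebra_simps)
  have "wedge_ext_deriv \<alpha> x u v w = 0" for u v w
  proof -
    obtain a b c where u: "u = a *\<^sub>R n + b *\<^sub>R E x + c *\<^sub>R E' x" using repr by blast
    obtain a' b' c' where v: "v = a' *\<^sub>R n + b' *\<^sub>R E x + c' *\<^sub>R E' x" using repr by blast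
    obtain a'' b'' c'' where w: "w = a'' *\<^sub>R n + b'' *\<^sub>R E x + c'' *\<^sub>R E' x" using repr by blast
    show ?thesis
      unfolding wedge_ext_deriv_def u v w ext
      using 0 \<alpha>_E[OF x] \<alpha>_E'[OF x] by (simp add: inner_add_right algebra_simps)
  qed
  then show False using contact[OF x] by blast
qed

end

lemma curve_chain_rule:
  assumes "(\<gamma> has_vector_derivative v) (at t)" "(f has_derivative f') (at (\<gamma> t))"
  shows "((\<lambda>s. f (\<gamma> s)) has_vector_derivative f' v) (at t)"
  using has_derivative_compose[OF assms(1)[unfolded has_vector_derivative_def] assms(2)]
    has_derivative_linear[OF assms(2)]
  by (simp add: has_vector_derivative_def linear_cmul)

lemma smooth_curve_has_vector_derivative:
  assumes "smooth_on I \<gamma>" "t \<in> I"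
  shows "(\<gamma> has_vector_derivative fderiv \<gamma> t 1) (at t)"
  using has_derivative_along_line[of \<gamma> _ 0 t 1] smooth_on_has_fderiv[OF assms] by simp

text \<open>Differentiates an orthogonality that holds near a point; this is how the first
  derivatives of the kernel fields and of \<alpha> get related.\<close>

lemma inner_derivative_constant:
  fixes f g :: "'a::real_normed_vector \<Rightarrow> 'b::real_inner"
  assumes "(f has_derivative f') (at x)" "(g has_derivative g') (at x)"
    "open S" "x \<in> S" "\<And>y. y \<in> S \<Longrightarrow> f y \<bullet> g y = c"
  shows "f' u \<bullet> g x + f x \<bullet> g' u = 0"
proof -
  have "((\<lambda>y. f y \<bullet> g y) has_derivative (\<lambda>u. f x \<bullet> g' u + f' u \<bullet> g x)) (at x)"
    by (rule has_derivative_inner[OF assms(1,2)])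
  moreover have "((\<lambda>y. f y \<bullet> g y) has_derivative (\<lambda>u. 0)) (at x)"
    by (rule has_derivative_transform_within_open[OF has_derivative_const[of c] assms(3,4)])
      (simp add: assms(5))
  ultimately have "(\<lambda>u. f x \<bullet> g' u + f' u \<bullet> g x) = (\<lambda>u. 0)" by (rule has_derivative_unique)
  then have "f x \<bullet> g' u + f' u \<bullet> g x = 0" by (rule fun_cong)
  then show ?thesis by (simp add: add.commute)
qed

section \<open>Order of contact of a front with the image of a fibre\<close>

context legendrian_pair
begin

lemma smooth_E: "smooth_on U E" and smooth_E': "smooth_on U E'"
  by (rule smooth_on_kernel_field[OF open_U smooth_R] smooth_on_kernel_field[OF open_U smooth_R'])+

text \<open>At \<open>x\<^sub>0\<close> the gradient of \<open>G\<close> is \<open>\<lambda> \<alpha>\<close>.  The form \<open>Q(u, w) = Hess G (u, w) - \<lambda> (D\<alpha> u) \<bullet> w\<close> computes the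
  second derivative of \<open>G\<close> along a Legendre curve as \<open>Q(v, v)\<close>, and it vanishes on \<open>(u, E)\<close> for all \<open>u\<close>
  and on \<open>(E', E')\<close>.  For \<open>v = a E + b E'\<close> this leaves \<open>a b Q(E, E') = - a b \<lambda> d\<alpha>(E, E')\<close>.\<close>

lemma second_derivative_along_legendre_curve:
  assumes "open U1" "U1 \<subseteq> U" "x0 \<in> U1" "smooth_on U1 G"
    and GE: "\<And>x. x \<in> U1 \<Longrightarrow> gradient G x \<bullet> E x = 0"
    and GE': "\<And>x. x \<in> U1 \<Longrightarrow> R' x = R' x0 \<Longrightarrow> gradient G x \<bullet> E' x = 0"
    and G0: "gradient G x0 \<noteq> 0"
    and "open I" "t \<in> I" "smooth_on I \<gamma>" "\<gamma> t = x0" "\<And>s. s \<in> I \<Longrightarrow> \<gamma> s \<in> U1"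
    and leg: "\<And>s. s \<in> I \<Longrightarrow> \<alpha> (\<gamma> s) \<bullet> fderiv \<gamma> s 1 = 0"
    and imm: "fderiv R x0 (fderiv \<gamma> t 1) \<noteq> 0"
  shows "deriv (\<lambda>s. G (\<gamma> s)) t = 0"
    and "deriv (deriv (\<lambda>s. G (\<gamma> s))) t = 0 \<longleftrightarrow> fderiv R' x0 (fderiv \<gamma> t 1) = 0"
proof -
  have x0: "x0 \<in> U" using assms by blast
  define v where "v = fderiv \<gamma> t 1"
  define \<gamma>1 where "\<gamma>1 s = fderiv \<gamma> s 1" for s
  have v: "\<gamma>1 t = v" by (simp add: v_def \<gamma>1_def)
  have d\<gamma>: "(\<gamma> has_vector_derivative \<gamma>1 s) (at s)" if "s \<in> I" for s
    unfolding \<gamma>1_def by (rule smooth_curve_has_vector_derivative[OF assms(10) that])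
  have d\<gamma>1: "(\<gamma>1 has_derivative fderiv \<gamma>1 t) (at t)"
    unfolding \<gamma>1_def[abs_def] by (rule smooth_on_has_fderiv[OF smooth_on_fderiv[OF assms(10)] assms(9)])
  have dG: "(gradient G has_derivative fderiv (gradient G) x) (at x)" if "x \<in> U1" for x
    by (rule smooth_on_has_fderiv[OF smooth_on_gradient[OF assms(1,4)] that])
  have d\<alpha>: "(\<alpha> has_derivative fderiv \<alpha> x0) (at x0)"
    by (rule smooth_on_has_fderiv[OF smooth_\<alpha> x0])
  have dE: "(E has_derivative fderiv E x0) (at x0)" "(E' has_derivative fderiv E' x0) (at x0)"
    using smooth_on_has_fderiv smooth_E smooth_E' x0 by blast+
  define H where "H u w = fderiv (gradient G) x0 u \<bullet> w" for u w
  define A where "A u w = fderiv \<alpha> x0 u \<bullet> w" for u w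
  have H_lin: "H (a *\<^sub>R u + b *\<^sub>R u') (c *\<^sub>R w + d *\<^sub>R w')
      = a * c * H u w + a * d * H u w' + b * c * H u' w + b * d * H u' w'" for a b c d u u' w w'
    using has_derivative_linear[OF dG[OF assms(3)]]
    by (simp add: H_def linear_add linear_cmul inner_add_left inner_add_right algebra_simps)
  have A_lin: "A (a *\<^sub>R u + b *\<^sub>R u') (c *\<^sub>R w + d *\<^sub>R w')
      = a * c * A u w + a * d * A u w' + b * c * A u' w + b * d * A u' w'" for a b c d u u' w w'
    using has_derivative_linear[OF d\<alpha>]
    by (simp add: A_def linear_add linear_cmul inner_add_left inner_add_right algebra_simps)
  have H_sym: "H u w = H w u" for u w
    unfolding H_def by (rule fderiv_gradient_commute[OF assms(1,4,3)])
  obtain l where l: "gradient G x0 = l *\<^sub>R \<alpha> x0"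
    using orthogonal_imp_multiple_\<alpha>[OF x0 GE[OF assms(3)] GE'[OF assms(3) refl]] .
  have l0: "l \<noteq> 0" using G0 l by auto
  \<comment> \<open>Both gradients \<open>gradient G\<close> and \<open>\<alpha>\<close> are
    orthogonal to \<open>E\<close> on an open set. Differentiating the two relations produces the
    derivative of \<open>E\<close> paired with \<open>l \<alpha>\<close> and with
    \<open>\<alpha>\<close>, so it can be eliminated.\<close>
  have HE: "H u (E x0) = l * A u (E x0)" for u
  proof -
    have "H u (E x0) + gradient G x0 \<bullet> fderiv E x0 u = 0"
      unfolding H_def by (rule inner_derivative_constant[OF dG[OF assms(3)] dE(1) assms(1,3) GE])
    moreover have "A u (E x0) + \<alpha> x0 \<bullet> fderiv E x0 u = 0"
      unfolding A_def by (rule inner_derivative_constant[OF d\<alpha> dE(1) open_U x0 \<alpha>_E])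
    ultimately show ?thesis unfolding l inner_scaleR_left by algebra
  qed
  \<comment> \<open>Orthogonality of \<open>gradient G\<close> to \<open>E'\<close> is known only on
    the fibre of \<open>R'\<close> through \<open>x0\<close>. It can therefore be differentiated
    only along a curve inside that fibre, here in the direction \<open>E'\<close>.\<close>
  have HE': "H (E' x0) (E' x0) = l * A (E' x0) (E' x0)"
  proof -
    have "smooth_on U1 R'" "surj (fderiv R' x0)" "fderiv R' x0 (E' x0) = 0"
      using smooth_on_subset[OF smooth_R' assms(2)] surj_R'[OF x0] R'_E'[OF x0] by auto
    then obtain \<sigma> \<epsilon> where \<sigma>: "\<epsilon> > 0" "\<sigma> 0 = x0" "\<sigma> ` {-\<epsilon><..<\<epsilon>} \<subseteq> U1"
      "\<And>t. t \<in> {-\<epsilon><..<\<epsilon>} \<Longrightarrow> R' (\<sigma> t) = R' x0" "(\<sigma> has_vector_derivative E' x0) (at 0)"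
      using curve_in_level_set[OF assms(1) _ assms(3)] by metis
    have c: "((\<lambda>s. F (\<sigma> s)) has_derivative (\<lambda>a. a *\<^sub>R fderiv F x0 (E' x0))) (at 0)"
      if "(F has_derivative fderiv F x0) (at x0)" for F :: "real^3 \<Rightarrow> real^3"
      using curve_chain_rule[OF \<sigma>(5)] that \<sigma>(2) by (simp add: has_vector_derivative_def)
    have 0: "0 \<in> {-\<epsilon><..<\<epsilon>}" using \<sigma>(1) by simp
    have "(1 *\<^sub>R fderiv (gradient G) x0 (E' x0)) \<bullet> E' (\<sigma> 0) + gradient G (\<sigma> 0) \<bullet> (1 *\<^sub>R fderiv E' x0 (E' x0)) = 0"
      by (rule inner_derivative_constant[OF c[OF dG[OF assms(3)]] c[OF dE(2)] open_greaterThanLessThan 0])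
        (use GE' \<sigma>(3,4) in blast)
    then have "H (E' x0) (E' x0) + gradient G x0 \<bullet> fderiv E' x0 (E' x0) = 0"
      by (simp add: H_def \<sigma>(2))
    moreover have "A (E' x0) (E' x0) + \<alpha> x0 \<bullet> fderiv E' x0 (E' x0) = 0"
      unfolding A_def by (rule inner_derivative_constant[OF d\<alpha> dE(2) open_U x0 \<alpha>_E'])
    ultimately show ?thesis unfolding l inner_scaleR_left by algebra
  qed
  have dG\<gamma>: "((\<lambda>s. G (\<gamma> s)) has_real_derivative gradient G (\<gamma> s) \<bullet> \<gamma>1 s) (at s)" if "s \<in> I" for s
    using curve_chain_rule[OF d\<gamma>[OF that] smooth_on_has_fderiv[OF assms(4) assms(12)[OF that]]]
      fderiv_eq_gradient[OF assms(4) assms(12)[OF that]]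
    by (simp add: has_real_derivative_iff_has_vector_derivative)
  have \<alpha>v: "\<alpha> x0 \<bullet> v = 0" using leg[OF assms(9)] assms(11) by (simp add: v_def)
  show "deriv (\<lambda>s. G (\<gamma> s)) t = 0"
    using DERIV_imp_deriv[OF dG\<gamma>[OF assms(9)]] \<alpha>v by (simp add: v assms(11) l)
  have c: "((\<lambda>s. F (\<gamma> s)) has_derivative (\<lambda>a. a *\<^sub>R fderiv F x0 v)) (at t)"
    if "(F has_derivative fderiv F x0) (at x0)" for F :: "real^3 \<Rightarrow> real^3"
    using curve_chain_rule[OF d\<gamma>[OF assms(9)]] that assms(11) by (simp add: has_vector_derivative_def v)
  \<comment> \<open>Differentiating the Legendre condition expresses the pairing of
    \<open>\<alpha>\<close> with the acceleration by \<open>A v v\<close>.\<close>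
  have "(1 *\<^sub>R fderiv \<alpha> x0 v) \<bullet> \<gamma>1 t + \<alpha> (\<gamma> t) \<bullet> fderiv \<gamma>1 t 1 = 0"
    by (rule inner_derivative_constant[OF c[OF d\<alpha>] d\<gamma>1 assms(8,9)]) (simp add: leg \<gamma>1_def)
  then have A\<gamma>: "A v v + \<alpha> x0 \<bullet> fderiv \<gamma>1 t 1 = 0" by (simp add: A_def v assms(11))
  have "((\<lambda>s. gradient G (\<gamma> s) \<bullet> \<gamma>1 s) has_derivative
      (\<lambda>a. gradient G (\<gamma> t) \<bullet> fderiv \<gamma>1 t a + (a *\<^sub>R fderiv (gradient G) x0 v) \<bullet> \<gamma>1 t)) (at t)"
    by (rule has_derivative_inner[OF c[OF dG[OF assms(3)]] d\<gamma>1])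
  moreover have "gradient G (\<gamma> t) \<bullet> fderiv \<gamma>1 t a + (a *\<^sub>R fderiv (gradient G) x0 v) \<bullet> \<gamma>1 t
      = a * (H v v + gradient G x0 \<bullet> fderiv \<gamma>1 t 1)" for a
  proof -
    have "fderiv \<gamma>1 t a = a *\<^sub>R fderiv \<gamma>1 t 1"
      using linear_cmul[OF has_derivative_linear[OF d\<gamma>1], of a 1] by simp
    then show ?thesis by (simp add: H_def v assms(11) distrib_left)
  qed
  ultimately have "((\<lambda>s. gradient G (\<gamma> s) \<bullet> \<gamma>1 s) has_real_derivative
      H v v + gradient G x0 \<bullet> fderiv \<gamma>1 t 1) (at t)"
    by (simp add: has_field_derivative_def mult_commute_abs)
  then have "(deriv (\<lambda>s. G (\<gamma> s)) has_real_derivative H v v + gradient G x0 \<bullet> fderiv \<gamma>1 t 1) (at t)"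
    by (rule has_field_derivative_transform_within_open[OF _ assms(8,9)])
      (simp add: DERIV_imp_deriv[OF dG\<gamma>])
  then have "deriv (deriv (\<lambda>s. G (\<gamma> s))) t = H v v + gradient G x0 \<bullet> fderiv \<gamma>1 t 1"
    by (rule DERIV_imp_deriv)
  also have "\<dots> = H v v - l * A v v"
    using A\<gamma> unfolding l inner_scaleR_left by algebra
  finally have D2: "deriv (deriv (\<lambda>s. G (\<gamma> s))) t = H v v - l * A v v" .
  obtain a b where ab: "v = a *\<^sub>R E x0 + b *\<^sub>R E' x0"
    using contact_plane_span[OF x0 \<alpha>v] .
  \<comment> \<open>The pure terms cancel by \<open>HE\<close> and \<open>HE'\<close>. For the mixed
    ones, symmetry replaces \<open>H (E x0) (E' x0)\<close> by \<open>H (E' x0) (E x0)\<close>,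
    which \<open>HE\<close> evaluates; \<open>A\<close> is not symmetric, and its two mixed values
    differ by the exterior derivative.\<close>
  have "H v v - l * A v v = - (a * b * l * ext_deriv \<alpha> x0 (E x0) (E' x0))"
    unfolding ab H_lin A_lin HE HE' H_sym[of "E x0" "E' x0"] ext_deriv_def
    by (simp add: A_def algebra_simps)
  moreover have "b \<noteq> 0"
    using imm R_E[OF x0] unfolding v_def[symmetric] ab
    by (auto simp: linear_add[OF linear_R[OF x0]] linear_cmul[OF linear_R[OF x0]])
  moreover have "fderiv R' x0 v = 0 \<longleftrightarrow> a = 0"
    using R'_E_nonzero[OF x0] R'_E'[OF x0] unfolding ab
    by (simp add: linear_add[OF linear_R'[OF x0]] linear_cmul[OF linear_R'[OF x0]])
  ultimately show "deriv (deriv (\<lambda>s. G (\<gamma> s))) t = 0 \<longleftrightarrow> fderiv R' x0 (fderiv \<gamma> t 1) = 0"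
    using D2 l0 ext_deriv_E_E'_nonzero[OF x0] by (simp add: v_def)
qed

text \<open>The function \<open>g \<circ> R\<close> vanishes along a curve in the fibre of
  \<open>R'\<close> with velocity \<open>E' x\<close>. The result serves at every point of the fibre
  in the second order computation, and at one point to find the tangent direction of a line.\<close>

lemma fibre_image_equation_tangent:
  assumes x: "x \<in> U" and W: "open W" "R x \<in> W" "smooth_on W g"
    and N: "open N" "x \<in> N" "\<And>y. y \<in> N \<Longrightarrow> y \<in> U \<Longrightarrow> R' y = R' x \<Longrightarrow> g (R y) = (0::real)"
  shows "fderiv g (R x) (fderiv R x (E' x)) = 0"
proof -
  have o: "open (U \<inter> N)" "U \<inter> N \<subseteq> U" "x \<in> U \<inter> N" using open_U N x by auto
  obtain \<sigma> \<epsilon> where \<sigma>: "\<epsilon> > 0" "\<sigma> 0 = x" "\<sigma> ` {-\<epsilon><..<\<epsilon>} \<subseteq> U \<inter> N"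
    "\<And>t. t \<in> {-\<epsilon><..<\<epsilon>} \<Longrightarrow> R' (\<sigma> t) = R' x" "(\<sigma> has_vector_derivative E' x) (at 0)"
    using curve_in_level_set[OF o(1) smooth_on_subset[OF smooth_R' o(2)] o(3) surj_R'[OF x] R'_E'[OF x]]
    by metis
  have 0: "0 \<in> {-\<epsilon><..<\<epsilon>}" using \<sigma>(1) by simp
  have "((\<lambda>s. R (\<sigma> s)) has_vector_derivative fderiv R x (E' x)) (at 0)"
    using curve_chain_rule[OF \<sigma>(5)] smooth_on_has_fderiv[OF smooth_R x] \<sigma>(2) by simp
  then have "((\<lambda>s. g (R (\<sigma> s))) has_vector_derivative fderiv g (R x) (fderiv R x (E' x))) (at 0)"
    by (rule curve_chain_rule) (use smooth_on_has_fderiv[OF W(3,2)] \<sigma>(2) in simp)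
  moreover have "((\<lambda>s. g (R (\<sigma> s))) has_vector_derivative 0) (at 0)"
  proof (rule has_vector_derivative_transform_within_open[OF has_vector_derivative_const open_greaterThanLessThan 0])
    show "0 = g (R (\<sigma> s))" if "s \<in> {-\<epsilon><..<\<epsilon>}" for s
    proof -
      have "\<sigma> s \<in> U \<inter> N" using \<sigma>(3) that by blast
      then show ?thesis using N(3)[of "\<sigma> s"] \<sigma>(4)[OF that] by simp
    qed
  qed
  ultimately show ?thesis by (rule vector_derivative_unique_at)
qed

text \<open>Applies the second derivative formula to \<open>G = g \<circ> R\<close>: its gradient is
  orthogonal to \<open>E\<close> because \<open>E\<close> is in the kernel of the derivative of
  \<open>R\<close>, and to \<open>E'\<close> on the fibre because \<open>g\<close> vanishes on the
  image of the fibre. As \<open>g\<close> is arbitrary, the order of contact is independent of the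
  chosen equation in the range considered.\<close>

lemma front_contact_iff:
  assumes x0: "x0 \<in> U" and W: "open W" "R x0 \<in> W" "smooth_on W g" and g0: "fderiv g (R x0) w \<noteq> 0"
    and N: "open N" "x0 \<in> N" "\<And>x. x \<in> N \<Longrightarrow> x \<in> U \<Longrightarrow> R' x = R' x0 \<Longrightarrow> g (R x) = (0::real)"
    and I: "open I" "t \<in> I" "smooth_on I \<gamma>" "\<gamma> t = x0" "\<And>s. s \<in> I \<Longrightarrow> \<gamma> s \<in> U"
    and leg: "\<And>s. s \<in> I \<Longrightarrow> \<alpha> (\<gamma> s) \<bullet> fderiv \<gamma> s 1 = 0"
    and imm: "fderiv R x0 (fderiv \<gamma> t 1) \<noteq> 0"
  shows "deriv (\<lambda>s. g (R (\<gamma> s))) t = 0"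
    and "deriv (deriv (\<lambda>s. g (R (\<gamma> s)))) t = 0 \<longleftrightarrow> fderiv R' x0 (fderiv \<gamma> t 1) = 0"
proof -
  define U1 where "U1 = U \<inter> R -` W \<inter> N"
  define I1 where "I1 = I \<inter> \<gamma> -` U1"
  have oU1: "open U1" unfolding U1_def
    using continuous_open_preimage[OF smooth_on_continuous_on[OF smooth_R] open_U W(1)] N(1) by auto
  have oI1: "open I1" unfolding I1_def
    by (rule continuous_open_preimage[OF smooth_on_continuous_on[OF I(3)] I(1) oU1])
  have U1: "U1 \<subseteq> U" "x0 \<in> U1" using x0 W N by (auto simp: U1_def)
  have I1: "I1 \<subseteq> I" "t \<in> I1" using I U1 by (auto simp: I1_def)
  define G where "G x = g (R x)" for x
  have smG: "smooth_on U1 G" unfolding G_def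
    by (rule smooth_on_compose[OF oU1 W(1) _ smooth_on_subset[OF smooth_R U1(1)] W(3)]) (auto simp: U1_def)
  have fG: "gradient G x \<bullet> u = fderiv g (R x) (fderiv R x u)" if "x \<in> U1" for x u
  proof -
    have "R x \<in> W" "x \<in> U" using that by (auto simp: U1_def)
    then have "(G has_derivative (\<lambda>u. fderiv g (R x) (fderiv R x u))) (at x)"
      unfolding G_def
      using has_derivative_compose smooth_on_has_fderiv[OF smooth_R] smooth_on_has_fderiv[OF W(3)] by blast
    then show ?thesis using fderiv_eq_gradient[OF smG that, of u] by (simp add: fderiv_eq)
  qed
  have ling: "linear (fderiv g (R x))" if "x \<in> U1" for x
    using smooth_on_linear_fderiv[OF W(3)] that by (auto simp: U1_def)
  have 1: "gradient G x \<bullet> E x = 0" if "x \<in> U1" for x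
    using R_E[of x] U1 that by (auto simp: fG linear_0[OF ling])
  have 2: "gradient G x \<bullet> E' x = 0" if x: "x \<in> U1" "R' x = R' x0" for x
    unfolding fG[OF x(1)]
    by (rule fibre_image_equation_tangent[OF _ W(1) _ W(3) N(1)]) (use x N(3) in \<open>auto simp: U1_def\<close>)
  have 3: "gradient G x0 \<noteq> 0"
  proof
    assume *: "gradient G x0 = 0"
    obtain u where "fderiv R x0 u = w" using surj_R[OF x0] by (metis surjD)
    then show False using fG[OF U1(2), of u] g0 * by simp
  qed
  have I1': "smooth_on I1 \<gamma>" "\<And>s. s \<in> I1 \<Longrightarrow> \<gamma> s \<in> U1"
    using smooth_on_subset[OF I(3) I1(1)] by (auto simp: I1_def)
  have leg1: "\<alpha> (\<gamma> s) \<bullet> fderiv \<gamma> s 1 = 0" if "s \<in> I1" for s using leg I1 that by blast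
  note second_derivative_along_legendre_curve[OF oU1 U1 smG 1 2 3 oI1 I1(2) I1'(1) I(4) I1'(2) leg1 imm]
  then show "deriv (\<lambda>s. g (R (\<gamma> s))) t = 0"
    "deriv (deriv (\<lambda>s. g (R (\<gamma> s)))) t = 0 \<longleftrightarrow> fderiv R' x0 (fderiv \<gamma> t 1) = 0"
    unfolding G_def by blast+
qed

text \<open>The coordinates \<open>(R'\<^sub>1, R'\<^sub>2, d \<bullet> R)\<close> with \<open>d = DR(E')\<close> turn the fibre of \<open>R'\<close> into a coordinate axis, so
  that its image under \<open>R\<close> is a graph over the direction \<open>d\<close>.\<close>

lemma fibre_image_local_equation:
  assumes x0: "x0 \<in> U"
  obtains W N g w where "open W" "R x0 \<in> W" "open N" "x0 \<in> N" "N \<subseteq> U" "smooth_on W g"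
    "fderiv g (R x0) w \<noteq> (0::real)" "\<And>x. x \<in> N \<Longrightarrow> R' x = R' x0 \<Longrightarrow> g (R x) = 0"
proof -
  define d where "d = fderiv R x0 (E' x0)"
  have d0: "d \<noteq> 0" using R_E'_nonzero[OF x0] by (simp add: d_def)
  define coords :: "3 \<Rightarrow> real^2 \<Rightarrow> real^2 \<Rightarrow> real" where
    "coords i y' y = (if i = 1 then y' $ 1 else if i = 2 then y' $ 2 else d \<bullet> y)" for i y' y
  define \<Phi> :: "real^3 \<Rightarrow> real^3" where "\<Phi> x = (\<chi> i. coords i (R' x) (R x))" for x
  have sm: "smooth_on U \<Phi>"
    unfolding \<Phi>_def[abs_def]
  proof (rule smooth_on_vec_lambda[OF open_U])
    show "smooth_on U (\<lambda>x. coords i (R' x) (R x))" for i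
      unfolding coords_def
      by (cases "i = 1"; cases "i = 2")
        (simp_all add: smooth_on_vec_nth smooth_on_inner smooth_on_const smooth_R smooth_R' open_U)
  qed
  have comp: "((\<lambda>x. \<Phi> x $ i) has_derivative (\<lambda>v. fderiv \<Phi> x0 v $ i)) (at x0)" for i
    by (rule bounded_linear.has_derivative[OF bounded_linear_vec_nth smooth_on_has_fderiv[OF sm x0]])
  have comp': "((\<lambda>x. \<Phi> x $ i) has_derivative (\<lambda>v. coords i (fderiv R' x0 v) (fderiv R x0 v))) (at x0)" for i
    unfolding \<Phi>_def coords_def
    using bounded_linear.has_derivative[OF bounded_linear_vec_nth smooth_on_has_fderiv[OF smooth_R' x0]]
      has_derivative_inner_right[OF smooth_on_has_fderiv[OF smooth_R x0], of d]
    by (cases "i = 1"; cases "i = 2") simp_all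
  have fd: "fderiv \<Phi> x0 v $ i = coords i (fderiv R' x0 v) (fderiv R x0 v)" for v i
    using has_derivative_unique[OF comp comp'] by metis
  have "inj (fderiv \<Phi> x0)"
    unfolding linear_injective_0[OF smooth_on_linear_fderiv[OF sm x0]]
  proof (intro allI impI)
    fix v assume v: "fderiv \<Phi> x0 v = 0"
    then have z: "coords i (fderiv R' x0 v) (fderiv R x0 v) = 0" for i using fd[of v i] by simp
    \<comment> \<open>The first two coordinates force \<open>v\<close> to be a multiple
      \<open>k\<close> of \<open>E' x0\<close>; the third then equals
      \<open>k (d \<bullet> d)\<close>.\<close>
    have "fderiv R' x0 v = 0" using z[of 1] z[of 2] by (simp add: coords_def vec_eq_iff forall_2)
    then obtain k where k: "v = k *\<^sub>R E' x0"
      using fderiv_eq_0_imp_multiple[OF smooth_R' x0 surj_R'[OF x0]] by blast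
    have "d \<bullet> fderiv R x0 v = 0" using z[of 3] by (simp add: coords_def)
    then show "v = 0" using d0 by (simp add: k linear_cmul[OF linear_R[OF x0]] flip: d_def)
  qed
  from smooth_inverse_function_theorem[OF open_U sm x0 this]
  obtain N V \<Psi> where inv: "open N" "N \<subseteq> U" "x0 \<in> N" "open V" "\<Phi> x0 \<in> V" "homeomorphism N V \<Phi> \<Psi>"
    "smooth_on V \<Psi>" by metis
  \<comment> \<open>For \<open>y\<close> in \<open>W\<close> below,
    \<open>\<Psi> (\<beta> y)\<close> lies on the level set of \<open>R'\<close> through
    \<open>x0\<close> and its image under \<open>R\<close> has the same inner product with
    \<open>d\<close> as \<open>y\<close>. The equation \<open>g\<close> compares \<open>y\<close>
    with this image in the direction \<open>p\<close> orthogonal to \<open>d\<close>.\<close>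
  define \<beta> :: "real^2 \<Rightarrow> real^3" where "\<beta> y = (\<chi> i. coords i (R' x0) y)" for y
  have sm\<beta>: "smooth_on UNIV \<beta>"
    unfolding \<beta>_def[abs_def]
  proof (rule smooth_on_vec_lambda[OF open_UNIV])
    show "smooth_on UNIV (coords i (R' x0))" for i
      unfolding coords_def[abs_def]
      by (cases "i = 1"; cases "i = 2") (simp_all add: smooth_on_inner smooth_on_const smooth_on_id)
  qed
  define p :: "real^2" where "p = (\<chi> i. if i = 1 then - d $ 2 else d $ 1)"
  have p: "d \<bullet> p = 0" "p \<noteq> 0"
    using d0 by (auto simp: p_def inner_vec_def sum_2 vec_eq_iff forall_2)
  define W where "W = \<beta> -` V"
  have oW: "open W" unfolding W_def
    by (rule open_vimage[OF inv(4) smooth_on_continuous_on[OF sm\<beta>]])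
  have \<beta>R: "\<Phi> x = \<beta> (R x)" if "R' x = R' x0" for x using that by (simp add: \<Phi>_def \<beta>_def)
  have RW: "R x0 \<in> W" using inv(5) \<beta>R[of x0] by (simp add: W_def)
  define g where "g y = p \<bullet> (y - R (\<Psi> (\<beta> y)))" for y
  have \<Psi>: "\<Psi> ` V \<subseteq> U" using inv(2,6) by (auto simp: homeomorphism_def)
  have sm\<Psi>: "smooth_on W (\<lambda>y. \<Psi> (\<beta> y))"
    by (rule smooth_on_compose[OF oW inv(4) _ smooth_on_subset[OF sm\<beta>] inv(7)]) (auto simp: W_def)
  have "smooth_on W (\<lambda>y. R (\<Psi> (\<beta> y)))"
    by (rule smooth_on_compose[OF oW open_U _ sm\<Psi> smooth_R]) (use \<Psi> in \<open>auto simp: W_def\<close>)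
  then have smg: "smooth_on W g"
    unfolding g_def
    by (rule smooth_on_inner[OF oW smooth_on_const[OF oW] smooth_on_diff[OF oW smooth_on_id[OF oW]]])
  have g0: "g (R x) = 0" if "x \<in> N" "R' x = R' x0" for x
    using inv(6) that by (simp add: g_def homeomorphism_def flip: \<beta>R[OF that(2)])
  \<comment> \<open>Moving \<open>y\<close> along \<open>p\<close> leaves \<open>\<beta> y\<close>
    fixed, so \<open>g\<close> is affine on that line with slope \<open>p \<bullet> p\<close>. This
    determines the needed derivative without differentiating \<open>\<Psi>\<close>.\<close>
  have "((\<lambda>s. g (R x0 + s *\<^sub>R p)) has_vector_derivative fderiv g (R x0) p) (at 0)"
    using smooth_on_along_line[OF smg, of "R x0" 0 p] RW by simp
  moreover have "g (R x0 + s *\<^sub>R p) = s * (p \<bullet> p)" for s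
  proof -
    have "\<beta> (R x0 + s *\<^sub>R p) = \<beta> (R x0)" using p(1) by (simp add: \<beta>_def coords_def inner_add_right cong: if_cong)
    then have "g (R x0 + s *\<^sub>R p) = g (R x0) + s * (p \<bullet> p)" by (simp add: g_def algebra_simps)
    then show ?thesis using g0[OF inv(3) refl] by simp
  qed
  ultimately have "((\<lambda>s. s * (p \<bullet> p)) has_vector_derivative fderiv g (R x0) p) (at 0)" by simp
  moreover have "((\<lambda>s. s * (p \<bullet> p)) has_vector_derivative (p \<bullet> p)) (at 0)"
    by (auto intro!: derivative_eq_intros simp flip: has_real_derivative_iff_has_vector_derivative)
  ultimately have "fderiv g (R x0) p = p \<bullet> p" by (rule vector_derivative_unique_at)
  then have "fderiv g (R x0) p \<noteq> 0" using p(2) by simp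
  then show thesis using that[OF oW RW inv(1,3,2) smg _ g0] by blast
qed

section \<open>Tangent planes, contact planes and characteristic directions\<close>

text \<open>A plane is mapped onto the target exactly when it does not contain the kernel line,
  which is spanned by \<open>E'\<close>.\<close>

lemma image_plane_R':
  assumes x: "x \<in> U" and \<nu>: "\<nu> \<noteq> 0"
  shows "fderiv R' x ` {v. \<nu> \<bullet> v = 0} = UNIV \<longleftrightarrow> \<nu> \<bullet> E' x \<noteq> 0"
proof
  assume surj: "fderiv R' x ` {v. \<nu> \<bullet> v = 0} = UNIV"
  show "\<nu> \<bullet> E' x \<noteq> 0"
  proof
    let ?r = "\<lambda>i. matrix (fderiv R' x) $ i"
    assume "\<nu> \<bullet> E' x = 0"
    then obtain s t where st: "\<nu> = s *\<^sub>R ?r 1 + t *\<^sub>R ?r 2"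
      using orthogonal_cross_imp_span[of "?r 1" "?r 2" \<nu>] E'_nonzero[OF x]
      unfolding kernel_field_def by (metis inner_commute)
    \<comment> \<open>If \<open>\<nu>\<close> is the combination of the rows with coefficients
      \<open>s\<close> and \<open>t\<close>, every image vector of the plane is orthogonal to
      \<open>(s, t)\<close>; so the vector \<open>(s, t)\<close> itself is not attained.\<close>
    define y :: "real^2" where "y = (\<chi> i. if i = 1 then s else t)"
    have "y \<in> fderiv R' x ` {v. \<nu> \<bullet> v = 0}" using surj by simp
    then obtain v where v: "\<nu> \<bullet> v = 0" "y = fderiv R' x v" by blast
    have "?r 1 \<bullet> v = y $ 1" "?r 2 \<bullet> v = y $ 2"
      unfolding v(2) by (simp_all add: fderiv_nth_eq_row[OF smooth_R' x])
    then have "?r 1 \<bullet> v = s" "?r 2 \<bullet> v = t" by (simp_all add: y_def)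
    then have "s * s + t * t = 0" using v(1) by (simp add: st inner_add_left)
    then show False using \<nu> st by (simp add: sum_squares_eq_zero_iff)
  qed
next
  assume ne: "\<nu> \<bullet> E' x \<noteq> 0"
  have "y \<in> fderiv R' x ` {v. \<nu> \<bullet> v = 0}" for y
  proof -
    obtain v where v: "fderiv R' x v = y" using surj_R'[OF x] by (metis surjD)
    let ?u = "v - ((\<nu> \<bullet> v) / (\<nu> \<bullet> E' x)) *\<^sub>R E' x"
    have "\<nu> \<bullet> ?u = 0" using ne by (simp add: inner_diff_right)
    moreover have "fderiv R' x ?u = y"
      using v R'_E'[OF x] by (simp add: linear_diff[OF linear_R'[OF x]] linear_cmul[OF linear_R'[OF x]])
    ultimately show ?thesis by blast
  qed
  then show "fderiv R' x ` {v. \<nu> \<bullet> v = 0} = UNIV" by blast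
qed

text \<open>\<open>E'\<close> always lies in the contact plane. If it also lies in the plane with
  normal \<open>\<nu>\<close>, it spans the intersection line of the two planes and is parallel to
  \<open>v\<close>.\<close>

lemma characteristic_direction_in_kernel_iff:
  assumes x: "x \<in> U" and c: "cross3 \<nu> (\<alpha> x) \<noteq> 0" and v: "v \<noteq> 0" "\<nu> \<bullet> v = 0" "\<alpha> x \<bullet> v = 0"
  shows "fderiv R' x v = 0 \<longleftrightarrow> \<nu> \<bullet> E' x = 0"
proof
  obtain k where k: "v = k *\<^sub>R cross3 \<nu> (\<alpha> x)"
    using orthogonal_both_imp_multiple_cross[OF c] v by (metis inner_commute)
  {
    assume "fderiv R' x v = 0"
    then obtain j where "v = j *\<^sub>R E' x"
      using fderiv_eq_0_imp_multiple[OF smooth_R' x surj_R'[OF x]] by blast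
    then show "\<nu> \<bullet> E' x = 0" using v by auto
  next
    assume "\<nu> \<bullet> E' x = 0"
    then obtain m where m: "E' x = m *\<^sub>R cross3 \<nu> (\<alpha> x)"
      using orthogonal_both_imp_multiple_cross[OF c] \<alpha>_E'[OF x] by (metis inner_commute)
    have "m \<noteq> 0" using m E'_nonzero[OF x] by auto
    then have "v = (k / m) *\<^sub>R E' x" unfolding m k by simp
    then show "fderiv R' x v = 0" using R'_E'[OF x] by (simp add: linear_cmul[OF linear_R'[OF x]])
  }
qed

text \<open>The contact plane contains \<open>E\<close>, which \<open>R\<close> annihilates to first
  order, so its image is the line spanned by the image of \<open>v\<close>; the kernel of the
  nonzero form \<open>\<omega>\<close> is a line through the same vector.\<close>

lemma image_contact_plane_R:
  assumes x: "x \<in> U" and "linear \<omega>" "\<omega> w0 \<noteq> (0::real)"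
    and v: "\<alpha> x \<bullet> v = 0" "fderiv R x v \<noteq> 0" "\<omega> (fderiv R x v) = 0"
  shows "fderiv R x ` {u. \<alpha> x \<bullet> u = 0} = {w. \<omega> w = 0}"
proof (intro equalityI subsetI)
  note lin = linear_add[OF linear_R[OF x]] linear_cmul[OF linear_R[OF x]]
  obtain a b where ab: "v = a *\<^sub>R E x + b *\<^sub>R E' x" using contact_plane_span[OF x v(1)] .
  have b: "b \<noteq> 0" using v(2) R_E[OF x] by (auto simp: ab lin)
  fix w assume "w \<in> fderiv R x ` {u. \<alpha> x \<bullet> u = 0}"
  then obtain u where u: "\<alpha> x \<bullet> u = 0" "w = fderiv R x u" by blast
  obtain a' b' where ab': "u = a' *\<^sub>R E x + b' *\<^sub>R E' x" using contact_plane_span[OF x u(1)] .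
  have "w = (b' / b) *\<^sub>R fderiv R x v" using b R_E[OF x] by (simp add: u(2) ab ab' lin)
  then show "w \<in> {w. \<omega> w = 0}" using v(3) linear_cmul[OF assms(2)] by simp
next
  fix w assume w: "w \<in> {w. \<omega> w = 0}"
  let ?o = "\<chi> i. \<omega> (axis i 1)"
  have o: "\<omega> y = ?o \<bullet> y" for y by (rule linear_functional_eq_inner[OF assms(2)])
  have o0: "?o \<noteq> 0" using assms(3) o[of w0] by (metis inner_zero_left)
  have "?o \<bullet> fderiv R x v = 0" "?o \<bullet> w = 0" using o[of "fderiv R x v"] o[of w] v(3) w by simp_all
  then obtain k where "w = k *\<^sub>R fderiv R x v"
    using orthogonal_same_imp_multiple[OF o0 v(2)] by blast
  then have "w = fderiv R x (k *\<^sub>R v)" by (simp add: linear_cmul[OF linear_R[OF x]])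
  then show "w \<in> fderiv R x ` {u. \<alpha> x \<bullet> u = 0}" using v(1) by auto
qed

text \<open>The cross product of the two normals is tangent to the level surface of \<open>f\<close>
  and to the contact plane. Being defined on an open set, and not only on the surface, it can be
  integrated by \<open>integral_curve_exists\<close>; \<open>f\<close> is constant on the integral
  curves because the field is orthogonal to its gradient.\<close>

lemma characteristic_curve_exists:
  assumes x0: "x0 \<in> U" and f: "smooth_on U f" and c: "cross3 (gradient f x0) (\<alpha> x0) \<noteq> 0"
  obtains \<gamma> :: "real \<Rightarrow> real^3" and \<epsilon> where "\<epsilon> > 0" "smooth_on {-\<epsilon><..<\<epsilon>} \<gamma>" "\<gamma> 0 = x0"
    "\<And>t. t \<in> {-\<epsilon><..<\<epsilon>} \<Longrightarrow> \<gamma> t \<in> U"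
    "\<And>t. t \<in> {-\<epsilon><..<\<epsilon>} \<Longrightarrow> f (\<gamma> t) = f x0"
    "\<And>t. t \<in> {-\<epsilon><..<\<epsilon>} \<Longrightarrow> cross3 (gradient f (\<gamma> t)) (\<alpha> (\<gamma> t)) \<noteq> 0"
    "\<And>t. t \<in> {-\<epsilon><..<\<epsilon>} \<Longrightarrow> fderiv \<gamma> t 1 = cross3 (gradient f (\<gamma> t)) (\<alpha> (\<gamma> t))"
proof -
  define X where "X x = cross3 (gradient f x) (\<alpha> x)" for x
  have "bounded_bilinear cross3"
    using bilinear_cross bilinear_conv_bounded_bilinear by blast
  from smooth_on_bilinear[OF this open_U smooth_on_gradient[OF open_U f] smooth_\<alpha>]
  have smX: "smooth_on U X" unfolding X_def[abs_def] .
  define U1 where "U1 = U \<inter> X -` (- {0})"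
  have oU1: "open U1" unfolding U1_def
    by (rule continuous_open_preimage[OF smooth_on_continuous_on[OF smX] open_U]) auto
  have "x0 \<in> U1" "U1 \<subseteq> U" using x0 c by (auto simp: U1_def X_def)
  then obtain \<gamma> \<epsilon> where g: "\<epsilon> > 0" "smooth_on {-\<epsilon><..<\<epsilon>} \<gamma>" "\<gamma> 0 = x0"
    "\<And>t. t \<in> {-\<epsilon><..<\<epsilon>} \<Longrightarrow> \<gamma> t \<in> U1"
    "\<And>t. t \<in> {-\<epsilon><..<\<epsilon>} \<Longrightarrow> (\<gamma> has_vector_derivative X (\<gamma> t)) (at t)"
    using integral_curve_exists[OF oU1 smooth_on_subset[OF smX]] by metis
  have gU: "\<gamma> t \<in> U" "X (\<gamma> t) \<noteq> 0" if "t \<in> {-\<epsilon><..<\<epsilon>}" for t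
    using g(4)[OF that] by (auto simp: U1_def)
  have fX: "fderiv f x (X x) = 0" if "x \<in> U" for x
    by (simp add: fderiv_eq_gradient[OF f that] X_def dot_cross_self)
  have const: "f (\<gamma> t) = f x0" if t: "t \<in> {-\<epsilon><..<\<epsilon>}" for t
  proof -
    have d0: "((\<lambda>s. f (\<gamma> s)) has_vector_derivative 0) (at s within {-\<epsilon><..<\<epsilon>})" if "s \<in> {-\<epsilon><..<\<epsilon>}" for s
      using curve_chain_rule[OF g(5)[OF that] smooth_on_has_fderiv[OF f gU(1)[OF that]]] fX[OF gU(1)[OF that]]
      by (simp add: has_vector_derivative_at_within)
    have "\<exists>c. \<forall>s\<in>{-\<epsilon><..<\<epsilon>}. f (\<gamma> s) = c"
      using has_derivative_zero_constant[of "{-\<epsilon><..<\<epsilon>}" "\<lambda>s. f (\<gamma> s)"] d0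
      by (auto simp: has_vector_derivative_def)
    then have "f (\<gamma> t) = f (\<gamma> 0)" using t g(1) by (metis greaterThanLessThan_iff neg_less_0_iff_less)
    then show ?thesis using g(3) by simp
  qed
  have "fderiv \<gamma> t 1 = X (\<gamma> t)" if "t \<in> {-\<epsilon><..<\<epsilon>}" for t
    using vector_derivative_unique_at[OF smooth_curve_has_vector_derivative[OF g(2) that] g(5)[OF that]] .
  then show thesis
    using g(1-3) gU const by (intro that[of \<epsilon> \<gamma>]) (simp_all add: X_def)
qed

end

section \<open>Charts and smooth maps\<close>

lemma chart_facts:
  assumes "smooth_manifold A" "c \<in> A"
  shows open_chart_domain: "open (fst c)"
    and chart_inv_chart: "p \<in> fst c \<Longrightarrow> chart_inv c (snd c p) = p"
    and chart_chart_inv: "x \<in> snd c ` fst c \<Longrightarrow> snd c (chart_inv c x) = x"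
    and chart_inv_in: "x \<in> snd c ` fst c \<Longrightarrow> chart_inv c x \<in> fst c"
    and continuous_on_chart: "continuous_on (fst c) (snd c)"
    and continuous_on_chart_inv: "continuous_on (snd c ` fst c) (chart_inv c)"
proof -
  have h: "open (fst c)" "homeomorphism (fst c) (snd c ` fst c) (snd c) (chart_inv c)"
    using assms by (auto simp: smooth_manifold_def)
  show "open (fst c)" "continuous_on (fst c) (snd c)" "continuous_on (snd c ` fst c) (chart_inv c)"
    using h by (auto simp: homeomorphism_def)
  show "p \<in> fst c \<Longrightarrow> chart_inv c (snd c p) = p"
    using h(2) by (simp add: homeomorphism_def)
  show "x \<in> snd c ` fst c \<Longrightarrow> snd c (chart_inv c x) = x" "x \<in> snd c ` fst c \<Longrightarrow> chart_inv c x \<in> fst c"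
    using h(2) unfolding homeomorphism_def by blast+
qed

lemma chart_at:
  assumes "smooth_manifold A"
  obtains c where "c \<in> A" "p \<in> fst c"
  using assms unfolding smooth_manifold_def by blast

lemma open_chart_image:
  assumes "smooth_manifold A" "c \<in> A" "open N" "N \<subseteq> fst c"
  shows "open (snd c ` N)"
proof -
  have "open (snd c ` fst c)" using assms by (auto simp: smooth_manifold_def)
  then have "open (snd c ` fst c \<inter> chart_inv c -` N)"
    using continuous_open_preimage[OF continuous_on_chart_inv[OF assms(1,2)]] assms(3) by blast
  moreover have "snd c ` fst c \<inter> chart_inv c -` N = snd c ` N"
    using assms(4) chart_inv_chart[OF assms(1,2)] by (force simp: subset_iff)
  ultimately show ?thesis by simp
qed

lemma smooth_on_transition:
  assumes "smooth_manifold A" "c \<in> A" "d \<in> A"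
  shows "smooth_on (snd c ` (fst c \<inter> fst d)) (\<lambda>x. snd d (chart_inv c x))"
  using assms unfolding smooth_manifold_def comp_def by blast

lemma fst_std_chart [simp]: "fst (UNIV, id) = UNIV" and snd_std_chart [simp]: "snd (UNIV, id) = id"
  and chart_inv_std [simp]: "chart_inv (UNIV, id) = id"
  by (simp_all add: chart_inv_def)

lemma std_chart: "c \<in> std_atlas \<longleftrightarrow> c = (UNIV, id)"
  by (simp add: std_atlas_def)

lemma smooth_manifold_std_atlas: "smooth_manifold (std_atlas :: ('e::euclidean_space, 'e) atlas)"
  using smooth_on_id[OF open_UNIV, where 'a='e]
  by (auto simp: smooth_manifold_def std_atlas_def homeomorphism_def chart_inv_def id_def comp_def)

lemma smooth_mapE:
  assumes "smooth_map A B f S" "p \<in> S"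
  obtains c d N where "c \<in> A" "d \<in> B" "open N" "p \<in> N" "N \<subseteq> S \<inter> fst c" "f ` N \<subseteq> fst d"
    "smooth_on (snd c ` N) (snd d \<circ> f \<circ> chart_inv c)"
  using bspec[OF assms(1)[unfolded smooth_map_def] assms(2)] that by (elim bexE exE conjE) blast

lemma smooth_map_continuous_on:
  assumes A: "smooth_manifold A" and B: "smooth_manifold B" and f: "smooth_map A B f S"
  shows "continuous_on S f"
proof -
  have "\<exists>N. open N \<and> p \<in> N \<and> continuous_on N f" if "p \<in> S" for p
  proof -
    obtain c d N where *: "c \<in> A" "d \<in> B" "open N" "p \<in> N" "N \<subseteq> S \<inter> fst c" "f ` N \<subseteq> fst d"
      "smooth_on (snd c ` N) (snd d \<circ> f \<circ> chart_inv c)"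
      using smooth_mapE[OF f \<open>p \<in> S\<close>] by metis
    have cN: "continuous_on N (snd c)"
      using continuous_on_chart[OF A *(1)] *(5) continuous_on_subset by blast
    have "continuous_on N (\<lambda>q. (snd d \<circ> f \<circ> chart_inv c) (snd c q))"
      by (rule continuous_on_compose2[OF smooth_on_continuous_on[OF *(7)] cN]) auto
    moreover have e: "(snd d \<circ> f \<circ> chart_inv c) (snd c q) = snd d (f q)" if "q \<in> N" for q
      using chart_inv_chart[OF A *(1)] *(5) that by auto
    ultimately have "continuous_on N (\<lambda>q. snd d (f q))" by (simp cong: continuous_on_cong)
    then have "continuous_on N (\<lambda>q. chart_inv d (snd d (f q)))"
      by (rule continuous_on_compose2[OF continuous_on_chart_inv[OF B *(2)]]) (use *(6) in auto)
    moreover have "chart_inv d (snd d (f q)) = f q" if "q \<in> N" for q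
      using chart_inv_chart[OF B *(2)] *(6) that by blast
    ultimately have "continuous_on N f" by (simp cong: continuous_on_cong)
    then show ?thesis using *(3,4) by blast
  qed
  note nbhd = this
  let ?F = "{N. open N \<and> continuous_on N f}"
  have "continuous_on (\<Union>?F) f" by (rule continuous_on_open_Union) simp_all
  moreover have "S \<subseteq> \<Union>?F"
  proof
    fix p assume "p \<in> S"
    from nbhd[OF this] obtain N where "open N" "p \<in> N" "continuous_on N f" by auto
    then show "p \<in> \<Union>?F" by (intro UnionI[of N]) simp_all
  qed
  ultimately show ?thesis by (rule continuous_on_subset)
qed

lemma smooth_map_openD: "smooth_map A B f S \<Longrightarrow> open S"
  by (subst open_subopen) (metis le_inf_iff smooth_mapE)

text \<open>\<open>smooth_map\<close> promises one pair of charts near each point. In any other pair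
  the local expression is that one composed with transition maps on both sides, and smoothness is
  local.\<close>

lemma smooth_map_in_charts:
  assumes A: "smooth_manifold A" and B: "smooth_manifold B" and f: "smooth_map A B f S"
    and c: "c \<in> A" and d: "d \<in> B" and N: "open N" "N \<subseteq> S \<inter> fst c" "f ` N \<subseteq> fst d"
  shows "smooth_on (snd c ` N) (\<lambda>x. snd d (f (chart_inv c x)))"
proof (rule smooth_on_if_locally)
  fix x assume "x \<in> snd c ` N"
  then obtain p where p: "p \<in> N" "x = snd c p" by blast
  then obtain c0 d0 N0 where *: "c0 \<in> A" "d0 \<in> B" "open N0" "p \<in> N0" "N0 \<subseteq> S \<inter> fst c0" "f ` N0 \<subseteq> fst d0"
    "smooth_on (snd c0 ` N0) (snd d0 \<circ> f \<circ> chart_inv c0)"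
    using smooth_mapE[OF f] N(2) by (metis IntD1 subsetD)
  define P where "P = N \<inter> N0"
  have P: "open P" "p \<in> P" "P \<subseteq> fst c" "P \<subseteq> fst c0" "f ` P \<subseteq> fst d" "f ` P \<subseteq> fst d0"
    using N * p by (auto simp: P_def)
  have oP: "open (snd c ` P)" "open (snd c0 ` P)"
    using open_chart_image[OF A] c * P by auto
  have "smooth_on (snd c ` P) (\<lambda>x. snd c0 (chart_inv c x))"
    by (rule smooth_on_subset[OF smooth_on_transition[OF A c *(1)]]) (use P in auto)
  moreover have "(\<lambda>x. snd c0 (chart_inv c x)) ` snd c ` P \<subseteq> snd c0 ` P"
    using chart_inv_chart[OF A c] P(3) by force
  moreover have "smooth_on (snd c0 ` P) (\<lambda>x. snd d0 (f (chart_inv c0 x)))"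
    using smooth_on_subset[OF *(7), of "snd c0 ` P"] by (auto simp: P_def comp_def)
  ultimately have 1: "smooth_on (snd c ` P) (\<lambda>x. snd d0 (f (chart_inv c0 (snd c0 (chart_inv c x)))))"
    using smooth_on_compose[OF oP] by blast
  have oT: "open (snd d0 ` (fst d0 \<inter> fst d))"
    by (rule open_chart_image[OF B *(2)]) (auto intro!: open_Int open_chart_domain[OF B] *(2) d)
  have 2: "smooth_on (snd c ` P) (\<lambda>x. snd d (chart_inv d0 (snd d0 (f (chart_inv c0 (snd c0 (chart_inv c x)))))))"
  proof (rule smooth_on_compose[OF oP(1) oT _ 1 smooth_on_transition[OF B *(2) d]])
    show "(\<lambda>x. snd d0 (f (chart_inv c0 (snd c0 (chart_inv c x))))) ` snd c ` P \<subseteq> snd d0 ` (fst d0 \<inter> fst d)"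
      using chart_inv_chart[OF A c] chart_inv_chart[OF A *(1)] P by (force simp: subset_iff)
  qed
  have "smooth_on (snd c ` P) (\<lambda>x. snd d (f (chart_inv c x)))"
  proof (rule smooth_on_cong[OF oP(1) _ 2])
    fix y assume "y \<in> snd c ` P"
    then obtain q where q: "q \<in> P" "y = snd c q" by blast
    then have "q \<in> fst c" "q \<in> fst c0" "f q \<in> fst d0" using P by auto
    then show "snd d (chart_inv d0 (snd d0 (f (chart_inv c0 (snd c0 (chart_inv c y)))))) = snd d (f (chart_inv c y))"
      by (simp add: q(2) chart_inv_chart[OF A c] chart_inv_chart[OF A *(1)] chart_inv_chart[OF B *(2)])
  qed
  then show "\<exists>T. open T \<and> x \<in> T \<and> smooth_on T (\<lambda>x. snd d (f (chart_inv c x)))"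
    using oP(1) P(2) p(2) by blast
qed

lemma smooth_map_chart_neighbourhood:
  assumes A: "smooth_manifold A" and B: "smooth_manifold B" and f: "smooth_map A B f S"
    and c: "c \<in> A" "p \<in> fst c" and d: "d \<in> B" "f p \<in> fst d" and p: "p \<in> S"
  obtains N where "open N" "p \<in> N" "N \<subseteq> S \<inter> fst c" "f ` N \<subseteq> fst d" "open (snd c ` N)"
    "smooth_on (snd c ` N) (\<lambda>x. snd d (f (chart_inv c x)))"
proof -
  define N where "N = (S \<inter> f -` fst d) \<inter> fst c"
  have "open (S \<inter> f -` fst d)"
    by (rule continuous_open_preimage[OF smooth_map_continuous_on[OF A B f] smooth_map_openD[OF f]
          open_chart_domain[OF B d(1)]])
  then have N: "open N" "p \<in> N" "N \<subseteq> S \<inter> fst c" "f ` N \<subseteq> fst d"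
    using open_chart_domain[OF A c(1)] p c d by (auto simp: N_def)
  moreover have "open (snd c ` N)" using open_chart_image[OF A c(1)] N by auto
  ultimately show thesis using that smooth_map_in_charts[OF A B f c(1) d(1)] by blast
qed

section \<open>Tangent vectors in charts\<close>

text \<open>Supplies a tangent vector with prescribed component \<open>w\<close> in the chart
  \<open>c\<close>; together with \<open>tangent_space_eqI\<close> it identifies the tangent space
  with the model space.\<close>

definition tvec_of :: "('m, 'e::euclidean_space) atlas \<Rightarrow> ('m, 'e) chart \<Rightarrow> 'm \<Rightarrow> 'e \<Rightarrow> ('m, 'e) tvec" where
  "tvec_of A c p w = (\<lambda>d. if d \<in> A \<and> p \<in> fst d then fderiv (\<lambda>x. snd d (chart_inv c x)) (snd c p) w else 0)"

lemma transition_has_derivative: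
  assumes "smooth_manifold A" "c \<in> A" "d \<in> A" "p \<in> fst c" "p \<in> fst d"
  shows "((\<lambda>x. snd d (chart_inv c x)) has_derivative fderiv (\<lambda>x. snd d (chart_inv c x)) (snd c p)) (at (snd c p))"
  by (rule smooth_on_has_fderiv[OF smooth_on_transition[OF assms(1-3)]]) (use assms in auto)

lemma fderiv_transition_trans:
  assumes A: "smooth_manifold A" and c: "c \<in> A" "p \<in> fst c" and d: "d \<in> A" "p \<in> fst d" and e: "e \<in> A" "p \<in> fst e"
  shows "fderiv (\<lambda>x. snd e (chart_inv c x)) (snd c p) w
    = fderiv (\<lambda>x. snd e (chart_inv d x)) (snd d p) (fderiv (\<lambda>x. snd d (chart_inv c x)) (snd c p) w)"
proof -
  let ?S = "snd c ` (fst c \<inter> fst d \<inter> fst e)"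
  have S: "open ?S"
    by (rule open_chart_image[OF A c(1)]) (auto intro!: open_Int open_chart_domain[OF A] c d e)
  have "((\<lambda>x. snd e (chart_inv d (snd d (chart_inv c x)))) has_derivative
      (\<lambda>w. fderiv (\<lambda>x. snd e (chart_inv d x)) (snd d p) (fderiv (\<lambda>x. snd d (chart_inv c x)) (snd c p) w))) (at (snd c p))"
    by (rule has_derivative_compose[OF transition_has_derivative[OF A c(1) d(1) c(2) d(2)]])
      (use transition_has_derivative[OF A d(1) e(1) d(2) e(2)] chart_inv_chart[OF A c] in simp)
  then have "((\<lambda>x. snd e (chart_inv c x)) has_derivative
      (\<lambda>w. fderiv (\<lambda>x. snd e (chart_inv d x)) (snd d p) (fderiv (\<lambda>x. snd d (chart_inv c x)) (snd c p) w))) (at (snd c p))"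
    by (rule has_derivative_transform_within_open[OF _ S])
      (use c d e chart_inv_chart[OF A c(1)] chart_inv_chart[OF A d(1)] in auto)
  then show ?thesis by (simp add: fderiv_eq)
qed

lemma fderiv_transition_self:
  assumes A: "smooth_manifold A" and c: "c \<in> A" "p \<in> fst c"
  shows "fderiv (\<lambda>x. snd c (chart_inv c x)) (snd c p) w = w"
proof -
  have S: "open (snd c ` fst c)" by (rule open_chart_image[OF A c(1) open_chart_domain[OF A c(1)]]) simp
  have "((\<lambda>x. snd c (chart_inv c x)) has_derivative (\<lambda>w. w)) (at (snd c p))"
    by (rule has_derivative_transform_within_open[OF has_derivative_ident S])
      (use c chart_chart_inv[OF A c(1)] in auto)
  then show ?thesis by (simp add: fderiv_eq)
qed

lemma tvec_of_in_tangent_space: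
  assumes "smooth_manifold A" "c \<in> A" "p \<in> fst c"
  shows "tvec_of A c p w \<in> tangent_space A p"
  unfolding tangent_space_def
proof (intro CollectI conjI allI impI ballI)
  show "tvec_of A c p w d = 0" if "\<not> (d \<in> A \<and> p \<in> fst d)" for d
    using that by (auto simp: tvec_of_def)
  fix d e assume d: "d \<in> A" "p \<in> fst d" and e: "e \<in> A" "p \<in> fst e"
  show "tvec_of A c p w e = fderiv (snd e \<circ> chart_inv d) (snd d p) (tvec_of A c p w d)"
    using fderiv_transition_trans[OF assms d e, of w] d e by (simp add: tvec_of_def comp_def)
qed

lemma tvec_of_chart:
  "smooth_manifold A \<Longrightarrow> c \<in> A \<Longrightarrow> p \<in> fst c \<Longrightarrow> tvec_of A c p w c = w"
  by (simp add: tvec_of_def fderiv_transition_self)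

lemma tangent_spaceD:
  "v \<in> tangent_space A p \<Longrightarrow> c \<in> A \<Longrightarrow> d \<in> A \<Longrightarrow> p \<in> fst c \<Longrightarrow> p \<in> fst d \<Longrightarrow>
    v d = fderiv (\<lambda>x. snd d (chart_inv c x)) (snd c p) (v c)"
  unfolding tangent_space_def comp_def by blast

lemma tangent_space_eqI:
  assumes "v \<in> tangent_space A p" "w \<in> tangent_space A p" "c \<in> A" "p \<in> fst c" "v c = w c"
  shows "v = w"
proof
  fix d
  show "v d = w d"
  proof (cases "d \<in> A \<and> p \<in> fst d")
    case True
    then show ?thesis
      using tangent_spaceD[OF assms(1,3) _ assms(4)] tangent_spaceD[OF assms(2,3) _ assms(4)] assms(5) by simp
  next
    case False
    have "u d = 0" if "u \<in> tangent_space A p" for u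
      using that False unfolding tangent_space_def by blast
    from this[OF assms(1)] this[OF assms(2)] show ?thesis by simp
  qed
qed

lemma zero_in_tangent_space:
  assumes "smooth_manifold A"
  shows "(\<lambda>_. 0) \<in> tangent_space A p"
  unfolding tangent_space_def
proof (intro CollectI conjI allI impI ballI)
  fix c d assume "c \<in> A" "d \<in> A" "p \<in> fst c" "p \<in> fst d"
  from has_derivative_linear[OF transition_has_derivative[OF assms this]]
  show "0 = fderiv (snd d \<circ> chart_inv c) (snd c p) 0" by (simp add: linear_0 comp_def)
qed simp

lemma tangent_vector_eq_0_iff:
  assumes "smooth_manifold A" "v \<in> tangent_space A p" "c \<in> A" "p \<in> fst c"
  shows "v = (\<lambda>_. 0) \<longleftrightarrow> v c = 0"
  using tangent_space_eqI[OF assms(2) zero_in_tangent_space[OF assms(1)] assms(3,4)] by auto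

lemma smooth_map_has_derivative:
  assumes A: "smooth_manifold A" and B: "smooth_manifold B" and f: "smooth_map A B f S"
    and c: "c \<in> A" "p \<in> fst c" and d: "d \<in> B" "f p \<in> fst d" and p: "p \<in> S"
  shows "((\<lambda>x. snd d (f (chart_inv c x))) has_derivative fderiv (\<lambda>x. snd d (f (chart_inv c x))) (snd c p)) (at (snd c p))"
proof -
  obtain N where "p \<in> N" "smooth_on (snd c ` N) (\<lambda>x. snd d (f (chart_inv c x)))"
    using smooth_map_chart_neighbourhood[OF A B f c d p] by metis
  then show ?thesis by (intro smooth_on_has_fderiv) auto
qed

text \<open>\<open>differential\<close> picks its source chart by \<open>SOME\<close>; the chain
  rule through the transition map shows that every chart at the point gives the same value.\<close>

lemma differential_in_charts:
  assumes A: "smooth_manifold A" and B: "smooth_manifold B" and f: "smooth_map A B f S"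
    and c: "c \<in> A" "p \<in> fst c" and d: "d \<in> B" "f p \<in> fst d" and p: "p \<in> S" and v: "v \<in> tangent_space A p"
  shows "differential A B f p v d = fderiv (\<lambda>x. snd d (f (chart_inv c x))) (snd c p) (v c)"
proof -
  define c' where "c' = (SOME c. c \<in> A \<and> p \<in> fst c)"
  have c': "c' \<in> A" "p \<in> fst c'"
    using someI[of "\<lambda>c. c \<in> A \<and> p \<in> fst c" c] c by (auto simp: c'_def)
  let ?S = "snd c' ` (fst c \<inter> fst c')"
  have S: "open ?S"
    by (rule open_chart_image[OF A c'(1)]) (auto intro!: open_Int open_chart_domain[OF A] c c')
  have "((\<lambda>x. snd d (f (chart_inv c (snd c (chart_inv c' x))))) has_derivative
      (\<lambda>w. fderiv (\<lambda>x. snd d (f (chart_inv c x))) (snd c p) (fderiv (\<lambda>x. snd c (chart_inv c' x)) (snd c' p) w))) (at (snd c' p))"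
    by (rule has_derivative_compose[OF transition_has_derivative[OF A c'(1) c(1) c'(2) c(2)]])
      (use smooth_map_has_derivative[OF A B f c d p] chart_inv_chart[OF A c'] in simp)
  then have "((\<lambda>x. snd d (f (chart_inv c' x))) has_derivative
      (\<lambda>w. fderiv (\<lambda>x. snd d (f (chart_inv c x))) (snd c p) (fderiv (\<lambda>x. snd c (chart_inv c' x)) (snd c' p) w))) (at (snd c' p))"
    by (rule has_derivative_transform_within_open[OF _ S])
      (use c c' chart_inv_chart[OF A c(1)] chart_inv_chart[OF A c'(1)] in auto)
  then have "fderiv (\<lambda>x. snd d (f (chart_inv c' x))) (snd c' p) (v c')
      = fderiv (\<lambda>x. snd d (f (chart_inv c x))) (snd c p) (v c)"
    using tangent_spaceD[OF v c'(1) c(1) c'(2) c(2)] by (simp add: fderiv_eq)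
  then show ?thesis using d by (simp add: differential_def Let_def comp_def flip: c'_def)
qed

lemma differential_in_tangent_space:
  assumes A: "smooth_manifold A" and B: "smooth_manifold B" and f: "smooth_map A B f S"
    and p: "p \<in> S" and v: "v \<in> tangent_space A p"
  shows "differential A B f p v \<in> tangent_space B (f p)"
  unfolding tangent_space_def
proof (intro CollectI conjI allI impI ballI)
  show "differential A B f p v d = 0" if "\<not> (d \<in> B \<and> f p \<in> fst d)" for d
    using that by (auto simp: differential_def)
  fix d e assume d: "d \<in> B" "f p \<in> fst d" and e: "e \<in> B" "f p \<in> fst e"
  obtain c where c: "c \<in> A" "p \<in> fst c" using chart_at[OF A] .
  obtain N where N: "open N" "p \<in> N" "N \<subseteq> S \<inter> fst c" "f ` N \<subseteq> fst d" "open (snd c ` N)"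
    "smooth_on (snd c ` N) (\<lambda>x. snd d (f (chart_inv c x)))"
    using smooth_map_chart_neighbourhood[OF A B f c d p] by metis
  have "((\<lambda>x. snd e (chart_inv d (snd d (f (chart_inv c x))))) has_derivative
      (\<lambda>w. fderiv (\<lambda>y. snd e (chart_inv d y)) (snd d (f p)) (fderiv (\<lambda>x. snd d (f (chart_inv c x))) (snd c p) w))) (at (snd c p))"
    by (rule has_derivative_compose[OF smooth_map_has_derivative[OF A B f c d p]])
      (use transition_has_derivative[OF B d(1) e(1) d(2) e(2)] chart_inv_chart[OF A c] in simp)
  then have "((\<lambda>x. snd e (f (chart_inv c x))) has_derivative
      (\<lambda>w. fderiv (\<lambda>y. snd e (chart_inv d y)) (snd d (f p)) (fderiv (\<lambda>x. snd d (f (chart_inv c x))) (snd c p) w))) (at (snd c p))"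
  proof (rule has_derivative_transform_within_open[OF _ N(5)])
    fix x assume "x \<in> snd c ` N"
    then obtain q where q: "q \<in> N" "x = snd c q" by blast
    then have "q \<in> fst c" "f q \<in> fst d" using N by auto
    then show "snd e (chart_inv d (snd d (f (chart_inv c x)))) = snd e (f (chart_inv c x))"
      by (simp add: q(2) chart_inv_chart[OF A c(1)] chart_inv_chart[OF B d(1)])
  qed (use N in auto)
  then show "differential A B f p v e = fderiv (snd e \<circ> chart_inv d) (snd d (f p)) (differential A B f p v d)"
    unfolding differential_in_charts[OF A B f c d p v] differential_in_charts[OF A B f c e p v]
    by (simp add: fderiv_eq comp_def)
qed

lemma differential_eq_0_iff:
  assumes A: "smooth_manifold A" and B: "smooth_manifold B" and f: "smooth_map A B f S"
    and c: "c \<in> A" "p \<in> fst c" and d: "d \<in> B" "f p \<in> fst d" and p: "p \<in> S" and v: "v \<in> tangent_space A p"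
  shows "differential A B f p v = (\<lambda>_. 0) \<longleftrightarrow> fderiv (\<lambda>x. snd d (f (chart_inv c x))) (snd c p) (v c) = 0"
  using tangent_vector_eq_0_iff[OF B differential_in_tangent_space[OF A B f p v] d]
    differential_in_charts[OF A B f c d p v] by simp

text \<open>The dictionary between images of sets of tangent vectors and images in coordinates. It
  is used for the submersion property, for contact elements and for critical points of the
  restriction to a surface.\<close>

lemma differential_image_eq_iff:
  assumes A: "smooth_manifold A" and B: "smooth_manifold B" and f: "smooth_map A B f S"
    and c: "c \<in> A" "p \<in> fst c" and d: "d \<in> B" "f p \<in> fst d" and p: "p \<in> S"
  shows "differential A B f p ` {v \<in> tangent_space A p. v c \<in> P} = {w \<in> tangent_space B (f p). w d \<in> Q} \<longleftrightarrow>
    fderiv (\<lambda>x. snd d (f (chart_inv c x))) (snd c p) ` P = Q"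
proof -
  let ?D = "fderiv (\<lambda>x. snd d (f (chart_inv c x))) (snd c p)"
  note dc = differential_in_charts[OF A B f c d p]
  have eq: "differential A B f p ` {v \<in> tangent_space A p. v c \<in> P} = {w \<in> tangent_space B (f p). w d \<in> ?D ` P}"
  proof (intro equalityI subsetI)
    fix w assume "w \<in> differential A B f p ` {v \<in> tangent_space A p. v c \<in> P}"
    then obtain v where v: "v \<in> tangent_space A p" "v c \<in> P" "w = differential A B f p v" by blast
    then show "w \<in> {w \<in> tangent_space B (f p). w d \<in> ?D ` P}"
      using dc[OF v(1)] differential_in_tangent_space[OF A B f p v(1)] by simp
  next
    fix w assume "w \<in> {w \<in> tangent_space B (f p). w d \<in> ?D ` P}"
    then obtain u where u: "w \<in> tangent_space B (f p)" "u \<in> P" "w d = ?D u" by blast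
    let ?v = "tvec_of A c p u"
    have v: "?v \<in> tangent_space A p" "?v c = u"
      using tvec_of_in_tangent_space[OF A c] tvec_of_chart[OF A c] by auto
    then have "w = differential A B f p ?v"
      using dc[OF v(1)] u by (intro tangent_space_eqI[OF u(1) differential_in_tangent_space[OF A B f p v(1)] d]) simp
    then show "w \<in> differential A B f p ` {v \<in> tangent_space A p. v c \<in> P}" using v u by auto
  qed
  have inj: "{w \<in> tangent_space B (f p). w d \<in> X} = {w \<in> tangent_space B (f p). w d \<in> Y} \<Longrightarrow> X \<subseteq> Y" for X Y
  proof
    fix y assume *: "{w \<in> tangent_space B (f p). w d \<in> X} = {w \<in> tangent_space B (f p). w d \<in> Y}" "y \<in> X"
    have t: "tvec_of B d (f p) y \<in> tangent_space B (f p)" "tvec_of B d (f p) y d = y"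
      using tvec_of_in_tangent_space[OF B d] tvec_of_chart[OF B d] by auto
    then have "tvec_of B d (f p) y \<in> {w \<in> tangent_space B (f p). w d \<in> X}" using *(2) by simp
    then have "tvec_of B d (f p) y \<in> {w \<in> tangent_space B (f p). w d \<in> Y}" unfolding *(1) .
    then show "y \<in> Y" using t(2) by simp
  qed
  show ?thesis unfolding eq using inj[of "?D ` P" Q] inj[of Q "?D ` P"] by blast
qed

lemma differential_surjective_iff:
  assumes A: "smooth_manifold A" and B: "smooth_manifold B" and f: "smooth_map A B f S"
    and c: "c \<in> A" "p \<in> fst c" and d: "d \<in> B" "f p \<in> fst d" and p: "p \<in> S"
  shows "differential A B f p ` tangent_space A p = tangent_space B (f p) \<longleftrightarrow>
    surj (fderiv (\<lambda>x. snd d (f (chart_inv c x))) (snd c p))"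
  using differential_image_eq_iff[OF assms, of UNIV UNIV] by simp

lemma nonzero_differential_iff:
  assumes A: "smooth_manifold A" and g: "smooth_map A std_atlas g S" and c: "c \<in> A" "p \<in> fst c" and p: "p \<in> S"
  shows "nonzero_differential A g p \<longleftrightarrow> (\<exists>w. fderiv (\<lambda>x. g (chart_inv c x)) (snd c p) w \<noteq> 0)"
proof -
  have d: "(UNIV, id) \<in> std_atlas" "g p \<in> fst (UNIV, id)" by (simp_all add: std_chart)
  have *: "differential A std_atlas g p v \<noteq> (\<lambda>_. 0) \<longleftrightarrow> fderiv (\<lambda>x. g (chart_inv c x)) (snd c p) (v c) \<noteq> 0"
    if "v \<in> tangent_space A p" for v
    using differential_eq_0_iff[OF A smooth_manifold_std_atlas g c d p that] by simp
  show ?thesis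
    unfolding nonzero_differential_def
    using * tvec_of_in_tangent_space[OF A c] tvec_of_chart[OF A c] by metis
qed

section \<open>Curves and level sets\<close>

lemma smooth_curve_in_chart:
  assumes A: "smooth_manifold A" and g: "smooth_map std_atlas A \<gamma> I" and c: "c \<in> A" "\<gamma> t \<in> fst c" and t: "t \<in> I"
  obtains J where "open J" "t \<in> J" "J \<subseteq> I" "\<gamma> ` J \<subseteq> fst c" "smooth_on J (\<lambda>s. snd c (\<gamma> s))"
proof -
  have "(UNIV, id) \<in> std_atlas" "t \<in> fst (UNIV, id)" by (simp_all add: std_chart)
  from smooth_map_chart_neighbourhood[OF smooth_manifold_std_atlas A g this c t]
  show thesis using that by auto
qed

lemma smooth_curve_from_chart:
  assumes A: "smooth_manifold A" and c: "c \<in> A" and I: "open I" "smooth_on I \<gamma>" "\<gamma> ` I \<subseteq> snd c ` fst c"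
  shows "smooth_map std_atlas A (\<lambda>s. chart_inv c (\<gamma> s)) I"
  unfolding smooth_map_def
proof (intro ballI)
  fix t assume t: "t \<in> I"
  have "smooth_on I (\<lambda>s. snd c (chart_inv c (\<gamma> s)))"
    by (rule smooth_on_cong[OF I(1) _ I(2)]) (use chart_chart_inv[OF A c] I(3) in auto)
  then have "smooth_on (snd (UNIV, id) ` I) (snd c \<circ> (\<lambda>s. chart_inv c (\<gamma> s)) \<circ> chart_inv (UNIV, id))"
    by (simp add: comp_def)
  moreover have "(\<lambda>s. chart_inv c (\<gamma> s)) ` I \<subseteq> fst c" using chart_inv_in[OF A c] I(3) by auto
  ultimately show "\<exists>e\<in>std_atlas. \<exists>d\<in>A. \<exists>N. open N \<and> t \<in> N \<and> N \<subseteq> I \<inter> fst e \<and>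
      (\<lambda>s. chart_inv c (\<gamma> s)) ` N \<subseteq> fst d \<and> smooth_on (snd e ` N) (snd d \<circ> (\<lambda>s. chart_inv c (\<gamma> s)) \<circ> chart_inv e)"
    using c I(1) t by (intro bexI[of _ "(UNIV, id)"] bexI[of _ c] exI[of _ I]) (auto simp: std_chart)
qed

lemma velocity_chart:
  assumes A: "smooth_manifold A" and g: "smooth_map std_atlas A \<gamma> I" and c: "c \<in> A" "\<gamma> t \<in> fst c" and t: "t \<in> I"
  shows "((\<lambda>s. snd c (\<gamma> s)) has_vector_derivative velocity A \<gamma> t c) (at t)"
proof -
  obtain J where "t \<in> J" "smooth_on J (\<lambda>s. snd c (\<gamma> s))" using smooth_curve_in_chart[OF assms] by metis
  then have "((\<lambda>s. snd c (\<gamma> s)) has_vector_derivative fderiv (\<lambda>s. snd c (\<gamma> s)) t 1) (at t)"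
    using smooth_curve_has_vector_derivative by blast
  then show ?thesis using c by (simp add: velocity_def comp_def vector_derivative_at)
qed

lemma velocity_in_tangent_space:
  assumes A: "smooth_manifold A" and g: "smooth_map std_atlas A \<gamma> I" and t: "t \<in> I"
  shows "velocity A \<gamma> t \<in> tangent_space A (\<gamma> t)"
  unfolding tangent_space_def
proof (intro CollectI conjI allI impI ballI)
  show "velocity A \<gamma> t c = 0" if "\<not> (c \<in> A \<and> \<gamma> t \<in> fst c)" for c
    using that by (auto simp: velocity_def)
  fix c d assume c: "c \<in> A" "\<gamma> t \<in> fst c" and d: "d \<in> A" "\<gamma> t \<in> fst d"
  obtain J where J: "open J" "t \<in> J" "J \<subseteq> I" "\<gamma> ` J \<subseteq> fst c"
    using smooth_curve_in_chart[OF A g c t] by metis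
  have "((\<lambda>s. snd d (chart_inv c (snd c (\<gamma> s)))) has_vector_derivative
      fderiv (\<lambda>x. snd d (chart_inv c x)) (snd c (\<gamma> t)) (velocity A \<gamma> t c)) (at t)"
    by (rule curve_chain_rule[OF velocity_chart[OF A g c t] transition_has_derivative[OF A c(1) d(1) c(2) d(2)]])
  then have "((\<lambda>s. snd d (\<gamma> s)) has_vector_derivative
      fderiv (\<lambda>x. snd d (chart_inv c x)) (snd c (\<gamma> t)) (velocity A \<gamma> t c)) (at t)"
    by (rule has_vector_derivative_transform_within_open[OF _ J(1,2)])
      (use J chart_inv_chart[OF A c(1)] in auto)
  then show "velocity A \<gamma> t d = fderiv (snd d \<circ> chart_inv c) (snd c (\<gamma> t)) (velocity A \<gamma> t c)"
    using vector_derivative_unique_at[OF velocity_chart[OF A g d t]] by (simp add: comp_def)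
qed

lemma velocity_image:
  assumes A: "smooth_manifold A" and B: "smooth_manifold B" and f: "smooth_map A B f S"
    and g: "smooth_map std_atlas A \<gamma> I" and t: "t \<in> I" "\<gamma> t \<in> S"
    and c: "c \<in> A" "\<gamma> t \<in> fst c" and d: "d \<in> B" "f (\<gamma> t) \<in> fst d"
  shows "((\<lambda>s. snd d (f (\<gamma> s))) has_vector_derivative
      fderiv (\<lambda>x. snd d (f (chart_inv c x))) (snd c (\<gamma> t)) (velocity A \<gamma> t c)) (at t)"
proof -
  obtain J where J: "open J" "t \<in> J" "J \<subseteq> I" "\<gamma> ` J \<subseteq> fst c"
    using smooth_curve_in_chart[OF A g c t(1)] by metis
  have "((\<lambda>s. snd d (f (chart_inv c (snd c (\<gamma> s))))) has_vector_derivative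
      fderiv (\<lambda>x. snd d (f (chart_inv c x))) (snd c (\<gamma> t)) (velocity A \<gamma> t c)) (at t)"
    by (rule curve_chain_rule[OF velocity_chart[OF A g c t(1)] smooth_map_has_derivative[OF A B f c d t(2)]])
  then show ?thesis
    by (rule has_vector_derivative_transform_within_open[OF _ J(1,2)])
      (use J chart_inv_chart[OF A c(1)] in auto)
qed

lemma velocity_composition:
  assumes A: "smooth_manifold A" and B: "smooth_manifold B" and f: "smooth_map A B f S"
    and g: "smooth_map std_atlas A \<gamma> I" and t: "t \<in> I" "\<gamma> t \<in> S"
    and c: "c \<in> A" "\<gamma> t \<in> fst c"
  shows "velocity B (f \<circ> \<gamma>) t = differential A B f (\<gamma> t) (velocity A \<gamma> t)"
proof
  fix d
  show "velocity B (f \<circ> \<gamma>) t d = differential A B f (\<gamma> t) (velocity A \<gamma> t) d"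
  proof (cases "d \<in> B \<and> f (\<gamma> t) \<in> fst d")
    case True
    then show ?thesis
      using vector_derivative_at[OF velocity_image[OF assms]]
        differential_in_charts[OF A B f c _ _ t(2) velocity_in_tangent_space[OF A g t(1)]]
      by (simp add: velocity_def comp_def)
  next
    case False
    then show ?thesis by (auto simp: velocity_def differential_def)
  qed
qed

text \<open>For a fibre, \<open>N\<close> is everything and \<open>S\<close> the fibre; for a surface, \<open>f\<close> is a local equation on \<open>N\<close>.\<close>

lemma tangent_to_level_set:
  fixes A :: "('m::topological_space, real^'n) atlas" and B :: "('b::topological_space, 'f::euclidean_space) atlas"
  assumes A: "smooth_manifold A" and B: "smooth_manifold B" and f: "smooth_map A B f N"
    and p: "p \<in> N" and S: "S \<inter> N = {q \<in> N. f q = f p}"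
    and c: "c \<in> A" "p \<in> fst c" and d: "d \<in> B" "f p \<in> fst d"
    and surj: "surj (fderiv (\<lambda>x. snd d (f (chart_inv c x))) (snd c p))"
  shows "tangent_to A S p = {v \<in> tangent_space A p. fderiv (\<lambda>x. snd d (f (chart_inv c x))) (snd c p) (v c) = 0}"
proof (intro equalityI subsetI)
  fix v assume "v \<in> tangent_to A S p"
  then obtain \<gamma> \<epsilon> where g: "\<epsilon> > 0" "smooth_map std_atlas A \<gamma> {-\<epsilon><..<\<epsilon>}" "\<gamma> ` {-\<epsilon><..<\<epsilon>} \<subseteq> S" "\<gamma> 0 = p"
    "v = velocity A \<gamma> 0"
    unfolding tangent_to_def by blast
  have 0: "0 \<in> {-\<epsilon><..<\<epsilon>}" using g(1) by simp
  define J where "J = {-\<epsilon><..<\<epsilon>} \<inter> \<gamma> -` N"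
  have J: "open J" "0 \<in> J"
    unfolding J_def using continuous_open_preimage[OF smooth_map_continuous_on[OF smooth_manifold_std_atlas A g(2)]
        open_greaterThanLessThan smooth_map_openD[OF f]] 0 p g(4) by auto
  have "((\<lambda>s. snd d (f (\<gamma> s))) has_vector_derivative
      fderiv (\<lambda>x. snd d (f (chart_inv c x))) (snd c p) (v c)) (at 0)"
    using velocity_image[OF A B f g(2) 0] p c d g(4,5) by simp
  moreover have "((\<lambda>s. snd d (f (\<gamma> s))) has_vector_derivative 0) (at 0)"
  proof (rule has_vector_derivative_transform_within_open[OF has_vector_derivative_const J])
    show "snd d (f p) = snd d (f (\<gamma> s))" if "s \<in> J" for s
    proof -
      have "\<gamma> s \<in> S \<inter> N" using that g(3) by (auto simp: J_def)
      then show ?thesis unfolding S by simp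
    qed
  qed
  ultimately have "fderiv (\<lambda>x. snd d (f (chart_inv c x))) (snd c p) (v c) = 0"
    by (rule vector_derivative_unique_at)
  then show "v \<in> {v \<in> tangent_space A p. fderiv (\<lambda>x. snd d (f (chart_inv c x))) (snd c p) (v c) = 0}"
    using velocity_in_tangent_space[OF A g(2) 0] g(4,5) by simp
next
  fix v assume "v \<in> {v \<in> tangent_space A p. fderiv (\<lambda>x. snd d (f (chart_inv c x))) (snd c p) (v c) = 0}"
  then have v: "v \<in> tangent_space A p" "fderiv (\<lambda>x. snd d (f (chart_inv c x))) (snd c p) (v c) = 0" by auto
  obtain P where P: "open P" "p \<in> P" "P \<subseteq> N \<inter> fst c" "f ` P \<subseteq> fst d" "open (snd c ` P)"
    "smooth_on (snd c ` P) (\<lambda>x. snd d (f (chart_inv c x)))"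
    using smooth_map_chart_neighbourhood[OF A B f c d p] by metis
  have pP: "snd c p \<in> snd c ` P" using P by blast
  obtain \<gamma> \<epsilon> where g: "\<epsilon> > 0" "smooth_on {-\<epsilon><..<\<epsilon>} \<gamma>" "\<gamma> 0 = snd c p" "\<gamma> ` {-\<epsilon><..<\<epsilon>} \<subseteq> snd c ` P"
    "\<And>t. t \<in> {-\<epsilon><..<\<epsilon>} \<Longrightarrow> snd d (f (chart_inv c (\<gamma> t))) = snd d (f (chart_inv c (snd c p)))"
    "(\<gamma> has_vector_derivative v c) (at 0)"
    using curve_in_level_set[OF P(5,6) pP surj v(2)] by metis
  define \<sigma> where "\<sigma> s = chart_inv c (\<gamma> s)" for s
  have 0: "0 \<in> {-\<epsilon><..<\<epsilon>}" using g(1) by simp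
  have sub: "\<gamma> ` {-\<epsilon><..<\<epsilon>} \<subseteq> snd c ` fst c" using g(4) P(3) by blast
  have sm: "smooth_map std_atlas A \<sigma> {-\<epsilon><..<\<epsilon>}"
    unfolding \<sigma>_def[abs_def] by (rule smooth_curve_from_chart[OF A c(1) open_greaterThanLessThan g(2) sub])
  have "\<sigma> ` {-\<epsilon><..<\<epsilon>} \<subseteq> S"
  proof (rule image_subsetI)
    fix s assume s: "s \<in> {-\<epsilon><..<\<epsilon>}"
    then obtain q where q: "q \<in> P" "\<gamma> s = snd c q" using g(4) by blast
    then have qs: "\<sigma> s = q" using chart_inv_chart[OF A c(1)] P(3) by (auto simp: \<sigma>_def)
    have "snd d (f q) = snd d (f p)"
      using g(5)[OF s] qs chart_inv_chart[OF A c] by (simp add: \<sigma>_def)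
    moreover have "f q \<in> fst d" using q P(4) by blast
    ultimately have "f q = f p" using chart_inv_chart[OF B d(1)] d(2) by metis
    then have "q \<in> {q \<in> N. f q = f p}" using q P(3) by auto
    then show "\<sigma> s \<in> S" using S qs by blast
  qed
  moreover have \<sigma>0: "\<sigma> 0 = p" using g(3) chart_inv_chart[OF A c] by (simp add: \<sigma>_def)
  moreover have "v = velocity A \<sigma> 0"
  proof (rule tangent_space_eqI[OF v(1) _ c])
    show "velocity A \<sigma> 0 \<in> tangent_space A p" using velocity_in_tangent_space[OF A sm 0] \<sigma>0 by simp
    have "((\<lambda>s. snd c (\<sigma> s)) has_vector_derivative v c) (at 0)"
    proof (rule has_vector_derivative_transform_within_open[OF g(6) open_greaterThanLessThan 0])
      fix s assume "s \<in> {-\<epsilon><..<\<epsilon>}"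
      then have "\<gamma> s \<in> snd c ` fst c" using sub by blast
      then show "\<gamma> s = snd c (\<sigma> s)" using chart_chart_inv[OF A c(1)] by (simp add: \<sigma>_def)
    qed
    then show "v c = velocity A \<sigma> 0 c"
      using vector_derivative_unique_at velocity_chart[OF A sm c(1) _ 0] c(2) \<sigma>0 by metis
  qed
  ultimately show "v \<in> tangent_to A S p" unfolding tangent_to_def using g(1) sm by blast
qed

section \<open>Adapted charts\<close>

lemma smooth_map_subset:
  assumes A: "smooth_manifold A" and B: "smooth_manifold B" and f: "smooth_map A B f S" and N: "open N" "N \<subseteq> S"
  shows "smooth_map A B f N"
  unfolding smooth_map_def
proof
  fix p assume p: "p \<in> N"
  obtain c d P where *: "c \<in> A" "d \<in> B" "open P" "p \<in> P" "P \<subseteq> S \<inter> fst c" "f ` P \<subseteq> fst d"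
    "smooth_on (snd c ` P) (snd d \<circ> f \<circ> chart_inv c)"
    using smooth_mapE[OF f] p N(2) by (metis subsetD)
  have "smooth_on (snd c ` (P \<inter> N)) (snd d \<circ> f \<circ> chart_inv c)"
    by (rule smooth_on_subset[OF *(7)]) auto
  then show "\<exists>c\<in>A. \<exists>d\<in>B. \<exists>P. open P \<and> p \<in> P \<and> P \<subseteq> N \<inter> fst c \<and> f ` P \<subseteq> fst d \<and>
      smooth_on (snd c ` P) (snd d \<circ> f \<circ> chart_inv c)"
    using * p N(1) by (intro bexI[of _ c] bexI[of _ d] exI[of _ "P \<inter> N"]) auto
qed

lemma smooth_map_real_in_chart:
  assumes A: "smooth_manifold A" and g: "smooth_map A std_atlas g S" and c: "c \<in> A" and N: "open N" "N \<subseteq> S \<inter> fst c"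
  shows "smooth_on (snd c ` N) (\<lambda>x. g (chart_inv c x))"
proof -
  have "(UNIV, id) \<in> std_atlas" by (simp add: std_chart)
  from smooth_map_in_charts[OF A smooth_manifold_std_atlas g c this N] show ?thesis by simp
qed

lemma kernel_not_contained_if_cross_nonzero:
  fixes \<nu> a :: "real^3"
  assumes "cross3 \<nu> a \<noteq> 0"
  obtains w where "a \<bullet> w = 0" "\<nu> \<bullet> w \<noteq> 0"
proof -
  \<comment> \<open>The witness is \<open>a \<bullet> a\<close> times the component of
    \<open>\<nu>\<close> orthogonal to \<open>a\<close>.\<close>
  have "a \<bullet> cross3 a (cross3 \<nu> a) = 0" by (simp add: dot_cross_self)
  moreover have "\<nu> \<bullet> cross3 a (cross3 \<nu> a) = cross3 \<nu> a \<bullet> cross3 \<nu> a"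
    by (simp add: cross3_simps)
  ultimately show thesis using that assms by (metis inner_eq_zero_iff)
qed

locale legendrian_fibration_pair =
  fixes M :: "('m::topological_space, real^3) atlas"
    and \<xi> :: "'m \<Rightarrow> ('m, real^3) tvec set"
    and B :: "('b::topological_space, real^2) atlas"
    and B' :: "('c::topological_space, real^2) atlas"
    and \<rho> :: "'m \<Rightarrow> 'b" and \<rho>' :: "'m \<Rightarrow> 'c"
  assumes M: "smooth_manifold M" and B: "smooth_manifold B" and B': "smooth_manifold B'"
    and contact_\<xi>: "contact_structure M \<xi>"
    and leg_\<rho>: "legendrian_fibration M \<xi> B \<rho>" and leg_\<rho>': "legendrian_fibration M \<xi> B' \<rho>'"
    and transv: "transverse_fibrations M \<rho> \<rho>'"
begin

lemma smooth_\<rho>: "smooth_map M B \<rho> UNIV" and smooth_\<rho>': "smooth_map M B' \<rho>' UNIV"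
  using leg_\<rho> leg_\<rho>' by (auto simp: legendrian_fibration_def smooth_fibration_def)

abbreviation R where "R c d \<equiv> \<lambda>x. snd d (\<rho> (chart_inv c x))"
abbreviation R' where "R' c d' \<equiv> \<lambda>x. snd d' (\<rho>' (chart_inv c x))"

text \<open>The chart \<open>c\<close> is dictated by the contact structure, as one in which a
  contact form is given; \<open>N\<close> is then small enough for a single chart of each
  base.\<close>

definition adapted where
  "adapted c d d' \<alpha> N \<longleftrightarrow> c \<in> M \<and> d \<in> B \<and> d' \<in> B' \<and> open N \<and> N \<subseteq> fst c \<and> \<rho> ` N \<subseteq> fst d \<and> \<rho>' ` N \<subseteq> fst d' \<and>
    (\<forall>q\<in>N. \<xi> q = {v \<in> tangent_space M q. \<alpha> (snd c q) \<bullet> v c = 0}) \<and>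
    legendrian_pair (snd c ` N) \<alpha> (R c d) (R' c d')"

lemma surj_R: "c \<in> M \<Longrightarrow> q \<in> fst c \<Longrightarrow> d \<in> B \<Longrightarrow> \<rho> q \<in> fst d \<Longrightarrow> surj (fderiv (R c d) (snd c q))"
  using differential_surjective_iff[OF M B smooth_\<rho>] leg_\<rho>
  by (auto simp: legendrian_fibration_def smooth_fibration_def)

lemma surj_R': "c \<in> M \<Longrightarrow> q \<in> fst c \<Longrightarrow> d \<in> B' \<Longrightarrow> \<rho>' q \<in> fst d \<Longrightarrow> surj (fderiv (R' c d) (snd c q))"
  using differential_surjective_iff[OF M B' smooth_\<rho>'] leg_\<rho>'
  by (auto simp: legendrian_fibration_def smooth_fibration_def)

lemma tangent_to_fibre_\<rho>:
  assumes "c \<in> M" "q \<in> fst c" "d \<in> B" "\<rho> q \<in> fst d"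
  shows "tangent_to M (fibre \<rho> q) q = {v \<in> tangent_space M q. fderiv (R c d) (snd c q) (v c) = 0}"
  by (rule tangent_to_level_set[OF M B smooth_\<rho> _ _ assms surj_R[OF assms]]) (auto simp: fibre_def)

lemma tangent_to_fibre_\<rho>':
  assumes "c \<in> M" "q \<in> fst c" "d \<in> B'" "\<rho>' q \<in> fst d"
  shows "tangent_to M (fibre \<rho>' q) q = {v \<in> tangent_space M q. fderiv (R' c d) (snd c q) (v c) = 0}"
  by (rule tangent_to_level_set[OF M B' smooth_\<rho>' _ _ assms surj_R'[OF assms]]) (auto simp: fibre_def)

text \<open>The chart \<open>d\<close> is prescribed, not found:
  \<open>inflection_along_unique\<close> compares contact elements at two points over the same point
  of \<open>B\<close> and needs a common chart there.\<close>

lemma adapted_exists: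
  assumes O: "open W" "p \<in> W" and d: "d \<in> B" "\<rho> p \<in> fst d"
  obtains c d' \<alpha> N where "adapted c d d' \<alpha> N" "p \<in> N" "N \<subseteq> W"
proof -
  from spec[OF contact_\<xi>[unfolded contact_structure_def], of p]
  obtain c N0 \<alpha> where c: "c \<in> M" "open N0" "p \<in> N0" "N0 \<subseteq> fst c" "smooth_on (snd c ` N0) \<alpha>"
    and N0: "\<forall>q\<in>N0. \<xi> q = {v \<in> tangent_space M q. \<alpha> (snd c q) \<bullet> v c = 0} \<and>
      (\<exists>u v w. wedge_ext_deriv \<alpha> (snd c q) u v w \<noteq> 0)"
    by (elim bexE exE conjE)
  have \<xi>: "\<xi> q = {v \<in> tangent_space M q. \<alpha> (snd c q) \<bullet> v c = 0}"
    and ct: "\<exists>u v w. wedge_ext_deriv \<alpha> (snd c q) u v w \<noteq> 0" if "q \<in> N0" for q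
    using bspec[OF N0 that] by (rule conjunct1, rule conjunct2)
  obtain d' where d': "d' \<in> B'" "\<rho>' p \<in> fst d'" using chart_at[OF B'] .
  define N where "N = N0 \<inter> W \<inter> (\<rho> -` fst d) \<inter> (\<rho>' -` fst d')"
  have "open (\<rho> -` fst d)" "open (\<rho>' -` fst d')"
    using open_vimage open_chart_domain[OF B d(1)] open_chart_domain[OF B' d'(1)]
      smooth_map_continuous_on[OF M B smooth_\<rho>] smooth_map_continuous_on[OF M B' smooth_\<rho>'] by blast+
  then have N: "open N" "p \<in> N" "N \<subseteq> W" "N \<subseteq> N0" "N \<subseteq> fst c" "\<rho> ` N \<subseteq> fst d" "\<rho>' ` N \<subseteq> fst d'"
    using O c d d' by (auto simp: N_def)
  have "legendrian_pair (snd c ` N) \<alpha> (R c d) (R' c d')"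
  proof
    show "open (snd c ` N)" by (rule open_chart_image[OF M c(1) N(1,5)])
    show "smooth_on (snd c ` N) \<alpha>" by (rule smooth_on_subset[OF c(5)]) (use N in auto)
    show "smooth_on (snd c ` N) (R c d)"
      by (rule smooth_map_in_charts[OF M B smooth_\<rho> c(1) d(1)]) (use N in auto)
    show "smooth_on (snd c ` N) (R' c d')"
      by (rule smooth_map_in_charts[OF M B' smooth_\<rho>' c(1) d'(1)]) (use N in auto)
    fix x assume "x \<in> snd c ` N"
    then obtain q where q: "q \<in> N" "x = snd c q" by blast
    have qc: "q \<in> fst c" "\<rho> q \<in> fst d" "\<rho>' q \<in> fst d'" "q \<in> N0" using q N by auto
    show "\<exists>u v w. wedge_ext_deriv \<alpha> x u v w \<noteq> 0" using ct[OF qc(4)] q(2) by simp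
    show "surj (fderiv (R c d) x)" "surj (fderiv (R' c d') x)"
      using surj_R[OF c(1) qc(1) d(1) qc(2)] surj_R'[OF c(1) qc(1) d'(1) qc(3)] q(2) by auto
    fix v
    let ?v = "tvec_of M c q v"
    have v: "?v \<in> tangent_space M q" "?v c = v"
      using tvec_of_in_tangent_space[OF M c(1) qc(1)] tvec_of_chart[OF M c(1) qc(1)] by auto
    note t = tangent_to_fibre_\<rho>[OF c(1) qc(1) d(1) qc(2)] tangent_to_fibre_\<rho>'[OF c(1) qc(1) d'(1) qc(3)]
    show "\<alpha> x \<bullet> v = 0" if "fderiv (R c d) x v = 0"
    proof -
      have "?v \<in> tangent_to M (fibre \<rho> q) q" unfolding t using that v q(2) by simp
      then have "?v \<in> \<xi> q" using leg_\<rho> unfolding legendrian_fibration_def by blast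
      then show ?thesis using \<xi>[OF qc(4)] v q(2) by simp
    qed
    show "\<alpha> x \<bullet> v = 0" if "fderiv (R' c d') x v = 0"
    proof -
      have "?v \<in> tangent_to M (fibre \<rho>' q) q" unfolding t using that v q(2) by simp
      then have "?v \<in> \<xi> q" using leg_\<rho>' unfolding legendrian_fibration_def by blast
      then show ?thesis using \<xi>[OF qc(4)] v q(2) by simp
    qed
    show "v = 0" if "fderiv (R c d) x v = 0" "fderiv (R' c d') x v = 0"
    proof -
      have "?v \<in> tangent_to M (fibre \<rho> q) q \<inter> tangent_to M (fibre \<rho>' q) q"
        unfolding t using that v q(2) by simp
      then have "?v = (\<lambda>_. 0)" using transv unfolding transverse_fibrations_def by blast
      then show "v = 0" using v(2) by simp
    qed
  qed
  then have "adapted c d d' \<alpha> N"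
    unfolding adapted_def using c(1) d(1) d'(1) N \<xi> by blast
  then show thesis using that N by blast
qed

lemma adaptedD:
  assumes "adapted c d d' \<alpha> N"
  shows "c \<in> M" "d \<in> B" "d' \<in> B'" "open N" "N \<subseteq> fst c" "\<rho> ` N \<subseteq> fst d" "\<rho>' ` N \<subseteq> fst d'"
    "q \<in> N \<Longrightarrow> \<xi> q = {v \<in> tangent_space M q. \<alpha> (snd c q) \<bullet> v c = 0}"
    "legendrian_pair (snd c ` N) \<alpha> (R c d) (R' c d')"
    "q \<in> N \<Longrightarrow> q \<in> fst c" "q \<in> N \<Longrightarrow> \<rho> q \<in> fst d" "q \<in> N \<Longrightarrow> \<rho>' q \<in> fst d'" "q \<in> N \<Longrightarrow> snd c q \<in> snd c ` N"
    "q \<in> N \<Longrightarrow> chart_inv c (snd c q) = q"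
proof -
  show *: "c \<in> M" "d \<in> B" "d' \<in> B'" "open N" "N \<subseteq> fst c" "\<rho> ` N \<subseteq> fst d" "\<rho>' ` N \<subseteq> fst d'"
    "q \<in> N \<Longrightarrow> \<xi> q = {v \<in> tangent_space M q. \<alpha> (snd c q) \<bullet> v c = 0}"
    "legendrian_pair (snd c ` N) \<alpha> (R c d) (R' c d')"
    using assms unfolding adapted_def by blast+
  show "q \<in> N \<Longrightarrow> q \<in> fst c" "q \<in> N \<Longrightarrow> \<rho> q \<in> fst d" "q \<in> N \<Longrightarrow> \<rho>' q \<in> fst d'" "q \<in> N \<Longrightarrow> snd c q \<in> snd c ` N"
    using * by blast+
  show "q \<in> N \<Longrightarrow> chart_inv c (snd c q) = q"
    using chart_inv_chart[OF M *(1)] *(5) by blast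
qed

section \<open>Inflections of the front of a Legendre curve\<close>

text \<open>Isolates what the inflection criterion takes from a characteristic: tangency to the
  contact planes.\<close>

definition legendre_curve where
  "legendre_curve \<gamma> I \<longleftrightarrow> open I \<and> smooth_map std_atlas M \<gamma> I \<and> (\<forall>s\<in>I. velocity M \<gamma> s \<in> \<xi> (\<gamma> s))"

lemma legendre_curve_in_chart:
  assumes g: "legendre_curve \<gamma> I" and t: "t \<in> I" and a: "adapted c d d' \<alpha> N" "\<gamma> t \<in> N"
  obtains J where "open J" "t \<in> J" "J \<subseteq> I" "\<And>s. s \<in> J \<Longrightarrow> \<gamma> s \<in> N" "smooth_on J (\<lambda>s. snd c (\<gamma> s))"
    "\<And>s. s \<in> J \<Longrightarrow> velocity M \<gamma> s c = fderiv (\<lambda>s. snd c (\<gamma> s)) s 1"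
    "\<And>s. s \<in> J \<Longrightarrow> \<alpha> (snd c (\<gamma> s)) \<bullet> fderiv (\<lambda>s. snd c (\<gamma> s)) s 1 = 0"
proof -
  note aD = adaptedD[OF a(1)]
  have g': "open I" "smooth_map std_atlas M \<gamma> I" "\<And>s. s \<in> I \<Longrightarrow> velocity M \<gamma> s \<in> \<xi> (\<gamma> s)"
    using g by (auto simp: legendre_curve_def)
  define J where "J = I \<inter> \<gamma> -` N"
  have J: "open J" "t \<in> J" "J \<subseteq> I" "\<And>s. s \<in> J \<Longrightarrow> \<gamma> s \<in> N"
    using continuous_open_preimage[OF smooth_map_continuous_on[OF smooth_manifold_std_atlas M g'(2)] g'(1) aD(4)] t a(2)
    by (auto simp: J_def)
  have "(UNIV, id) \<in> std_atlas" by (simp add: std_chart)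
  from smooth_map_in_charts[OF smooth_manifold_std_atlas M g'(2) this aD(1) J(1)]
  have sm: "smooth_on J (\<lambda>s. snd c (\<gamma> s))" using J aD(5) by auto
  have v: "velocity M \<gamma> s c = fderiv (\<lambda>s. snd c (\<gamma> s)) s 1" if "s \<in> J" for s
    using vector_derivative_unique_at[OF velocity_chart[OF M g'(2) aD(1)] smooth_curve_has_vector_derivative[OF sm that]]
      J(3,4) aD(10) that by blast
  have "\<alpha> (snd c (\<gamma> s)) \<bullet> fderiv (\<lambda>s. snd c (\<gamma> s)) s 1 = 0" if "s \<in> J" for s
    using g'(3)[of s] J(3,4) that aD(8)[of "\<gamma> s"] v[OF that] by auto
  then show thesis using that J sm v by blast
qed

lemma front_immersed_iff:
  assumes g: "legendre_curve \<gamma> I" and t: "t \<in> I" and a: "adapted c d d' \<alpha> N" "\<gamma> t \<in> N"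
  shows "velocity B (\<rho> \<circ> \<gamma>) t \<noteq> (\<lambda>_. 0) \<longleftrightarrow> fderiv (R c d) (snd c (\<gamma> t)) (velocity M \<gamma> t c) \<noteq> 0"
proof -
  note aD = adaptedD[OF a(1)]
  have g': "smooth_map std_atlas M \<gamma> I" using g by (auto simp: legendre_curve_def)
  show ?thesis
    unfolding velocity_composition[OF M B smooth_\<rho> g' t UNIV_I aD(1) aD(10)[OF a(2)]]
    using differential_eq_0_iff[OF M B smooth_\<rho> aD(1) aD(10)[OF a(2)] aD(2) aD(11)[OF a(2)] UNIV_I
        velocity_in_tangent_space[OF M g' t]] by simp
qed

lemma has_contact_in_chart:
  assumes h: "has_contact M B \<rho> k cv t (fibre \<rho>' q) q" and a: "adapted c d d' \<alpha> N" "q \<in> N"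
  obtains W P g w where "open W" "cv t \<in> W" "W \<subseteq> fst d" "open P" "q \<in> P" "P \<subseteq> N"
    "open (snd d ` W)" "R c d (snd c q) \<in> snd d ` W" "smooth_on (snd d ` W) (\<lambda>y. g (chart_inv d y))"
    "fderiv (\<lambda>y. g (chart_inv d y)) (R c d (snd c q)) w \<noteq> (0::real)"
    "\<And>x. x \<in> snd c ` P \<Longrightarrow> R' c d' x = R' c d' (snd c q) \<Longrightarrow> g (chart_inv d (R c d x)) = 0"
    "\<And>j. j < k \<Longrightarrow> (deriv ^^ j) (\<lambda>s. g (cv s)) t = 0"
proof -
  note aD = adaptedD[OF a(1)]
  obtain W N1 g where *: "\<rho> q = cv t" "open W" "cv t \<in> W" "open N1" "q \<in> N1" "smooth_map B std_atlas g W"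
    "nonzero_differential B g (cv t)" "\<And>m. m \<in> N1 \<Longrightarrow> m \<in> fibre \<rho>' q \<Longrightarrow> g (\<rho> m) = 0"
    "\<And>j. j < k \<Longrightarrow> (deriv ^^ j) (g \<circ> cv) t = 0"
    using h unfolding has_contact_def by blast
  define W1 where "W1 = W \<inter> fst d"
  have W1: "open W1" "cv t \<in> W1" "W1 \<subseteq> fst d" "W1 \<subseteq> W"
    using *(2,3) open_chart_domain[OF B aD(2)] aD(11)[OF a(2)] *(1) by (auto simp: W1_def)
  define P where "P = N1 \<inter> N"
  have P: "open P" "q \<in> P" "P \<subseteq> N" "P \<subseteq> N1" using * aD(4) a(2) by (auto simp: P_def)
  have Rq: "R c d (snd c q) = snd d (cv t)" using aD(14)[OF a(2)] *(1) by simp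
  obtain w where w: "fderiv (\<lambda>y. g (chart_inv d y)) (snd d (cv t)) w \<noteq> 0"
    using nonzero_differential_iff[OF B *(6) aD(2) _ *(3)] *(7) W1 by blast
  show thesis
  proof (rule that[OF W1(1-3) P(1-3)])
    show "open (snd d ` W1)" by (rule open_chart_image[OF B aD(2) W1(1,3)])
    show "R c d (snd c q) \<in> snd d ` W1" unfolding Rq using W1 by blast
    show "smooth_on (snd d ` W1) (\<lambda>y. g (chart_inv d y))"
      by (rule smooth_map_real_in_chart[OF B *(6) aD(2) W1(1)]) (use W1 in auto)
    show "fderiv (\<lambda>y. g (chart_inv d y)) (R c d (snd c q)) w \<noteq> 0" unfolding Rq by (rule w)
    show "(deriv ^^ j) (\<lambda>s. g (cv s)) t = 0" if "j < k" for j using *(9)[OF that] by (simp add: comp_def)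
    fix x assume x: "x \<in> snd c ` P" "R' c d' x = R' c d' (snd c q)"
    then obtain m where m: "m \<in> P" "x = snd c m" by blast
    have mN: "m \<in> N" using m P by blast
    have "snd d' (\<rho>' m) = snd d' (\<rho>' q)" using x(2) m(2) aD(14)[OF mN] aD(14)[OF a(2)] by simp
    then have "\<rho>' m = \<rho>' q"
      using chart_inv_chart[OF B' aD(3)] aD(12)[OF mN] aD(12)[OF a(2)] by metis
    then have "g (\<rho> m) = 0" using *(8)[of m] m P by (auto simp: fibre_def)
    then show "g (chart_inv d (R c d x)) = 0"
      using m(2) aD(14)[OF mN] chart_inv_chart[OF B aD(2) aD(11)[OF mN]] by simp
  qed
qed

lemma deriv_cong_on_open:
  assumes "open J" "\<And>s. s \<in> J \<Longrightarrow> f s = (g s :: real)" "t \<in> J"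
  shows "deriv f t = deriv g t"
  by (rule deriv_cong_ev[OF _ refl]) (use assms eventually_nhds in blast)

text \<open>Whatever equation witnesses the contact, its second derivative along the front vanishes
  only if the velocity is in the kernel of the derivative of \<open>R'\<close>.\<close>

lemma inflection_along_imp_kernel:
  assumes g: "legendre_curve \<gamma> I" and t: "t \<in> I" and a: "adapted c d d' \<alpha> N" "\<gamma> t \<in> N"
    and i: "inflection_along M B \<rho> \<rho>' (\<rho> \<circ> \<gamma>) t (\<gamma> t)"
  shows "fderiv (R' c d') (snd c (\<gamma> t)) (velocity M \<gamma> t c) = 0"
proof -
  note aD = adaptedD[OF a(1)]
  interpret L: legendrian_pair "snd c ` N" \<alpha> "R c d" "R' c d'" by (rule aD(9))
  have h: "has_contact M B \<rho> 3 (\<rho> \<circ> \<gamma>) t (fibre \<rho>' (\<gamma> t)) (\<gamma> t)"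
    and imm: "velocity B (\<rho> \<circ> \<gamma>) t \<noteq> (\<lambda>_. 0)"
    using i by (auto simp: inflection_along_def)
  obtain J where J: "open J" "t \<in> J" "J \<subseteq> I" "\<And>s. s \<in> J \<Longrightarrow> \<gamma> s \<in> N" "smooth_on J (\<lambda>s. snd c (\<gamma> s))"
    "\<And>s. s \<in> J \<Longrightarrow> velocity M \<gamma> s c = fderiv (\<lambda>s. snd c (\<gamma> s)) s 1"
    "\<And>s. s \<in> J \<Longrightarrow> \<alpha> (snd c (\<gamma> s)) \<bullet> fderiv (\<lambda>s. snd c (\<gamma> s)) s 1 = 0"
    using legendre_curve_in_chart[OF g t a] by metis
  obtain W P gg w where W: "open W" "(\<rho> \<circ> \<gamma>) t \<in> W" "W \<subseteq> fst d" "open P" "\<gamma> t \<in> P" "P \<subseteq> N"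
    "open (snd d ` W)" "R c d (snd c (\<gamma> t)) \<in> snd d ` W" "smooth_on (snd d ` W) (\<lambda>y. gg (chart_inv d y))"
    "fderiv (\<lambda>y. gg (chart_inv d y)) (R c d (snd c (\<gamma> t))) w \<noteq> (0::real)"
    "\<And>x. x \<in> snd c ` P \<Longrightarrow> R' c d' x = R' c d' (snd c (\<gamma> t)) \<Longrightarrow> gg (chart_inv d (R c d x)) = 0"
    "\<And>j. j < 3 \<Longrightarrow> (deriv ^^ j) (\<lambda>s. gg ((\<rho> \<circ> \<gamma>) s)) t = 0"
    using has_contact_in_chart[OF h a] by metis
  have oP: "open (snd c ` P)" by (rule open_chart_image[OF M aD(1) W(4)]) (use W(6) aD(5) in blast)
  have imm': "fderiv (R c d) (snd c (\<gamma> t)) (fderiv (\<lambda>s. snd c (\<gamma> s)) t 1) \<noteq> 0"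
    using front_immersed_iff[OF g t a] imm J(6)[OF J(2)] by simp
  have e: "gg ((\<rho> \<circ> \<gamma>) s) = gg (chart_inv d (R c d (snd c (\<gamma> s))))" if "s \<in> J" for s
    using aD(14)[OF J(4)[OF that]] chart_inv_chart[OF B aD(2) aD(11)[OF J(4)[OF that]]] by simp
  have "deriv (deriv (\<lambda>s. gg ((\<rho> \<circ> \<gamma>) s))) t = deriv (deriv (\<lambda>s. gg (chart_inv d (R c d (snd c (\<gamma> s)))))) t"
    by (rule deriv_cong_on_open[OF J(1) deriv_cong_on_open[OF J(1) e] J(2)])
  \<comment> \<open>3-point contact covers the orders 0, 1 and 2; the last one carries the
    information.\<close>
  moreover have "deriv (deriv (\<lambda>s. gg ((\<rho> \<circ> \<gamma>) s))) t = 0"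
    using W(12)[of 2] by (simp add: numeral_2_eq_2)
  moreover have "deriv (deriv (\<lambda>s. gg (chart_inv d (R c d (snd c (\<gamma> s)))))) t = 0 \<longleftrightarrow>
      fderiv (R' c d') (snd c (\<gamma> t)) (fderiv (\<lambda>s. snd c (\<gamma> s)) t 1) = 0"
    by (rule L.front_contact_iff(2)[where g="\<lambda>y. gg (chart_inv d y)" and N="snd c ` P" and I=J and \<gamma>="\<lambda>s. snd c (\<gamma> s)",
        OF aD(13)[OF a(2)] W(7-10) oP _ W(11) J(1,2,5) refl _ J(7) imm'])
      (use W(5) J(4) in auto)
  ultimately show ?thesis using J(6)[OF J(2)] by simp
qed

text \<open>The front is immersed by transversality: a nonzero velocity in the kernel for
  \<open>R'\<close> is not in the kernel for \<open>R\<close>. The equation witnessing the contact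
  is the one from \<open>fibre_image_local_equation\<close>, pulled back to
  \<open>B\<close>.\<close>

lemma kernel_imp_inflection_along:
  assumes g: "legendre_curve \<gamma> I" and t: "t \<in> I" and a: "adapted c d d' \<alpha> N" "\<gamma> t \<in> N"
    and v0: "velocity M \<gamma> t \<noteq> (\<lambda>_. 0)"
    and k: "fderiv (R' c d') (snd c (\<gamma> t)) (velocity M \<gamma> t c) = 0"
  shows "inflection_along M B \<rho> \<rho>' (\<rho> \<circ> \<gamma>) t (\<gamma> t)"
proof -
  note aD = adaptedD[OF a(1)]
  interpret L: legendrian_pair "snd c ` N" \<alpha> "R c d" "R' c d'" by (rule aD(9))
  have g': "smooth_map std_atlas M \<gamma> I" using g by (auto simp: legendre_curve_def)
  obtain J where J: "open J" "t \<in> J" "J \<subseteq> I" "\<And>s. s \<in> J \<Longrightarrow> \<gamma> s \<in> N" "smooth_on J (\<lambda>s. snd c (\<gamma> s))"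
    "\<And>s. s \<in> J \<Longrightarrow> velocity M \<gamma> s c = fderiv (\<lambda>s. snd c (\<gamma> s)) s 1"
    "\<And>s. s \<in> J \<Longrightarrow> \<alpha> (snd c (\<gamma> s)) \<bullet> fderiv (\<lambda>s. snd c (\<gamma> s)) s 1 = 0"
    using legendre_curve_in_chart[OF g t a] by metis
  have x0: "snd c (\<gamma> t) \<in> snd c ` N" by (rule aD(13)[OF a(2)])
  have "velocity M \<gamma> t c \<noteq> 0"
    using tangent_vector_eq_0_iff[OF M velocity_in_tangent_space[OF M g' t] aD(1) aD(10)[OF a(2)]] v0 by simp
  then have immR: "fderiv (R c d) (snd c (\<gamma> t)) (velocity M \<gamma> t c) \<noteq> 0"
    using L.transverse[OF x0 _ k] by blast
  then have imm: "velocity B (\<rho> \<circ> \<gamma>) t \<noteq> (\<lambda>_. 0)" using front_immersed_iff[OF g t a] by simp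
  have imm': "fderiv (R c d) (snd c (\<gamma> t)) (fderiv (\<lambda>s. snd c (\<gamma> s)) t 1) \<noteq> 0"
    using immR J(6)[OF J(2)] by simp
  obtain W P gg w where W: "open W" "R c d (snd c (\<gamma> t)) \<in> W" "open P" "snd c (\<gamma> t) \<in> P" "P \<subseteq> snd c ` N"
    "smooth_on W gg" "fderiv gg (R c d (snd c (\<gamma> t))) w \<noteq> (0::real)"
    "\<And>x. x \<in> P \<Longrightarrow> R' c d' x = R' c d' (snd c (\<gamma> t)) \<Longrightarrow> gg (R c d x) = 0"
    using L.fibre_image_local_equation[OF x0] by metis
  define W1 where "W1 = fst d \<inter> snd d -` W"
  have b: "\<rho> (\<gamma> t) \<in> W1" using W(2) aD(14)[OF a(2)] aD(11)[OF a(2)] by (simp add: W1_def)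
  have oW1: "open W1" unfolding W1_def
    by (rule continuous_open_preimage[OF continuous_on_chart[OF B aD(2)] open_chart_domain[OF B aD(2)] W(1)])
  have W1d: "W1 \<subseteq> fst d" by (auto simp: W1_def)
  have oW1': "open (snd d ` W1)" by (rule open_chart_image[OF B aD(2) oW1 W1d])
  define G where "G b = gg (snd d b)" for b
  have Gd: "G (chart_inv d y) = gg y" if "y \<in> snd d ` W1" for y
    using that chart_inv_chart[OF B aD(2)] W1d by (auto simp: G_def)
  have smgg: "smooth_on (snd d ` W1) gg" by (rule smooth_on_subset[OF W(6)]) (auto simp: W1_def)
  have "smooth_on (snd d ` W1) (\<lambda>y. G (chart_inv d y))"
    by (rule smooth_on_cong[OF oW1' _ smgg]) (simp add: Gd)
  then have smG: "smooth_map B std_atlas G W1"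
    unfolding smooth_map_def
    using aD(2) oW1 W1d
    by (intro ballI bexI[of _ d] bexI[of _ "(UNIV, id)"] exI[of _ W1]) (auto simp: std_chart comp_def)
  have y0: "snd d (\<rho> (\<gamma> t)) \<in> snd d ` W1" using b by blast
  have Rt: "R c d (snd c (\<gamma> t)) = snd d (\<rho> (\<gamma> t))" using aD(14)[OF a(2)] by simp
  have "((\<lambda>y. G (chart_inv d y)) has_derivative fderiv gg (snd d (\<rho> (\<gamma> t)))) (at (snd d (\<rho> (\<gamma> t))))"
    by (rule has_derivative_transform_within_open[OF smooth_on_has_fderiv[OF smgg y0] oW1' y0]) (simp add: Gd)
  then have "fderiv (\<lambda>y. G (chart_inv d y)) (snd d (\<rho> (\<gamma> t))) w \<noteq> 0"
    using W(7) unfolding Rt by (simp add: fderiv_eq)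
  then have nz: "nonzero_differential B G (\<rho> (\<gamma> t))"
    using nonzero_differential_iff[OF B smG aD(2) aD(11)[OF a(2)] b] by blast
  define P1 where "P1 = N \<inter> snd c -` P"
  have "open (fst c \<inter> snd c -` P)"
    by (rule continuous_open_preimage[OF continuous_on_chart[OF M aD(1)] open_chart_domain[OF M aD(1)] W(3)])
  then have "open (N \<inter> (fst c \<inter> snd c -` P))" using aD(4) by blast
  moreover have "N \<inter> (fst c \<inter> snd c -` P) = P1" using aD(5) by (auto simp: P1_def)
  ultimately have oP1: "open P1" by simp
  have zero: "G (\<rho> m) = 0" if "m \<in> P1 \<inter> fibre \<rho>' (\<gamma> t)" for m
  proof -
    have m: "m \<in> N" "snd c m \<in> P" "\<rho>' m = \<rho>' (\<gamma> t)" using that by (auto simp: P1_def fibre_def)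
    then show ?thesis using W(8)[of "snd c m"] aD(14)[OF m(1)] aD(14)[OF a(2)] by (simp add: G_def)
  qed
  have e: "(G \<circ> (\<rho> \<circ> \<gamma>)) s = gg (R c d (snd c (\<gamma> s)))" if "s \<in> J" for s
    using aD(14)[OF J(4)[OF that]] by (simp add: G_def)
  note fc = L.front_contact_iff[where I=J and \<gamma>="\<lambda>s. snd c (\<gamma> s)" and N=P and g=gg,
      OF x0 W(1,2,6,7,3,4) W(8) J(1,2,5) refl aD(13)[OF J(4)] J(7) imm']
  have 1: "deriv (G \<circ> (\<rho> \<circ> \<gamma>)) t = 0"
    by (rule trans[OF deriv_cong_on_open[OF J(1) e J(2)] fc(1)])
  have "deriv (deriv (G \<circ> (\<rho> \<circ> \<gamma>))) t = deriv (deriv (\<lambda>s. gg (R c d (snd c (\<gamma> s))))) t"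
    by (rule deriv_cong_on_open[OF J(1) deriv_cong_on_open[OF J(1) e] J(2)])
  then have 2: "deriv (deriv (G \<circ> (\<rho> \<circ> \<gamma>))) t = 0"
    using fc(2) k J(6)[OF J(2)] by simp
  have t1: "\<gamma> t \<in> P1" using a(2) W(4) by (simp add: P1_def)
  have 0: "(G \<circ> (\<rho> \<circ> \<gamma>)) t = 0" using zero[of "\<gamma> t"] t1 by (simp add: fibre_def)
  have "(deriv ^^ j) (G \<circ> (\<rho> \<circ> \<gamma>)) t = 0" if "j < 3" for j
  proof -
    have "j = 0 \<or> j = 1 \<or> j = 2" using that by auto
    then show ?thesis using 0 1 2 by (auto simp: numeral_2_eq_2)
  qed
  then have "has_contact M B \<rho> 3 (\<rho> \<circ> \<gamma>) t (fibre \<rho>' (\<gamma> t)) (\<gamma> t)"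
    unfolding has_contact_def
    using oW1 b oP1 t1 smG nz zero
    by (intro conjI exI[of _ W1] exI[of _ P1] exI[of _ G]) (auto simp: fibre_def)
  then show ?thesis using imm by (simp add: inflection_along_def)
qed

text \<open>Describes the contact element by a linear form in a chart of \<open>B\<close>, so that
  elements computed in different charts of \<open>M\<close> can be compared.\<close>

lemma contact_element_eq_kernel:
  assumes a: "adapted c d d' \<alpha> N" "q \<in> N" and l: "linear \<omega>" "\<omega> w0 \<noteq> (0::real)"
    and v: "\<alpha> (snd c q) \<bullet> v = 0" "fderiv (R c d) (snd c q) v \<noteq> 0" "\<omega> (fderiv (R c d) (snd c q) v) = 0"
  shows "differential M B \<rho> q ` \<xi> q = {w \<in> tangent_space B (\<rho> q). \<omega> (w d) = 0}"
proof -
  note aD = adaptedD[OF a(1)]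
  interpret L: legendrian_pair "snd c ` N" \<alpha> "R c d" "R' c d'" by (rule aD(9))
  show ?thesis
    unfolding aD(8)[OF a(2)]
    using differential_image_eq_iff[OF M B smooth_\<rho> aD(1) aD(10)[OF a(2)] aD(2) aD(11)[OF a(2)] UNIV_I,
        of "{u. \<alpha> (snd c q) \<bullet> u = 0}" "{w. \<omega> w = 0}"]
      L.image_contact_plane_R[OF aD(13)[OF a(2)] l v] by simp
qed

text \<open>Let \<open>\<omega>\<close> be the differential of the line's equation at the common
  base point. It annihilates the tangent of the branch at \<open>q\<close>, because the equation
  vanishes on that branch, and the velocity of the front, by first order contact. So both contact
  elements are the kernel of \<open>\<omega>\<close>.\<close>

lemma inflection_along_unique:
  assumes g: "legendre_curve \<gamma> I" and t: "t \<in> I"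
    and i: "inflection_along M B \<rho> \<rho>' (\<rho> \<circ> \<gamma>) t q" and inj: "distinct_contact_elements M \<xi> B \<rho>"
  shows "q = \<gamma> t"
proof -
  have h: "has_contact M B \<rho> 3 (\<rho> \<circ> \<gamma>) t (fibre \<rho>' q) q"
    and imm: "velocity B (\<rho> \<circ> \<gamma>) t \<noteq> (\<lambda>_. 0)"
    using i by (auto simp: inflection_along_def)
  have g': "smooth_map std_atlas M \<gamma> I" using g by (auto simp: legendre_curve_def)
  have \<rho>q: "\<rho> q = \<rho> (\<gamma> t)" using h by (simp add: has_contact_def)
  obtain d where d: "d \<in> B" "\<rho> q \<in> fst d" using chart_at[OF B] .
  obtain c d' \<alpha> N where a: "adapted c d d' \<alpha> N" "q \<in> N"
    using adapted_exists[OF open_UNIV UNIV_I d] by metis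
  obtain c2 d2' \<alpha>2 N2 where a2: "adapted c2 d d2' \<alpha>2 N2" "\<gamma> t \<in> N2"
    using adapted_exists[OF open_UNIV UNIV_I d(1) d(2)[unfolded \<rho>q]] by metis
  note aD = adaptedD[OF a(1)] and aD2 = adaptedD[OF a2(1)]
  interpret L: legendrian_pair "snd c ` N" \<alpha> "R c d" "R' c d'" by (rule aD(9))
  obtain W P gg w where W: "open W" "(\<rho> \<circ> \<gamma>) t \<in> W" "W \<subseteq> fst d" "open P" "q \<in> P" "P \<subseteq> N"
    "open (snd d ` W)" "R c d (snd c q) \<in> snd d ` W" "smooth_on (snd d ` W) (\<lambda>y. gg (chart_inv d y))"
    "fderiv (\<lambda>y. gg (chart_inv d y)) (R c d (snd c q)) w \<noteq> (0::real)"
    "\<And>x. x \<in> snd c ` P \<Longrightarrow> R' c d' x = R' c d' (snd c q) \<Longrightarrow> gg (chart_inv d (R c d x)) = 0"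
    "\<And>j. j < 3 \<Longrightarrow> (deriv ^^ j) (\<lambda>s. gg ((\<rho> \<circ> \<gamma>) s)) t = 0"
    using has_contact_in_chart[OF h a] by metis
  have oP: "open (snd c ` P)" by (rule open_chart_image[OF M aD(1) W(4)]) (use W(6) aD(5) in blast)
  define \<omega> where "\<omega> = fderiv (\<lambda>y. gg (chart_inv d y)) (snd d (\<rho> q))"
  have Rq: "R c d (snd c q) = snd d (\<rho> q)" using aD(14)[OF a(2)] by simp
  have Rt: "R c2 d (snd c2 (\<gamma> t)) = snd d (\<rho> q)" using aD2(14)[OF a2(2)] \<rho>q by simp
  have y0: "snd d (\<rho> q) \<in> snd d ` W" using W(8) Rq by simp
  have \<omega>: "linear \<omega>" "\<omega> w \<noteq> 0"
    using smooth_on_linear_fderiv[OF W(9) y0] W(10) Rq by (auto simp: \<omega>_def)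
  have "\<omega> (fderiv (R c d) (snd c q) (L.E' (snd c q))) = 0"
    unfolding \<omega>_def Rq[symmetric]
    by (rule L.fibre_image_equation_tangent[OF aD(13)[OF a(2)] W(7,8,9) oP _ W(11)]) (use W(5) in auto)
  then have 1: "differential M B \<rho> q ` \<xi> q = {w \<in> tangent_space B (\<rho> q). \<omega> (w d) = 0}"
    using contact_element_eq_kernel[OF a \<omega> L.\<alpha>_E'[OF aD(13)[OF a(2)]] L.R_E'_nonzero[OF aD(13)[OF a(2)]]] by blast
  have \<alpha>v: "\<alpha>2 (snd c2 (\<gamma> t)) \<bullet> velocity M \<gamma> t c2 = 0"
    using g t aD2(8)[OF a2(2)] by (auto simp: legendre_curve_def)
  have "((\<lambda>s. snd d (\<rho> (\<gamma> s))) has_vector_derivative fderiv (R c2 d) (snd c2 (\<gamma> t)) (velocity M \<gamma> t c2)) (at t)"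
    by (rule velocity_image[OF M B smooth_\<rho> g' t UNIV_I aD2(1) aD2(10)[OF a2(2)] d(1)]) (use d(2) \<rho>q in simp)
  then have "((\<lambda>s. gg (chart_inv d (snd d (\<rho> (\<gamma> s))))) has_vector_derivative
      \<omega> (fderiv (R c2 d) (snd c2 (\<gamma> t)) (velocity M \<gamma> t c2))) (at t)"
    by (rule curve_chain_rule) (use smooth_on_has_fderiv[OF W(9) y0] \<rho>q in \<open>simp add: \<omega>_def\<close>)
  moreover obtain J where J: "open J" "t \<in> J" "\<And>s. s \<in> J \<Longrightarrow> \<gamma> s \<in> N2"
    using legendre_curve_in_chart[OF g t a2] by metis
  ultimately have "((\<lambda>s. gg ((\<rho> \<circ> \<gamma>) s)) has_vector_derivative
      \<omega> (fderiv (R c2 d) (snd c2 (\<gamma> t)) (velocity M \<gamma> t c2))) (at t)"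
    using has_vector_derivative_transform_within_open[OF _ J(1,2)] chart_inv_chart[OF B d(1)] aD2(11)[OF J(3)]
    by (metis (no_types, lifting) comp_apply)
  then have "\<omega> (fderiv (R c2 d) (snd c2 (\<gamma> t)) (velocity M \<gamma> t c2)) = deriv (\<lambda>s. gg ((\<rho> \<circ> \<gamma>) s)) t"
    by (simp add: DERIV_imp_deriv has_real_derivative_iff_has_vector_derivative)
  also have "\<dots> = 0" using W(12)[of 1] by simp
  finally have "\<omega> (fderiv (R c2 d) (snd c2 (\<gamma> t)) (velocity M \<gamma> t c2)) = 0" .
  then have 2: "differential M B \<rho> (\<gamma> t) ` \<xi> (\<gamma> t) = {w \<in> tangent_space B (\<rho> (\<gamma> t)). \<omega> (w d) = 0}"
    using contact_element_eq_kernel[OF a2 \<omega> \<alpha>v] front_immersed_iff[OF g t a2] imm by blast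
  have "\<rho> q = \<rho> (\<gamma> t) \<and> differential M B \<rho> q ` \<xi> q = differential M B \<rho> (\<gamma> t) ` \<xi> (\<gamma> t)"
    using \<rho>q unfolding 1 2 by simp
  then show ?thesis by (rule inj[unfolded distinct_contact_elements_def, rule_format])
qed

section \<open>Characteristics of a surface\<close>

text \<open>The tangent plane is given at all nearby points with nonzero gradient because
  \<open>characteristic_through\<close> needs it along a whole curve.\<close>

lemma surface_chart:
  assumes V: "smooth_surface M V" and p: "p \<in> V"
  obtains c d d' \<alpha> N F where "adapted c d d' \<alpha> N" "p \<in> N" "smooth_on (snd c ` N) F"
    "gradient F (snd c p) \<noteq> 0" "\<And>q. q \<in> N \<Longrightarrow> q \<in> V \<longleftrightarrow> F (snd c q) = 0"
    "\<And>q. q \<in> N \<Longrightarrow> q \<in> V \<Longrightarrow> gradient F (snd c q) \<noteq> 0 \<Longrightarrow>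
      tangent_to M V q = {v \<in> tangent_space M q. gradient F (snd c q) \<bullet> v c = 0}"
proof -
  obtain N0 f where f: "open N0" "p \<in> N0" "smooth_map M std_atlas f N0" "nonzero_differential M f p"
    "V \<inter> N0 = {q \<in> N0. f q = (0::real)}"
    using V p unfolding smooth_surface_def by metis
  obtain d where d: "d \<in> B" "\<rho> p \<in> fst d" using chart_at[OF B] .
  obtain c d' \<alpha> N where a: "adapted c d d' \<alpha> N" "p \<in> N" "N \<subseteq> N0"
    using adapted_exists[OF f(1,2) d] by metis
  note aD = adaptedD[OF a(1)]
  define F where "F x = f (chart_inv c x)" for x
  have smF: "smooth_on (snd c ` N) F"
    unfolding F_def by (rule smooth_map_real_in_chart[OF M f(3) aD(1,4)]) (use a(3) aD(5) in auto)
  have F: "F (snd c q) = f q" if "q \<in> N" for q using aD(14)[OF that] by (simp add: F_def)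
  have V_iff: "q \<in> V \<longleftrightarrow> F (snd c q) = 0" if "q \<in> N" for q
    using f(5) that a(3) unfolding F[OF that] by blast
  have fd: "fderiv F (snd c q) w = gradient F (snd c q) \<bullet> w" if "q \<in> N" for q w
    by (rule fderiv_eq_gradient[OF smF aD(13)[OF that]])
  obtain w where "fderiv F (snd c p) w \<noteq> 0"
    using nonzero_differential_iff[OF M f(3) aD(1) aD(10)[OF a(2)] f(2)] f(4) unfolding F_def[abs_def] by blast
  then have grad: "gradient F (snd c p) \<noteq> 0" using fd[OF a(2)] by auto
  have "tangent_to M V q = {v \<in> tangent_space M q. gradient F (snd c q) \<bullet> v c = 0}"
    if q: "q \<in> N" "q \<in> V" and g: "gradient F (snd c q) \<noteq> 0" for q
  proof -
    have std: "(UNIV, id) \<in> std_atlas" "f q \<in> fst (UNIV, id)" by (simp_all add: std_chart)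
    let ?g = "gradient F (snd c q)"
    \<comment> \<open>A multiple of the gradient attains any prescribed value, so the real-valued
      derivative is onto.\<close>
    have "fderiv F (snd c q) ((y / (?g \<bullet> ?g)) *\<^sub>R ?g) = y" for y
      using g fd[OF q(1)] by simp
    then have surj: "surj (fderiv F (snd c q))" by (rule surjI)
    have "V \<inter> N = {q' \<in> N. f q' = f q}"
      using V_iff F q by auto
    from tangent_to_level_set[OF M smooth_manifold_std_atlas smooth_map_subset[OF M smooth_manifold_std_atlas f(3) aD(4) a(3)]
        q(1) this aD(1) aD(10)[OF q(1)] std]
    show ?thesis using surj fd[OF q(1)] by (simp add: F_def[abs_def])
  qed
  then show thesis using that[OF a(1,2) smF grad V_iff] by blast
qed

lemma surface_normal:
  assumes V: "smooth_surface M V" and p: "p \<in> V"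
  obtains c d d' \<alpha> N \<nu> where "adapted c d d' \<alpha> N" "p \<in> N" "\<nu> \<noteq> 0"
    "tangent_to M V p = {v \<in> tangent_space M p. \<nu> \<bullet> v c = 0}"
proof (rule surface_chart[OF assms])
  fix c d d' \<alpha> N F
  assume "adapted c d d' \<alpha> N" "p \<in> N" "gradient F (snd c p) \<noteq> 0"
    and "\<And>q. q \<in> N \<Longrightarrow> q \<in> V \<Longrightarrow> gradient F (snd c q) \<noteq> 0 \<Longrightarrow>
      tangent_to M V q = {v \<in> tangent_space M q. gradient F (snd c q) \<bullet> v c = 0}"
  then show thesis using that[of c d d' \<alpha> N "gradient F (snd c p)"] p by simp
qed

text \<open>Two planes through the origin coincide exactly when their normals are parallel.\<close>

lemma characteristic_point_iff:
  assumes a: "adapted c d d' \<alpha> N" "q \<in> N" and q: "q \<in> V" and n: "\<nu> \<noteq> 0"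
    and T: "tangent_to M V q = {v \<in> tangent_space M q. \<nu> \<bullet> v c = 0}"
  shows "q \<in> characteristic_points M \<xi> V \<longleftrightarrow> cross3 \<nu> (\<alpha> (snd c q)) = 0"
proof -
  note aD = adaptedD[OF a(1)]
  interpret L: legendrian_pair "snd c ` N" \<alpha> "R c d" "R' c d'" by (rule aD(9))
  have \<alpha>0: "\<alpha> (snd c q) \<noteq> 0" by (rule L.\<alpha>_nonzero[OF aD(13)[OF a(2)]])
  have "cross3 \<nu> (\<alpha> (snd c q)) = 0" if eq: "tangent_to M V q = \<xi> q"
  proof (rule ccontr)
    assume "cross3 \<nu> (\<alpha> (snd c q)) \<noteq> 0"
    then obtain w where w: "\<alpha> (snd c q) \<bullet> w = 0" "\<nu> \<bullet> w \<noteq> 0" by (rule kernel_not_contained_if_cross_nonzero)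
    have "tvec_of M c q w \<in> tangent_space M q" "tvec_of M c q w c = w"
      using tvec_of_in_tangent_space[OF M aD(1) aD(10)[OF a(2)]] tvec_of_chart[OF M aD(1) aD(10)[OF a(2)]] by auto
    then have "tvec_of M c q w \<in> \<xi> q" "tvec_of M c q w \<notin> tangent_to M V q"
      unfolding T aD(8)[OF a(2)] using w by auto
    then show False using eq by simp
  qed
  moreover have "tangent_to M V q = \<xi> q" if z: "cross3 \<nu> (\<alpha> (snd c q)) = 0"
  proof -
    obtain k where k: "\<nu> = k *\<^sub>R \<alpha> (snd c q)" using cross_eq_0_imp_multiple[OF \<alpha>0 z] .
    then have "k \<noteq> 0" using n by auto
    then show ?thesis unfolding T aD(8)[OF a(2)] by (simp add: k)
  qed
  ultimately show ?thesis using q by (auto simp: characteristic_points_def)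
qed

lemma contour_iff:
  assumes a: "adapted c d d' \<alpha> N" "q \<in> N" and q: "q \<in> V" and n: "\<nu> \<noteq> 0"
    and T: "tangent_to M V q = {v \<in> tangent_space M q. \<nu> \<bullet> v c = 0}"
  shows "q \<in> contour M B' \<rho>' V \<longleftrightarrow> \<nu> \<bullet> kernel_field (R' c d') (snd c q) = 0"
proof -
  note aD = adaptedD[OF a(1)]
  interpret L: legendrian_pair "snd c ` N" \<alpha> "R c d" "R' c d'" by (rule aD(9))
  show ?thesis
    using differential_image_eq_iff[OF M B' smooth_\<rho>' aD(1) aD(10)[OF a(2)] aD(3) aD(12)[OF a(2)] UNIV_I,
        of "{u. \<nu> \<bullet> u = 0}" UNIV] L.image_plane_R'[OF aD(13)[OF a(2)] n] q
    by (simp add: contour_def T)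
qed

text \<open>At a characteristic point the tangent plane is the contact plane, which contains the
  tangent of the \<open>\<rho>'\<close>-fibre.\<close>

lemma characteristic_points_subset_contour:
  assumes V: "smooth_surface M V"
  shows "characteristic_points M \<xi> V \<subseteq> contour M B' \<rho>' V"
proof
  fix p assume p: "p \<in> characteristic_points M \<xi> V"
  then have pV: "p \<in> V" by (simp add: characteristic_points_def)
  obtain c d d' \<alpha> N \<nu> where S: "adapted c d d' \<alpha> N" "p \<in> N" "\<nu> \<noteq> 0"
    "tangent_to M V p = {v \<in> tangent_space M p. \<nu> \<bullet> v c = 0}"
    by (rule surface_normal[OF V pV])
  note aD = adaptedD[OF S(1)]
  interpret L: legendrian_pair "snd c ` N" \<alpha> "R c d" "R' c d'" by (rule aD(9))
  have x: "snd c p \<in> snd c ` N" by (rule aD(13)[OF S(2)])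
  have "cross3 \<nu> (\<alpha> (snd c p)) = 0"
    using characteristic_point_iff[OF S(1,2) pV S(3,4)] p by simp
  then obtain k where "\<nu> = k *\<^sub>R \<alpha> (snd c p)"
    using cross_eq_0_imp_multiple[OF L.\<alpha>_nonzero[OF x]] by blast
  then have "\<nu> \<bullet> L.E' (snd c p) = 0" using L.\<alpha>_E'[OF x] by simp
  then show "p \<in> contour M B' \<rho>' V" using contour_iff[OF S(1,2) pV S(3,4)] by simp
qed

lemma characteristic_legendre_curve:
  "characteristic M \<xi> V \<gamma> I \<Longrightarrow> legendre_curve \<gamma> I"
  by (auto simp: characteristic_def legendre_curve_def characteristic_line_def)

text \<open>Inflection means that the velocity is tangent to the \<open>\<rho>'\<close>-fibre. Away
  from characteristic points the velocity spans the intersection of the tangent and contact planes,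
  so this happens exactly when the tangent plane contains the fibre direction.\<close>

lemma inflection_along_characteristic_iff:
  assumes V: "smooth_surface M V" and g: "characteristic M \<xi> V \<gamma> I" and t: "t \<in> I"
  shows "inflection_along M B \<rho> \<rho>' (\<rho> \<circ> \<gamma>) t (\<gamma> t) \<longleftrightarrow> \<gamma> t \<in> contour M B' \<rho>' V"
proof -
  note l = characteristic_legendre_curve[OF g]
  have g': "smooth_map std_atlas M \<gamma> I" "\<gamma> t \<in> V" "\<gamma> t \<notin> characteristic_points M \<xi> V" "velocity M \<gamma> t \<noteq> (\<lambda>_. 0)"
    "velocity M \<gamma> t \<in> tangent_to M V (\<gamma> t)" "velocity M \<gamma> t \<in> \<xi> (\<gamma> t)"
    using g t by (auto simp: characteristic_def characteristic_line_def)
  obtain c d d' \<alpha> N \<nu> where S: "adapted c d d' \<alpha> N" "\<gamma> t \<in> N" "\<nu> \<noteq> 0"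
    "tangent_to M V (\<gamma> t) = {v \<in> tangent_space M (\<gamma> t). \<nu> \<bullet> v c = 0}"
    by (rule surface_normal[OF V g'(2)])
  note aD = adaptedD[OF S(1)]
  interpret L: legendrian_pair "snd c ` N" \<alpha> "R c d" "R' c d'" by (rule aD(9))
  have x: "snd c (\<gamma> t) \<in> snd c ` N" by (rule aD(13)[OF S(2)])
  have cr: "cross3 \<nu> (\<alpha> (snd c (\<gamma> t))) \<noteq> 0"
    using characteristic_point_iff[OF S(1,2) g'(2) S(3,4)] g'(3) by simp
  have "velocity M \<gamma> t c \<noteq> 0"
    using tangent_vector_eq_0_iff[OF M velocity_in_tangent_space[OF M g'(1) t] aD(1) aD(10)[OF S(2)]] g'(4) by simp
  moreover have "\<nu> \<bullet> velocity M \<gamma> t c = 0" "\<alpha> (snd c (\<gamma> t)) \<bullet> velocity M \<gamma> t c = 0"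
    using g'(5,6) unfolding S(4) aD(8)[OF S(2)] by auto
  ultimately have "fderiv (R' c d') (snd c (\<gamma> t)) (velocity M \<gamma> t c) = 0 \<longleftrightarrow>
      \<nu> \<bullet> L.E' (snd c (\<gamma> t)) = 0"
    by (rule L.characteristic_direction_in_kernel_iff[OF x cr])
  then show ?thesis
    using contour_iff[OF S(1,2) g'(2) S(3,4)] inflection_along_imp_kernel[OF l t S(1,2)]
      kernel_imp_inflection_along[OF l t S(1,2) g'(4)] by blast
qed

lemma characteristic_through:
  assumes V: "smooth_surface M V" and p: "p \<in> V" "p \<notin> characteristic_points M \<xi> V"
  obtains \<gamma> I t where "characteristic M \<xi> V \<gamma> I" "t \<in> I" "\<gamma> t = p"
proof (rule surface_chart[OF V p(1)])
  fix c d d' \<alpha> N F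
  assume S: "adapted c d d' \<alpha> N" "p \<in> N" "smooth_on (snd c ` N) F"
    "gradient F (snd c p) \<noteq> 0" and VF: "\<And>q. q \<in> N \<Longrightarrow> q \<in> V \<longleftrightarrow> F (snd c q) = 0"
    and T: "\<And>q. q \<in> N \<Longrightarrow> q \<in> V \<Longrightarrow> gradient F (snd c q) \<noteq> 0 \<Longrightarrow>
      tangent_to M V q = {v \<in> tangent_space M q. gradient F (snd c q) \<bullet> v c = 0}"
  note aD = adaptedD[OF S(1)]
  interpret L: legendrian_pair "snd c ` N" \<alpha> "R c d" "R' c d'" by (rule aD(9))
  have "cross3 (gradient F (snd c p)) (\<alpha> (snd c p)) \<noteq> 0"
    using characteristic_point_iff[OF S(1,2) p(1) S(4) T[OF S(2) p(1) S(4)]] p(2) by simp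
  then show thesis
  proof (rule L.characteristic_curve_exists[OF aD(13)[OF S(2)] S(3)])
    fix \<sigma> :: "real \<Rightarrow> real^3" and \<epsilon>
    assume s: "\<epsilon> > 0" "smooth_on {-\<epsilon><..<\<epsilon>} \<sigma>" "\<sigma> 0 = snd c p"
      "\<And>t. t \<in> {-\<epsilon><..<\<epsilon>} \<Longrightarrow> \<sigma> t \<in> snd c ` N"
      "\<And>t. t \<in> {-\<epsilon><..<\<epsilon>} \<Longrightarrow> F (\<sigma> t) = F (snd c p)"
      "\<And>t. t \<in> {-\<epsilon><..<\<epsilon>} \<Longrightarrow> cross3 (gradient F (\<sigma> t)) (\<alpha> (\<sigma> t)) \<noteq> 0"
      "\<And>t. t \<in> {-\<epsilon><..<\<epsilon>} \<Longrightarrow> fderiv \<sigma> t 1 = cross3 (gradient F (\<sigma> t)) (\<alpha> (\<sigma> t))"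
    define \<gamma> where "\<gamma> t = chart_inv c (\<sigma> t)" for t
    let ?I = "{-\<epsilon><..<\<epsilon>}"
    have c\<gamma>: "snd c (\<gamma> t) = \<sigma> t" "\<gamma> t \<in> N" if t: "t \<in> ?I" for t
    proof -
      obtain q where "q \<in> N" "\<sigma> t = snd c q" using s(4)[OF t] by blast
      then show "snd c (\<gamma> t) = \<sigma> t" "\<gamma> t \<in> N" using aD(14) by (auto simp: \<gamma>_def)
    qed
    have sm: "smooth_map std_atlas M \<gamma> ?I"
      unfolding \<gamma>_def[abs_def]
      by (rule smooth_curve_from_chart[OF M aD(1) open_greaterThanLessThan s(2)]) (use s(4) aD(5) in blast)
    have "characteristic M \<xi> V \<gamma> ?I"
      unfolding characteristic_def
    proof (intro conjI ballI)
      show "connected ?I" by simp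
      fix t assume t: "t \<in> ?I"
      let ?\<nu> = "gradient F (\<sigma> t)" and ?a = "\<alpha> (\<sigma> t)"
      have tN: "\<gamma> t \<in> N" and ct: "snd c (\<gamma> t) = \<sigma> t" using c\<gamma>[OF t] by auto
      have tV: "\<gamma> t \<in> V" using VF[OF tN] VF[OF S(2)] p(1) s(5)[OF t] ct by simp
      \<comment> \<open>The gradient is nonzero along the whole curve because its cross product with
        \<open>\<alpha>\<close> is.\<close>
      have \<nu>0: "gradient F (snd c (\<gamma> t)) \<noteq> 0" using s(6)[OF t] ct by auto
      note Tt = T[OF tN tV \<nu>0]
      show "\<gamma> t \<in> V - characteristic_points M \<xi> V"
        using tV characteristic_point_iff[OF S(1) tN tV \<nu>0 Tt] s(6)[OF t] ct by simp
      have "((\<lambda>s. snd c (\<gamma> s)) has_vector_derivative cross3 ?\<nu> ?a) (at t)"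
        by (rule has_vector_derivative_transform_within_open[OF _ open_greaterThanLessThan t])
          (use smooth_curve_has_vector_derivative[OF s(2) t] s(7)[OF t] c\<gamma>(1) in simp_all)
      then have v: "velocity M \<gamma> t c = cross3 ?\<nu> ?a"
        using vector_derivative_unique_at velocity_chart[OF M sm aD(1) aD(10)[OF tN] t] by metis
      have vT: "velocity M \<gamma> t \<in> tangent_space M (\<gamma> t)" by (rule velocity_in_tangent_space[OF M sm t])
      show "velocity M \<gamma> t \<noteq> (\<lambda>_. 0)"
        using tangent_vector_eq_0_iff[OF M vT aD(1) aD(10)[OF tN]] v s(6)[OF t] by simp
      show "velocity M \<gamma> t \<in> characteristic_line M \<xi> V (\<gamma> t)"
        unfolding characteristic_line_def Tt aD(8)[OF tN] using vT v ct by (simp add: dot_cross_self)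
    qed (use sm in auto)
    moreover have "0 \<in> ?I" using s(1) by simp
    moreover have "\<gamma> 0 = p" using s(3) aD(14)[OF S(2)] by (simp add: \<gamma>_def)
    ultimately show thesis by (rule that)
  qed
qed

text \<open>One inclusion reads the criterion along a given characteristic; the other needs a
  characteristic through each point of the contour that is not characteristic.\<close>

lemma lifted_front_inflections_eq:
  assumes V: "smooth_surface M V"
  shows "lifted_front_inflections M \<xi> B \<rho> \<rho>' V = \<rho> ` (contour M B' \<rho>' V - characteristic_points M \<xi> V)"
proof (intro equalityI subsetI)
  fix b assume "b \<in> lifted_front_inflections M \<xi> B \<rho> \<rho>' V"
  then obtain \<gamma> I t where *: "characteristic M \<xi> V \<gamma> I" "t \<in> I" "b = \<rho> (\<gamma> t)"
    "inflection_along M B \<rho> \<rho>' (\<rho> \<circ> \<gamma>) t (\<gamma> t)"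
    unfolding lifted_front_inflections_def by blast
  then have "\<gamma> t \<in> contour M B' \<rho>' V" using inflection_along_characteristic_iff[OF V] by blast
  moreover have "\<gamma> t \<notin> characteristic_points M \<xi> V" using * by (auto simp: characteristic_def)
  ultimately show "b \<in> \<rho> ` (contour M B' \<rho>' V - characteristic_points M \<xi> V)" using *(3) by blast
next
  fix b assume "b \<in> \<rho> ` (contour M B' \<rho>' V - characteristic_points M \<xi> V)"
  then obtain p where p: "p \<in> contour M B' \<rho>' V" "p \<notin> characteristic_points M \<xi> V" "b = \<rho> p" by blast
  then have "p \<in> V" by (simp add: contour_def)
  then obtain \<gamma> I t where g: "characteristic M \<xi> V \<gamma> I" "t \<in> I" "\<gamma> t = p"
    using characteristic_through[OF V _ p(2)] by metis
  then have "inflection_along M B \<rho> \<rho>' (\<rho> \<circ> \<gamma>) t (\<gamma> t)"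
    using inflection_along_characteristic_iff[OF V g(1,2)] p(1) by simp
  then show "b \<in> lifted_front_inflections M \<xi> B \<rho> \<rho>' V"
    unfolding lifted_front_inflections_def using g p(3) by blast
qed

lemma front_inflections_eq_lifted:
  assumes "distinct_contact_elements M \<xi> B \<rho>"
  shows "front_inflections M \<xi> B \<rho> \<rho>' V = lifted_front_inflections M \<xi> B \<rho> \<rho>' V"
  unfolding front_inflections_def lifted_front_inflections_def
  using inflection_along_unique[OF characteristic_legendre_curve _ _ assms] by metis

end

theorem mainTheorem11:
  fixes M :: "('m::{t2_space,second_countable_topology}, real^3) atlas"
    and \<xi> :: "'m \<Rightarrow> ('m, real^3) tvec set"
    and B :: "('b::{t2_space,second_countable_topology}, real^2) atlas"
    and B' :: "('c::{t2_space,second_countable_topology}, real^2) atlas"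
    and \<rho> :: "'m \<Rightarrow> 'b" and \<rho>' :: "'m \<Rightarrow> 'c" and V :: "'m set"
  assumes "smooth_manifold M" and "smooth_manifold B" and "smooth_manifold B'"
    and "contact_structure M \<xi>"
    and "legendrian_fibration M \<xi> B \<rho>" and "legendrian_fibration M \<xi> B' \<rho>'"
    and "transverse_fibrations M \<rho> \<rho>'"
    and "smooth_surface M V"
  shows "characteristic_points M \<xi> V \<subseteq> contour M B' \<rho>' V \<and>
    lifted_front_inflections M \<xi> B \<rho> \<rho>' V =
      \<rho> ` (contour M B' \<rho>' V - characteristic_points M \<xi> V) \<and>
    (distinct_contact_elements M \<xi> B \<rho> \<longrightarrow>
      front_inflections M \<xi> B \<rho> \<rho>' V =
        \<rho> ` (contour M B' \<rho>' V - characteristic_points M \<xi> V))"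
proof -
  interpret legendrian_fibration_pair M \<xi> B B' \<rho> \<rho>'
    by unfold_locales (fact assms)+
  show ?thesis
    using characteristic_points_subset_contour[OF assms(8)] lifted_front_inflections_eq[OF assms(8)]
      front_inflections_eq_lifted by metis
qed

end
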